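(* Let $X,Y$ be real random variables with joint law $\mu$ on $(\mathbb{R}^2,\beta_{\mathbb{R}^2})$ and marginal laws $\mu_X,\mu_Y$ absolutely continuous with respect to Lebesgue measure $\mathscr{L}_1$ on $\mathbb{R}$, with densities $\rho_X=\frac{d\mu_X}{d\mathscr{L}_1}$, $\rho_Y=\frac{d\mu_Y}{d\mathscr{L}_1}$. For $\epsilon>0$ let $\rho_\epsilon(x,y)=\mu(B_\epsilon(x,y))/\mathscr{L}_2(B_\epsilon(0,0))$, let $l(x,y)=\{s\in(-\infty,2]:\lim_{\epsilon\to0}\epsilon^{2-s}\rho_\epsilon(x,y)=0\}$, $s(x,y)=\sup l(x,y)$, $\tilde\rho(x,y)=\lim_{\epsilon\to0}\epsilon^{2-s(x,y)}\rho_\epsilon(x,y)$ (where this limit exists), and define the (general) Lift Function \[L(x,y)=\frac{\tilde\rho(x,y)}{\rho_X(x)\rho_Y(y)}\] where $\tilde\rho(x,y)$ is defined. Let $s\in\{1,2\}$ and let $A_s\in\beta_{\mathbb{R}^2}$ be such that $s(x,y)=s$ for all $(x,y)\in A_s$ and the limit $\lim_{\epsilon\to0}\mu(B_\epsilon(x,y))/\epsilon^s$ exists and is positive and finite for $\mu$-almost every $(x,y)\in A_s$. Suppose $\mathscr{H}^s|_{A_s}$ is $\sigma$-finite, and define the measure $\nu_s$ on $(A_s,\beta_{\mathbb{R}^2}|_{A_s})$ by \[\nu_s(B)=\int_B\rho_X(x)\rho_Y(y)\,d\mathscr{H}^s|_{A_s}(x,y),\qquad B\in\beta_{\mathbb{R}^2}|_{A_s}.\]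 Then there is a constant $\alpha(s)$ such that for all $(x,y)\in A_s$, \[L(x,y)=\alpha(s)\,\frac{d\mu|_{A_s}}{d\nu_s}(x,y).\]
   Context: $\mathscr{L}_2$ is Lebesgue measure on $\mathbb{R}^2$, $B_\epsilon(x,y)$ the ball of radius $\epsilon$ centred at $(x,y)$, $\mathscr{H}^s$ the $s$-dimensional Hausdorff measure on $\mathbb{R}^2$, and $\mu|_{A}$, $\mathscr{H}^s|_A$ restrictions to $A$. The equality is understood for a suitable version of the Radon–Nikodym derivative. *)

theory Defs
  imports "HOL-Probability.Probability"
begin

(* s-dimensional Hausdorff measure (unnormalised: sum of diam^s) on a metric space,
   restricted to the Borel sets. *)
definition hausdorff_pre :: "real \<Rightarrow> real \<Rightarrow> 'a::metric_space set \<Rightarrow> ennreal" where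
  "hausdorff_pre s \<delta> S =
     (INF C \<in> {C :: nat \<Rightarrow> 'a set. S \<subseteq> (\<Union>n. C n) \<and> (\<forall>n. bounded (C n) \<and> diameter (C n) \<le> \<delta>)}.
        (\<Sum>n. ennreal (diameter (C n) powr s)))"

definition hausdorff_outer :: "real \<Rightarrow> 'a::metric_space set \<Rightarrow> ennreal" where
  "hausdorff_outer s S = (SUP \<delta> \<in> {0<..}. hausdorff_pre s \<delta> S)"

definition hausdorff_measure :: "real \<Rightarrow> 'a::metric_space measure" where
  "hausdorff_measure s = measure_of UNIV (sets borel) (hausdorff_outer s)"

definition rho_eps :: "(real \<times> real) measure \<Rightarrow> real \<Rightarrow> real \<times> real \<Rightarrow> real" where
  "rho_eps \<mu> \<epsilon> p = measure \<mu> (ball p \<epsilon>) / measure lborel (ball (0::real\<times>real) \<epsilon>)"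

definition l_set :: "(real \<times> real) measure \<Rightarrow> real \<times> real \<Rightarrow> real set" where
  "l_set \<mu> p = {s. s \<le> 2 \<and> ((\<lambda>\<epsilon>. \<epsilon> powr (2 - s) * rho_eps \<mu> \<epsilon> p) \<longlongrightarrow> 0) (at_right 0)}"

(* s(x,y) = sup l(x,y), in the extended reals (sup of the empty set is -\<infinity>) *)
definition s_fun :: "(real \<times> real) measure \<Rightarrow> real \<times> real \<Rightarrow> ereal" where
  "s_fun \<mu> p = Sup (ereal ` l_set \<mu> p)"

definition rho_tilde_defined :: "(real \<times> real) measure \<Rightarrow> real \<times> real \<Rightarrow> bool" where
  "rho_tilde_defined \<mu> p \<longleftrightarrow> \<bar>s_fun \<mu> p\<bar> \<noteq> \<infinity> \<and>
     (\<exists>c. ((\<lambda>\<epsilon>. \<epsilon> powr (2 - real_of_ereal (s_fun \<mu> p)) * rho_eps \<mu> \<epsilon> p) \<longlongrightarrow> c) (at_right 0))"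

definition rho_tilde :: "(real \<times> real) measure \<Rightarrow> real \<times> real \<Rightarrow> real" where
  "rho_tilde \<mu> p = Lim (at_right 0) (\<lambda>\<epsilon>. \<epsilon> powr (2 - real_of_ereal (s_fun \<mu> p)) * rho_eps \<mu> \<epsilon> p)"

definition lift :: "(real \<times> real) measure \<Rightarrow> (real \<Rightarrow> real) \<Rightarrow> (real \<Rightarrow> real) \<Rightarrow> real \<times> real \<Rightarrow> real" where
  "lift \<mu> \<rho>X \<rho>Y p = rho_tilde \<mu> p / (\<rho>X (fst p) * \<rho>Y (snd p))"

definition lift_defined :: "(real \<times> real) measure \<Rightarrow> (real \<Rightarrow> real) \<Rightarrow> (real \<Rightarrow> real) \<Rightarrow> real \<times> real \<Rightarrow> bool" where
  "lift_defined \<mu> \<rho>X \<rho>Y p \<longleftrightarrow> rho_tilde_defined \<mu> p \<and> \<rho>X (fst p) * \<rho>Y (snd p) \<noteq> 0"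

end

theory Submission
  imports Defs "HOL-Library.Diagonal_Subsequence"
begin

text \<open>
  Where the density \<open>\<Theta>(p) = lim \<mu>(B(p,r)) / r^s\<close> exists, the lift function is
  \<open>\<Theta> / (\<pi> \<rho>X \<rho>Y)\<close>, so the theorem amounts to \<open>\<mu> = \<kappa> \<Theta> \<H>^s\<close> on the set where \<open>0 < \<Theta> < \<infinity>\<close>,
  with a constant \<open>\<kappa>\<close> that depends only on \<open>s\<close>. This follows from the estimates
  \<open>\<kappa> a \<H>^s(F) \<le> \<mu>(F) \<le> \<kappa> b \<H>^s(F)\<close> for Borel sets \<open>F\<close> on which \<open>a < \<Theta> < b\<close>; the lower one is a
  Vitali covering argument.

  For \<open>s = 2\<close>, \<open>\<H>^2\<close> is a multiple of Lebesgue measure by translation invariance, and Vitali's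
  argument with the roles of the two measures exchanged gives the upper estimate.

  For \<open>s = 1\<close> covering a set by a ball about one of its points loses a factor 2. To recover it,
  one shows that at almost every point small sets \<open>C\<close> satisfy \<open>\<mu>(C) \<le> (\<Theta>/2 + h) diam C\<close>. Blowing up
  at a density point yields in the limit a closed set \<open>S\<close> that supports a mass which gives
  \<open>\<Theta> r\<close> to every ball of radius \<open>r\<close> centred in \<open>S\<close>. Such a set is a line: if \<open>y\<close>, \<open>y'\<close> are two points
  of \<open>S\<close> at distance \<open>d\<close> from \<open>x\<close> in \<open>S\<close>, the balls of radii \<open>d - \<sigma>\<close>, \<open>\<sigma>\<close>, \<open>\<sigma>\<close> about \<open>x\<close>, \<open>y\<close>, \<open>y'\<close>
  use up all the mass of the ball of radius \<open>d + \<sigma>\<close> about \<open>x\<close>, which forces \<open>S\<close> to consist of the two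
  rays from \<open>x\<close> through \<open>y\<close> and \<open>y'\<close>, for every choice of \<open>x\<close>.
\<close>

section \<open>Hausdorff measure\<close>

text \<open>The two estimates must carry the same constant \<kappa>. Cutting a set into slices on
  which \<Theta> varies by a factor close to 1 then gives equality in the limit, whereas a gap
  between the constants would survive the cutting. The obstacle is that Hausdorff measure admits
  arbitrary covering sets, while the hypothesis controls centred balls only. In full dimension
  Lebesgue measure, whose value on balls is known, serves as an intermediary, so neither the
  isodiametric inequality nor the exact Hausdorff measure of a disc enters. For s = 1 there is no
  such reference measure, and a sharp mass bound for arbitrary small sets has to come from the
  geometry of blow-ups; there \<kappa> = 1/2 is the ratio of radius to diameter of a ball. No limit
  measure is constructed: limits are taken of sets only, and the measure is remembered through two
  inequalities between radii, one for packings and one for coverings by balls centred in the limit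
  set. Since \<kappa> is fixed before \<mu>, the constant 1/(\<pi> \<kappa>) depends on s
  alone.\<close>

lemma hausdorff_pre_mono: "S \<subseteq> T \<Longrightarrow> hausdorff_pre s \<delta> S \<le> hausdorff_pre s \<delta> T"
  unfolding hausdorff_pre_def by (intro INF_superset_mono) auto

lemma hausdorff_pre_antimono: "\<delta> \<le> \<delta>' \<Longrightarrow> hausdorff_pre s \<delta>' S \<le> hausdorff_pre s \<delta> S"
  unfolding hausdorff_pre_def by (intro INF_superset_mono) (auto intro: order_trans)

lemma hausdorff_pre_le:
  assumes "S \<subseteq> (\<Union>n. C n)" "\<And>n. bounded (C n)" "\<And>n. diameter (C n) \<le> \<delta>"
  shows "hausdorff_pre s \<delta> S \<le> (\<Sum>n. ennreal (diameter (C n) powr s))"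
  unfolding hausdorff_pre_def using assms by (intro INF_lower) auto

lemma hausdorff_pre_lessE:
  assumes "hausdorff_pre s \<delta> S < e"
  obtains C where "S \<subseteq> (\<Union>n. C n)" "\<And>n. bounded (C n)" "\<And>n. diameter (C n) \<le> \<delta>"
    "(\<Sum>n. ennreal (diameter (C n) powr s)) < e"
  using assms unfolding hausdorff_pre_def INF_less_iff by auto

lemma hausdorff_pre_le_outer: "\<delta> > 0 \<Longrightarrow> hausdorff_pre s \<delta> S \<le> hausdorff_outer s S"
  unfolding hausdorff_outer_def by (intro SUP_upper) auto

lemma hausdorff_outer_leI:
  assumes "\<And>\<delta>. \<delta> > 0 \<Longrightarrow> hausdorff_pre s \<delta> S \<le> c"
  shows "hausdorff_outer s S \<le> c"
  unfolding hausdorff_outer_def using assms by (intro SUP_least) auto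

lemma hausdorff_outer_mono: "S \<subseteq> T \<Longrightarrow> hausdorff_outer s S \<le> hausdorff_outer s T"
  unfolding hausdorff_outer_def by (intro SUP_mono) (auto intro: hausdorff_pre_mono)

lemma hausdorff_outer_empty [simp]: "hausdorff_outer s ({}::'a::metric_space set) = 0"
proof -
  \<comment> \<open>\<open>diameter {} = 0\<close> and \<open>0 powr s = 0\<close> for every s, so
    empty sets pad any cover at no cost.\<close>
  have "hausdorff_pre s \<delta> ({}::'a set) \<le> 0" if "\<delta> > 0" for \<delta>
    using hausdorff_pre_le[of "{}" "\<lambda>_. {}" \<delta> s] that by auto
  then show ?thesis
    using hausdorff_outer_leI by (metis le_zero_eq)
qed

lemma hausdorff_pre_UN:
  "hausdorff_pre s \<delta> (\<Union>n. A n) \<le> (\<Sum>n. hausdorff_pre s \<delta> (A n))"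
proof (rule ennreal_le_epsilon)
  fix e :: real assume "0 < e" "(\<Sum>n. hausdorff_pre s \<delta> (A n)) < top"
  \<comment> \<open>Finiteness of the sum makes every summand finite, which is what makes the
    inequality strict.\<close>
  then have *: "\<And>n. hausdorff_pre s \<delta> (A n) < hausdorff_pre s \<delta> (A n) + e * (1/2)^Suc n"
    by (auto simp add: less_top dest!: ennreal_suminf_lessD)
  have "\<forall>n. \<exists>C. A n \<subseteq> (\<Union>i. C i) \<and> (\<forall>i. bounded (C i) \<and> diameter (C i) \<le> \<delta>) \<and>
     (\<Sum>i. ennreal (diameter (C i) powr s)) < hausdorff_pre s \<delta> (A n) + e * (1/2)^Suc n"
    using hausdorff_pre_lessE[OF *] by metis
  then obtain B where B: "\<And>n. A n \<subseteq> (\<Union>i. B n i)" "\<And>n i. bounded (B n i)"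
      "\<And>n i. diameter (B n i) \<le> \<delta>"
      "\<And>n. (\<Sum>i. ennreal (diameter (B n i) powr s)) < hausdorff_pre s \<delta> (A n) + e * (1/2)^Suc n"
    by metis
  define C where "C = case_prod B o prod_decode"
  have "(\<Union>i. A i) \<subseteq> (\<Union>i. C i)"
    using B(1) by (auto simp add: C_def subset_eq) (metis prod.case prod_encode_inverse)
  then have "hausdorff_pre s \<delta> (\<Union>n. A n) \<le> (\<Sum>i. ennreal (diameter (C i) powr s))"
    using B by (intro hausdorff_pre_le) (auto simp: C_def split: prod.split)
  also have "\<dots> = (\<Sum>n. \<Sum>i. ennreal (diameter (B n i) powr s))"
  proof -
    define f where "f = (\<lambda>p. ennreal (diameter (case_prod B p) powr s))"
    have "(\<Sum>i. f (prod_decode i)) = (\<Sum>n. \<Sum>i. f (n, i))"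
      by (rule suminf_ennreal_2dimen) simp
    then show ?thesis
      by (simp add: f_def C_def)
  qed
  also have "\<dots> \<le> (\<Sum>n. hausdorff_pre s \<delta> (A n) + e * (1/2) ^ Suc n)"
    using B(4) by (intro suminf_le less_imp_le) auto
  also have "... = (\<Sum>n. hausdorff_pre s \<delta> (A n)) + (\<Sum>n. ennreal e * ennreal ((1/2) ^ Suc n))"
    using \<open>0 < e\<close> by (subst suminf_add[symmetric])
                     (auto simp del: ennreal_suminf_cmult simp add: ennreal_mult[symmetric])
  also have "\<dots> = (\<Sum>n. hausdorff_pre s \<delta> (A n)) + e"
    unfolding ennreal_suminf_cmult
    by (subst suminf_ennreal_eq[OF zero_le_power power_half_series]) auto
  finally show "hausdorff_pre s \<delta> (\<Union>n. A n) \<le> (\<Sum>n. hausdorff_pre s \<delta> (A n)) + e" .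
qed

lemma hausdorff_outer_UN: "hausdorff_outer s (\<Union>n. A n) \<le> (\<Sum>n. hausdorff_outer s (A n))"
proof (rule hausdorff_outer_leI)
  fix \<delta> :: real assume "\<delta> > 0"
  have "hausdorff_pre s \<delta> (\<Union>n. A n) \<le> (\<Sum>n. hausdorff_pre s \<delta> (A n))"
    by (rule hausdorff_pre_UN)
  also have "\<dots> \<le> (\<Sum>n. hausdorff_outer s (A n))"
    using \<open>\<delta> > 0\<close> by (intro suminf_le hausdorff_pre_le_outer) auto
  finally show "hausdorff_pre s \<delta> (\<Union>n. A n) \<le> (\<Sum>n. hausdorff_outer s (A n))" .
qed

lemma hausdorff_outer_Un: "hausdorff_outer s (A \<union> B) \<le> hausdorff_outer s A + hausdorff_outer s B"
proof -
  have "hausdorff_outer s (\<Union>n::nat. if n = 0 then A else if n = 1 then B else {})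
      \<le> (\<Sum>n. hausdorff_outer s (if n = 0 then A else if n = 1 then B else {}))"
    by (rule hausdorff_outer_UN)
  also have "(\<Union>n::nat. if n = 0 then A else if n = 1 then B else {}) = A \<union> B"
    by (auto split: if_splits)
  also have "(\<Sum>n::nat. hausdorff_outer s (if n = 0 then A else if n = 1 then B else {}))
      = hausdorff_outer s A + hausdorff_outer s B"
    by (subst suminf_finite[of "{0, 1}"]) auto
  finally show ?thesis .
qed

section \<open>Metric outer measures: Borel sets are Caratheodory measurable\<close>

lemma outer_measure_space_hausdorff:
  "outer_measure_space (Pow UNIV) (hausdorff_outer s :: 'a::metric_space set \<Rightarrow> ennreal)"
  unfolding outer_measure_space_def
  by (auto simp: positive_def increasing_def countably_subadditive_def
      intro: hausdorff_outer_mono hausdorff_outer_UN)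

text \<open>A set of diameter at most \<delta> cannot meet both A and B, so a cover of the union
  splits into a cover of A and a cover of B without using any set twice.\<close>

lemma hausdorff_pre_separated:
  assumes sep: "\<And>x y. x \<in> A \<Longrightarrow> y \<in> B \<Longrightarrow> \<delta> < dist x y" and "\<delta> \<ge> 0"
  shows "hausdorff_pre s \<delta> A + hausdorff_pre s \<delta> B \<le> hausdorff_pre s \<delta> (A \<union> B)"
  unfolding hausdorff_pre_def[of s \<delta> "A \<union> B"]
proof (intro INF_greatest, clarify)
  fix C :: "nat \<Rightarrow> 'a set"
  assume C: "A \<union> B \<subseteq> (\<Union>n. C n)" "\<forall>n. bounded (C n) \<and> diameter (C n) \<le> \<delta>"
  define C1 where "C1 = (\<lambda>n. if C n \<inter> A = {} then {} else C n)"
  define C2 where "C2 = (\<lambda>n. if C n \<inter> B = {} then {} else C n)"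
  have disj: "C n \<inter> A = {} \<or> C n \<inter> B = {}" for n
  proof (rule ccontr)
    assume "\<not> ?thesis"
    then obtain x y where xy: "x \<in> C n" "x \<in> A" "y \<in> C n" "y \<in> B" by blast
    then have "dist x y \<le> \<delta>"
      using C diameter_bounded_bound by (metis order_trans)
    with sep xy show False by force
  qed
  have "hausdorff_pre s \<delta> A \<le> (\<Sum>n. ennreal (diameter (C1 n) powr s))"
  proof (rule hausdorff_pre_le)
    show "A \<subseteq> (\<Union>n. C1 n)"
    proof
      fix x assume "x \<in> A"
      then obtain n where "x \<in> C n" using C by blast
      with \<open>x \<in> A\<close> have "x \<in> C1 n" unfolding C1_def by auto
      then show "x \<in> (\<Union>n. C1 n)" by blast
    qed
  qed (use C \<open>\<delta> \<ge> 0\<close> in \<open>simp_all add: C1_def\<close>)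
  moreover have "hausdorff_pre s \<delta> B \<le> (\<Sum>n. ennreal (diameter (C2 n) powr s))"
  proof (rule hausdorff_pre_le)
    show "B \<subseteq> (\<Union>n. C2 n)"
    proof
      fix x assume "x \<in> B"
      then obtain n where "x \<in> C n" using C by blast
      with \<open>x \<in> B\<close> have "x \<in> C2 n" unfolding C2_def by auto
      then show "x \<in> (\<Union>n. C2 n)" by blast
    qed
  qed (use C \<open>\<delta> \<ge> 0\<close> in \<open>simp_all add: C2_def\<close>)
  ultimately have "hausdorff_pre s \<delta> A + hausdorff_pre s \<delta> B
     \<le> (\<Sum>n. ennreal (diameter (C1 n) powr s)) + (\<Sum>n. ennreal (diameter (C2 n) powr s))"
    by (rule add_mono)
  also have "\<dots> = (\<Sum>n. ennreal (diameter (C1 n) powr s) + ennreal (diameter (C2 n) powr s))"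
    by (rule suminf_add) auto
  also have "\<dots> \<le> (\<Sum>n. ennreal (diameter (C n) powr s))"
    using disj by (intro suminf_le) (auto simp: C1_def C2_def)
  finally show "hausdorff_pre s \<delta> A + hausdorff_pre s \<delta> B \<le> (\<Sum>n. ennreal (diameter (C n) powr s))" .
qed

lemma hausdorff_outer_separated:
  assumes sep: "\<And>x y. x \<in> A \<Longrightarrow> y \<in> B \<Longrightarrow> \<eta> \<le> dist x y" and "\<eta> > 0"
  shows "hausdorff_outer s A + hausdorff_outer s B \<le> hausdorff_outer s (A \<union> B)"
proof -
  have *: "hausdorff_pre s \<delta> A + hausdorff_pre s \<delta>' B \<le> hausdorff_outer s (A \<union> B)"
    if "\<delta> > 0" "\<delta>' > 0" for \<delta> \<delta>'
  proof -
    \<comment> \<open>One scale below \<delta>, \<delta>' and \<eta>: there covers of the union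
      split, and refining the scale only increases the two summands.\<close>
    define e where "e = min (\<eta> / 2) (min \<delta> \<delta>')"
    have e: "0 < e" "e \<le> \<delta>" "e \<le> \<delta>'" "e < \<eta>"
      using that \<open>\<eta> > 0\<close> by (auto simp: e_def)
    have "hausdorff_pre s \<delta> A + hausdorff_pre s \<delta>' B \<le> hausdorff_pre s e A + hausdorff_pre s e B"
      using e by (intro add_mono hausdorff_pre_antimono)
    also have "\<dots> \<le> hausdorff_pre s e (A \<union> B)"
      using sep e by (intro hausdorff_pre_separated) force+
    also have "\<dots> \<le> hausdorff_outer s (A \<union> B)"
      using e by (intro hausdorff_pre_le_outer)
    finally show ?thesis .
  qed
  have ne: "{0<..} \<noteq> ({}::real set)"
    by auto
  have "hausdorff_pre s \<delta> A + hausdorff_outer s B \<le> hausdorff_outer s (A \<union> B)" if "\<delta> > 0" for \<delta>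
    unfolding hausdorff_outer_def[of s B] ennreal_SUP_add_right[OF ne]
    using * that by (intro SUP_least) auto
  then show ?thesis
    unfolding hausdorff_outer_def[of s A] ennreal_SUP_add_left[OF ne, symmetric]
    by (intro SUP_least) auto
qed

text \<open>Caratheodory's argument. The part \<open>A k\<close> of X at distance at least 1/(k+1)
  from F satisfies the inequality by separation, so it remains to see that the shells
  \<open>D j\<close> with large j contribute little. Shells whose indices differ by at least 2 are
  separated; hence the sums over even and over odd indices are each bounded by the measure of X, and
  the series converges.\<close>

lemma hausdorff_outer_caratheodory:
  fixes F :: "'a::metric_space set"
  assumes "closed F"
  shows "hausdorff_outer s (X \<inter> F) + hausdorff_outer s (X - F) \<le> hausdorff_outer s X"
proof (cases "F = {} \<or> hausdorff_outer s X = \<top>")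
  \<comment> \<open>For empty F, \<open>infdist\<close> is 0 by convention and would not exhaust X;
    that case and the case of infinite measure are immediate.\<close>
  case False
  then have "F \<noteq> {}" and fin: "hausdorff_outer s X < \<top>" by (auto simp: less_top)
  define A where "A = (\<lambda>k::nat. {x\<in>X. 1 / real (k + 1) \<le> infdist x F})"
  define D where "D = (\<lambda>k. A (Suc k) - A k)"
  have A_mono: "A k \<subseteq> A l" if "k \<le> l" for k l
    using that by (auto simp: A_def elim!: order_trans[rotated] intro!: divide_left_mono)
  have X_eq: "X - F = (\<Union>k. A k)"
  proof (intro equalityI subsetI)
    fix x assume x: "x \<in> X - F"
    then have "infdist x F > 0"
      using \<open>F \<noteq> {}\<close> \<open>closed F\<close> infdist_pos_not_in_closed by blast
    then obtain k where "1 / real (k + 1) < infdist x F"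
      by (metis Suc_eq_plus1 inverse_eq_divide reals_Archimedean)
    with x show "x \<in> (\<Union>k. A k)" by (auto simp: A_def intro: less_imp_le)
  qed (auto simp: A_def divide_simps)
  have 1: "hausdorff_outer s (X \<inter> F) + hausdorff_outer s (A k) \<le> hausdorff_outer s X" for k
  proof -
    have "hausdorff_outer s (X \<inter> F) + hausdorff_outer s (A k) \<le> hausdorff_outer s (X \<inter> F \<union> A k)"
    proof (rule hausdorff_outer_separated)
      fix x y assume "x \<in> X \<inter> F" "y \<in> A k"
      then show "1 / real (k + 1) \<le> dist x y"
        using infdist_le[of x F y] by (auto simp: A_def dist_commute)
    qed auto
    also have "\<dots> \<le> hausdorff_outer s X"
      by (intro hausdorff_outer_mono) (auto simp: A_def)
    finally show ?thesis .
  qed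
  have sep: "hausdorff_outer s (A k) + hausdorff_outer s (D (Suc k)) \<le> hausdorff_outer s (A k \<union> D (Suc k))"
    for k
  proof (rule hausdorff_outer_separated)
    fix x y assume "x \<in> A k" "y \<in> D (Suc k)"
    then have "1 / real (k + 1) \<le> infdist x F" "infdist y F < 1 / real (k + 2)"
      by (auto simp: A_def D_def)
    then show "1 / real (k + 1) - 1 / real (k + 2) \<le> dist x y"
      using infdist_triangle[of x F y] by linarith
  qed (simp add: frac_less2)
  \<comment> \<open>The last shell has index \<open>2 * (n - 1) + i\<close> and lies in the next
    \<open>A\<close>. Subtraction on naturals truncates only when \<open>2 * n + i = 0\<close>,
    which the induction step treats separately.\<close>
  have parity: "(\<Sum>j<n. hausdorff_outer s (D (2 * j + i))) \<le> hausdorff_outer s (A (2 * n + i - 1))"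
    if "i \<le> 1" for n i
  proof (induction n)
    case (Suc n)
    show ?case
    proof (cases "2 * n + i = 0")
      case True
      then show ?thesis
        by (auto simp: D_def intro!: hausdorff_outer_mono)
    next
      case False
      define m where "m = 2 * n + i - 1"
      have m: "Suc m = 2 * n + i" "2 * Suc n + i - 1 = Suc (Suc m)" using False by (auto simp: m_def)
      have "(\<Sum>j<Suc n. hausdorff_outer s (D (2 * j + i)))
          \<le> hausdorff_outer s (A m) + hausdorff_outer s (D (Suc m))"
        using Suc unfolding m_def[symmetric] m(1) by (simp add: add_right_mono)
      also have "\<dots> \<le> hausdorff_outer s (A m \<union> D (Suc m))"
        by (rule sep)
      also have "\<dots> \<le> hausdorff_outer s (A (2 * Suc n + i - 1))"
        unfolding m(2) using A_mono[of m "Suc (Suc m)"] by (intro hausdorff_outer_mono) (auto simp: D_def)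
      finally show ?thesis .
    qed
  qed auto
  have A_le: "hausdorff_outer s (A k) \<le> hausdorff_outer s X" for k
    by (intro hausdorff_outer_mono) (auto simp: A_def)
  define a where "a = (\<lambda>j. enn2real (hausdorff_outer s (D j)))"
  have a: "ennreal (a j) = hausdorff_outer s (D j)" for j
  proof -
    have "hausdorff_outer s (D j) \<le> hausdorff_outer s X"
      by (intro hausdorff_outer_mono) (auto simp: A_def D_def)
    then show ?thesis
      using fin by (simp add: a_def)
  qed
  have a_nonneg: "0 \<le> a j" for j
    by (simp add: a_def)
  define M where "M = enn2real (hausdorff_outer s X)"
  have M: "ennreal M = hausdorff_outer s X" "0 \<le> M"
    using fin by (auto simp: M_def)
  have par: "(\<Sum>j<n. a (2 * j + i)) \<le> M" if "i \<le> 1" for n i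
  proof -
    have "ennreal (\<Sum>j<n. a (2 * j + i)) \<le> ennreal M"
      unfolding M(1) using order_trans[OF parity[OF that] A_le]
      by (simp add: sum_ennreal[symmetric] a_nonneg a)
    then show ?thesis
      using M(2) by (simp add: ennreal_le_iff)
  qed
  have "(\<Sum>j<n. a j) \<le> 2 * M" for n
  proof -
    have "(\<Sum>j<2 * n. a j) = (\<Sum>j<n. a (2 * j + 0)) + (\<Sum>j<n. a (2 * j + 1))"
      by (induction n) auto
    moreover have "(\<Sum>j<n. a j) \<le> (\<Sum>j<2 * n. a j)"
      using a_nonneg by (intro sum_mono2) auto
    ultimately show ?thesis using par[of 0 n] par[of 1 n] by linarith
  qed
  then have "summable a"
    using a_nonneg by (intro summableI_nonneg_bounded) auto
  show ?thesis
  proof (rule ennreal_le_epsilon)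
    fix e :: real assume "e > 0"
    then obtain N where N: "\<And>n. n \<ge> N \<Longrightarrow> norm (\<Sum>i. a (i + n)) < e"
      using suminf_exist_split[OF _ \<open>summable a\<close>] by blast
    have tail: "(\<Sum>i. hausdorff_outer s (D (i + N))) \<le> ennreal e"
    proof -
      have "(\<Sum>i. hausdorff_outer s (D (i + N))) = ennreal (\<Sum>i. a (i + N))"
        unfolding a[symmetric] using \<open>summable a\<close> a_nonneg by (intro suminf_ennreal2) (auto simp: summable_iff_shift)
      then show ?thesis
        using N[of N] by (auto intro!: ennreal_leI)
    qed
    have "X - F \<subseteq> A N \<union> (\<Union>i. D (i + N))"
    proof
      fix x assume "x \<in> X - F"
      then obtain k where "x \<in> A k" using X_eq by auto
      show "x \<in> A N \<union> (\<Union>i. D (i + N))"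
      proof (cases "x \<in> A N")
        case False
        have "\<exists>i. x \<notin> A (i + N) \<and> x \<in> A (Suc i + N)"
        proof (rule ccontr)
          assume "\<not> ?thesis"
          then have "x \<notin> A (i + N)" for i
            using False by (induction i) auto
          with \<open>x \<in> A k\<close> show False
            using A_mono[of k "k + N"] by auto
        qed
        then show ?thesis by (auto simp: D_def)
      qed auto
    qed
    then have "hausdorff_outer s (X - F) \<le> hausdorff_outer s (A N) + hausdorff_outer s (\<Union>i. D (i + N))"
      by (meson hausdorff_outer_Un hausdorff_outer_mono order_trans)
    also have "\<dots> \<le> hausdorff_outer s (A N) + ennreal e"
      using hausdorff_outer_UN[of s "\<lambda>i. D (i + N)"] tail by (meson add_left_mono order_trans)
    finally have "hausdorff_outer s (X \<inter> F) + hausdorff_outer s (X - F)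
        \<le> hausdorff_outer s (X \<inter> F) + hausdorff_outer s (A N) + ennreal e"
      by (simp add: add.assoc add_left_mono)
    also have "\<dots> \<le> hausdorff_outer s X + ennreal e"
      using 1[of N] by (rule add_right_mono)
    finally show "hausdorff_outer s (X \<inter> F) + hausdorff_outer s (X - F) \<le> hausdorff_outer s X + ennreal e" .
  qed
qed (auto simp: hausdorff_outer_mono)

text \<open>\<open>measure_of\<close> falls back to the zero measure when the set function is not
  countably additive; this fact is what gives \<open>hausdorff_measure\<close> its intended
  values.\<close>

lemma measure_space_hausdorff:
  "measure_space UNIV (sets borel) (hausdorff_outer s :: 'a::metric_space set \<Rightarrow> ennreal)"
proof -
  interpret sigma_algebra "UNIV::'a set" "Pow UNIV"
    by (rule sigma_algebra_Pow)
  define L where "L = lambda_system UNIV (Pow UNIV) (hausdorff_outer s :: 'a set \<Rightarrow> ennreal)"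
  have ms: "measure_space UNIV L (hausdorff_outer s)"
    unfolding L_def by (rule caratheodory_lemma[OF outer_measure_space_hausdorff])
  then have sa: "sigma_algebra UNIV L"
    by (simp add: measure_space_def)
  have "closed F \<Longrightarrow> F \<in> L" for F :: "'a set"
    unfolding L_def lambda_system_eq using hausdorff_outer_Un[of s "X \<inter> F" "X - F" for X]
    by (auto intro!: antisym[OF hausdorff_outer_caratheodory] simp: Int_Diff_Un)
  then have "sets borel \<subseteq> L"
    using sigma_algebra.sigma_sets_subset[OF sa, of "Collect closed"]
    by (auto simp: borel_eq_closed)
  then show ?thesis
    by (intro measure_down[OF ms]) (metis sets.sigma_algebra_axioms space_borel)
qed

lemma sets_hausdorff_measure [simp, measurable_cong]: "sets (hausdorff_measure s) = sets borel"
  unfolding hausdorff_measure_def by (metis sets.sets_measure_of_eq space_borel)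

lemma space_hausdorff_measure [simp]: "space (hausdorff_measure s) = UNIV"
  unfolding hausdorff_measure_def by (simp add: space_measure_of_conv)

lemma emeasure_hausdorff_measure:
  assumes "B \<in> sets borel"
  shows "emeasure (hausdorff_measure s) B = hausdorff_outer s B"
  unfolding hausdorff_measure_def
  by (rule emeasure_measure_of_sigma)
    (use assms measure_space_hausdorff[of s] in \<open>auto simp: measure_space_def\<close>)

section \<open>Translation invariance\<close>

lemma hausdorff_outer_translate_le:
  fixes S :: "'a::real_normed_vector set"
  shows "hausdorff_outer s ((+) a ` S) \<le> hausdorff_outer s S"
proof (rule hausdorff_outer_leI)
  fix \<delta> :: real assume "\<delta> > 0"
  have "hausdorff_pre s \<delta> ((+) a ` S) \<le> hausdorff_pre s \<delta> S"
    unfolding hausdorff_pre_def[of s \<delta> S]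
  proof (intro INF_greatest, clarify)
    fix C :: "nat \<Rightarrow> 'a set"
    assume C: "S \<subseteq> (\<Union>n. C n)" "\<forall>n. bounded (C n) \<and> diameter (C n) \<le> \<delta>"
    have diam: "diameter ((+) a ` C n) = diameter (C n)" for n
      unfolding diameter_def by (auto simp: image_iff intro!: SUP_cong arg_cong[where f=Sup]) blast+
    have "hausdorff_pre s \<delta> ((+) a ` S) \<le> (\<Sum>n. ennreal (diameter ((+) a ` C n) powr s))"
    proof (rule hausdorff_pre_le)
      show "(+) a ` S \<subseteq> (\<Union>n. (+) a ` C n)"
        using C by blast
    qed (use C in \<open>simp_all add: diam bounded_translation\<close>)
    then show "hausdorff_pre s \<delta> ((+) a ` S) \<le> (\<Sum>n. ennreal (diameter (C n) powr s))"
      by (simp add: diam)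
  qed
  also have "\<dots> \<le> hausdorff_outer s S"
    using \<open>\<delta> > 0\<close> by (rule hausdorff_pre_le_outer)
  finally show "hausdorff_pre s \<delta> ((+) a ` S) \<le> hausdorff_outer s S" .
qed

lemma hausdorff_outer_translate:
  fixes S :: "'a::real_normed_vector set"
  shows "hausdorff_outer s ((+) a ` S) = hausdorff_outer s S"
  using hausdorff_outer_translate_le[of s a S] hausdorff_outer_translate_le[of s "- a" "(+) a ` S"]
  by (simp add: image_image antisym)

section \<open>Covering arguments\<close>

text \<open>The Vitali family is disjoint and its fivefold enlargement covers F. Finitely many of
  its balls already account for almost the whole sum, so only the others are enlarged; in this way
  the factor 5^s falls on a negligible remainder and the bound \<open>measure \<nu> U / t\<close> is
  sharp. Centres in F are recorded because one application needs a density bound at them.\<close>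

lemma vitali_cover_sequence:
  fixes \<nu> :: "'a::euclidean_space measure"
  assumes sets: "sets \<nu> = sets borel" and U: "open U" "F \<subseteq> U" "emeasure \<nu> U \<noteq> \<infinity>" and "F \<noteq> {}"
    and pos: "t > 0" "\<delta> > 0" "\<eta> > 0"
    and dens: "\<And>p d. p \<in> F \<Longrightarrow> d > 0 \<Longrightarrow> \<exists>r>0. r < d \<and> t * r powr s \<le> measure \<nu> (cball p r)"
  obtains x :: "nat \<Rightarrow> 'a" and R where "range x \<subseteq> F" "\<And>i. 0 \<le> R i" "\<And>i. R i \<le> \<delta>"
    "F \<subseteq> (\<Union>i. cball (x i) (R i))"
    "(\<Sum>i. ennreal (R i powr s)) \<le> ennreal (measure \<nu> U / t + \<eta>)"
proof -
  \<comment> \<open>The bound \<open>5 * r \<le> \<delta>\<close> leaves room for the later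
    enlargement.\<close>
  define K where "K = {(p, r). p \<in> F \<and> 0 < r \<and> 5 * r \<le> \<delta> \<and> cball p r \<subseteq> U \<and> t * r powr s \<le> measure \<nu> (cball p r)}"
  have K: "0 < snd i \<and> snd i \<le> \<delta>" if "i \<in> K" for i
    using that by (auto simp: K_def)
  obtain C where C: "countable C" "C \<subseteq> K"
     "pairwise (\<lambda>i j. disjnt (cball (fst i) (snd i)) (cball (fst j) (snd j))) C"
     "\<And>i. i \<in> K \<Longrightarrow> \<exists>j. j \<in> C \<and> \<not> disjnt (cball (fst i) (snd i)) (cball (fst j) (snd j)) \<and>
                        cball (fst i) (snd i) \<subseteq> ball (fst j) (5 * snd j)"
    by (rule Vitali_covering_lemma_cballs_balls[OF K, where a = fst]) (blast intro: that)+
  have CK: "fst c \<in> F" "snd c > 0" "5 * snd c \<le> \<delta>" "cball (fst c) (snd c) \<subseteq> U"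
     "t * snd c powr s \<le> measure \<nu> (cball (fst c) (snd c))" if "c \<in> C" for c
    using subsetD[OF C(2) that] unfolding K_def by (simp_all add: case_prod_unfold)
  have U_sets: "U \<in> sets \<nu>"
    using U(1) by (simp add: sets)
  have sum_le: "(\<Sum>c\<in>C'. snd c powr s) \<le> measure \<nu> U / t" if C': "finite C'" "C' \<subseteq> C" for C'
  proof -
    have "t * (\<Sum>c\<in>C'. snd c powr s) \<le> (\<Sum>c\<in>C'. measure \<nu> (cball (fst c) (snd c)))"
      unfolding sum_distrib_left using CK C' by (intro sum_mono) auto
    also have "\<dots> = measure \<nu> (\<Union>c\<in>C'. cball (fst c) (snd c))"
    proof (rule measure_finite_Union[symmetric])
      show "disjoint_family_on (\<lambda>c. cball (fst c) (snd c)) C'"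
        using C(3) C' unfolding disjoint_family_on_def pairwise_def disjnt_def by blast
      show "emeasure \<nu> (cball (fst c) (snd c)) \<noteq> \<infinity>" if "c \<in> C'" for c
        using emeasure_mono[OF CK(4) U_sets, of c] U(3) C' that by (auto simp: top_unique)
    qed (use C' sets in auto)
    also have "\<dots> \<le> measure \<nu> U"
    proof (rule measure_mono_fmeasurable)
      show "(\<Union>c\<in>C'. cball (fst c) (snd c)) \<subseteq> U"
        using CK(4) C' by blast
    qed (use C' U(3) U_sets sets in \<open>auto simp: fmeasurable_def less_top intro!: sets.finite_UN\<close>)
    finally show ?thesis
      using pos by (simp add: field_simps)
  qed
  define \<sigma> where "\<sigma> = (SUP C' \<in> {C'. finite C' \<and> C' \<subseteq> C}. \<Sum>c\<in>C'. snd c powr s)"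
  have bdd: "bdd_above ((\<lambda>C'. \<Sum>c\<in>C'. snd c powr s) ` {C'. finite C' \<and> C' \<subseteq> C})"
    using sum_le by (auto intro!: bdd_aboveI2)
  \<comment> \<open>A finite \<open>C0\<close> comes within \<eta>/5^s of the supremum, so the
    remaining balls contribute at most \<eta> even after their radii are multiplied by 5.\<close>
  have "\<sigma> - \<eta> / 5 powr s < \<sigma>"
    using pos by simp
  moreover have "{C'. finite C' \<and> C' \<subseteq> C} \<noteq> {}"
    by blast
  ultimately obtain C0 where C0: "finite C0" "C0 \<subseteq> C" "\<sigma> - \<eta> / 5 powr s < (\<Sum>c\<in>C0. snd c powr s)"
    unfolding \<sigma>_def using less_cSUP_iff[OF _ bdd] by blast
  have tail: "(\<Sum>c\<in>C'. snd c powr s) \<le> \<eta> / 5 powr s" if C': "finite C'" "C' \<subseteq> C - C0" for C'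
  proof -
    have "(\<Sum>c\<in>C'. snd c powr s) + (\<Sum>c\<in>C0. snd c powr s) = (\<Sum>c\<in>C' \<union> C0. snd c powr s)"
      using C' C0 by (intro sum.union_disjoint[symmetric]) auto
    also have "\<dots> \<le> \<sigma>"
      unfolding \<sigma>_def using C' C0 by (intro cSUP_upper[OF _ bdd]) auto
    finally show ?thesis using C0(3) by simp
  qed
  define e where "e = (\<lambda>c. if c \<in> C0 then snd c else 5 * snd c)"
  \<comment> \<open>A point outside the finitely many closed balls of \<open>C0\<close> has a small
    admissible ball disjoint from all of them. The family member that meets and swallows this ball
    cannot belong to \<open>C0\<close>, so it is one of the enlarged ones.\<close>
  have cover: "\<exists>c\<in>C. p \<in> cball (fst c) (e c)" if "p \<in> F" for p
  proof (cases "p \<in> (\<Union>c\<in>C0. cball (fst c) (snd c))")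
    case True
    then show ?thesis using C0 by (auto simp: e_def)
  next
    case False
    have "open (U - (\<Union>c\<in>C0. cball (fst c) (snd c)))"
      using C0(1) U(1) by (intro open_Diff closed_UN) auto
    then obtain d where d: "d > 0" "ball p d \<subseteq> U - (\<Union>c\<in>C0. cball (fst c) (snd c))"
      using False \<open>p \<in> F\<close> U(2) by (meson DiffI open_contains_ball subsetD)
    obtain r where r: "r > 0" "r < min d (\<delta> / 5)" "t * r powr s \<le> measure \<nu> (cball p r)"
      using dens[OF \<open>p \<in> F\<close>, of "min d (\<delta> / 5)"] d pos by auto
    have sub: "cball p r \<subseteq> U - (\<Union>c\<in>C0. cball (fst c) (snd c))"
      using r d(2) by (auto simp: subset_eq)
    then have "(p, r) \<in> K"
      using r \<open>p \<in> F\<close> by (auto simp: K_def)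
    then obtain j where j: "j \<in> C" "\<not> disjnt (cball p r) (cball (fst j) (snd j))" "cball p r \<subseteq> ball (fst j) (5 * snd j)"
      using C(4) by fastforce
    then have "j \<notin> C0"
      using sub unfolding disjnt_def by blast
    moreover have "p \<in> ball (fst j) (5 * snd j)"
      using subsetD[OF j(3), of p] r by simp
    ultimately show ?thesis
      using j(1) by (intro bexI[of _ j]) (auto simp: e_def)
  qed
  obtain p0 where "p0 \<in> F" using \<open>F \<noteq> {}\<close> by auto
  \<comment> \<open>C may be finite; indices outside T receive the degenerate ball of radius 0 about
    \<open>p0\<close>, which adds nothing to the sum.\<close>
  define T where "T = to_nat_on C ` C"
  define c where "c = inv_into C (to_nat_on C)"
  have inj: "inj_on (to_nat_on C) C"
    using C(1) by (rule inj_on_to_nat_on)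
  have c_in: "c n \<in> C" if "n \<in> T" for n
    using that unfolding c_def T_def by (rule inv_into_into)
  have c_inv: "c (to_nat_on C j) = j" if "j \<in> C" for j
    using that inj unfolding c_def by simp
  define x where "x = (\<lambda>n. if n \<in> T then fst (c n) else p0)"
  define R where "R = (\<lambda>n. if n \<in> T then e (c n) else 0)"
  show ?thesis
  proof (rule that[of x R])
    show "range x \<subseteq> F"
      using CK(1)[OF c_in] \<open>p0 \<in> F\<close> by (auto simp: x_def)
    show "0 \<le> R i" for i
      using CK(2)[OF c_in[of i]] by (auto simp: R_def e_def)
    show "R i \<le> \<delta>" for i
      using CK(2,3)[OF c_in[of i]] pos by (auto simp: R_def e_def)
    show "F \<subseteq> (\<Union>i. cball (x i) (R i))"
    proof
      fix p assume "p \<in> F"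
      then obtain j where j: "j \<in> C" "p \<in> cball (fst j) (e j)" using cover by blast
      then have "p \<in> cball (x (to_nat_on C j)) (R (to_nat_on C j))"
        using c_inv by (auto simp: x_def R_def T_def)
      then show "p \<in> (\<Union>i. cball (x i) (R i))" by blast
    qed
    show "(\<Sum>i. ennreal (R i powr s)) \<le> ennreal (measure \<nu> U / t + \<eta>)"
    proof (rule suminf_le_const[OF summableI])
      fix N
      define C' where "C' = c ` ({..<N} \<inter> T)"
      have "inj_on c T"
        unfolding c_def T_def by (rule inj_on_inv_into) simp
      then have injc: "inj_on c ({..<N} \<inter> T)"
        by (rule inj_on_subset) auto
      have C': "finite C'" "C' \<subseteq> C"
        using c_in by (auto simp: C'_def)
      have "(\<Sum>i<N. R i powr s) = (\<Sum>i\<in>{..<N} \<inter> T. e (c i) powr s)"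
        by (intro sum.mono_neutral_cong_right) (auto simp: R_def)
      also have "\<dots> = (\<Sum>j\<in>C'. e j powr s)"
        unfolding C'_def by (rule sum.reindex[OF injc, symmetric, unfolded comp_def])
      also have "\<dots> = (\<Sum>j\<in>C' \<inter> C0. e j powr s) + (\<Sum>j\<in>C' - C0. e j powr s)"
        using C'(1) by (metis sum.Int_Diff)
      also have "(\<Sum>j\<in>C' \<inter> C0. e j powr s) = (\<Sum>j\<in>C' \<inter> C0. snd j powr s)"
        by (intro sum.cong) (auto simp: e_def)
      also have "(\<Sum>j\<in>C' - C0. e j powr s) = 5 powr s * (\<Sum>j\<in>C' - C0. snd j powr s)"
        unfolding sum_distrib_left
      proof (rule sum.cong)
        fix j assume "j \<in> C' - C0"
        then have "snd j > 0" "j \<notin> C0" using CK(2) C' by blast+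
        then show "e j powr s = 5 powr s * snd j powr s"
          by (simp add: e_def powr_mult)
      qed simp
      also have "(\<Sum>j\<in>C' \<inter> C0. snd j powr s) + 5 powr s * (\<Sum>j\<in>C' - C0. snd j powr s)
           \<le> measure \<nu> U / t + 5 powr s * (\<eta> / 5 powr s)"
        using C' by (intro add_mono mult_left_mono sum_le tail) auto
      finally have "(\<Sum>i<N. R i powr s) \<le> measure \<nu> U / t + \<eta>"
        by simp
      then show "(\<Sum>i<N. ennreal (R i powr s)) \<le> ennreal (measure \<nu> U / t + \<eta>)"
        by (simp add: sum_ennreal ennreal_leI)
    qed
  qed
qed

text \<open>The factor 2^s arises because the covering balls have diameter twice their radius.
  Finiteness is asked of \<nu> on U alone, so that Lebesgue measure on a ball is covered
  too.\<close>

lemma hausdorff_outer_le_open: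
  fixes \<nu> :: "'a::euclidean_space measure"
  assumes sets: "sets \<nu> = sets borel" and U: "open U" "F \<subseteq> U" "emeasure \<nu> U \<noteq> \<infinity>"
    and "t > 0"
    and dens: "\<And>p d. p \<in> F \<Longrightarrow> d > 0 \<Longrightarrow> \<exists>r>0. r < d \<and> t * r powr s \<le> measure \<nu> (cball p r)"
  shows "hausdorff_outer s F \<le> ennreal (2 powr s / t * measure \<nu> U)"
proof (cases "F = {}")
  case False
  show ?thesis
  proof (rule hausdorff_outer_leI, rule ennreal_le_epsilon)
    fix \<delta> e :: real assume "\<delta> > 0" "e > 0"
    have "\<delta> / 2 > 0" "e / 2 powr s > 0" using \<open>\<delta> > 0\<close> \<open>e > 0\<close> by auto
    from vitali_cover_sequence[OF sets U False \<open>t > 0\<close> this dens]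
    obtain x R where x: "range x \<subseteq> F" and R: "\<And>i. 0 \<le> R i" "\<And>i. R i \<le> \<delta> / 2" and
      cov: "F \<subseteq> (\<Union>i::nat. cball (x i) (R i))" and
      sum: "(\<Sum>i. ennreal (R i powr s)) \<le> ennreal (measure \<nu> U / t + e / 2 powr s)"
      by blast
    have "hausdorff_pre s \<delta> F \<le> (\<Sum>i. ennreal (diameter (cball (x i) (R i)) powr s))"
    proof (rule hausdorff_pre_le[OF cov])
      show "diameter (cball (x n) (R n)) \<le> \<delta>" for n
        using R[of n] by simp
    qed auto
    also have "\<dots> = (\<Sum>i. ennreal (2 powr s) * ennreal (R i powr s))"
      using R by (simp add: powr_mult ennreal_mult not_less[symmetric])
    also have "\<dots> = ennreal (2 powr s) * (\<Sum>i. ennreal (R i powr s))"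
      by simp
    also have "\<dots> \<le> ennreal (2 powr s) * ennreal (measure \<nu> U / t + e / 2 powr s)"
      using sum by (intro mult_left_mono) auto
    also have "\<dots> = ennreal (2 powr s / t * measure \<nu> U) + ennreal e"
      using \<open>t > 0\<close> \<open>e > 0\<close> by (simp add: ennreal_mult[symmetric] ennreal_plus[symmetric] field_simps del: ennreal_plus)
    finally show "hausdorff_pre s \<delta> F \<le> ennreal (2 powr s / t * measure \<nu> U) + ennreal e" .
  qed
qed auto

lemma finite_outer_regular_open:
  fixes \<nu> :: "'a::{second_countable_topology, complete_space} measure"
  assumes "finite_measure \<nu>" and sets: "sets \<nu> = sets borel" and F: "F \<in> sets borel" and "e > 0"
  obtains U where "open U" "F \<subseteq> U" "measure \<nu> U \<le> measure \<nu> F + e"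
proof -
  interpret finite_measure \<nu> by fact
  have "emeasure \<nu> F < ennreal (measure \<nu> F + e)"
    using \<open>e > 0\<close> by (simp add: emeasure_eq_measure ennreal_less_iff)
  then have "(INF U\<in>{U. F \<subseteq> U \<and> open U}. emeasure \<nu> U) < ennreal (measure \<nu> F + e)"
    using outer_regular[OF sets _ F] by simp
  then obtain U where "F \<subseteq> U" "open U" "emeasure \<nu> U < ennreal (measure \<nu> F + e)"
    unfolding INF_less_iff by auto
  then show ?thesis
    using that[of U] by (simp add: emeasure_eq_measure ennreal_less_iff)
qed

text \<open>Outer regularity lets U shrink to F. Only some arbitrarily small radii at each point are
  asked for, that is, an upper density bound; nothing more is known on the exceptional sets in
  \<open>AE_density_point\<close>.\<close>

lemma hausdorff_outer_le_measure:
  fixes \<nu> :: "'a::euclidean_space measure"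
  assumes "finite_measure \<nu>" and sets: "sets \<nu> = sets borel" and F: "F \<in> sets borel"
    and "t > 0"
    and dens: "\<And>p d. p \<in> F \<Longrightarrow> d > 0 \<Longrightarrow> \<exists>r>0. r < d \<and> t * r powr s \<le> measure \<nu> (cball p r)"
  shows "hausdorff_outer s F \<le> ennreal (2 powr s / t) * emeasure \<nu> F"
proof -
  interpret finite_measure \<nu> by fact
  define c where "c = 2 powr s / t"
  have "c > 0" using \<open>t > 0\<close> by (simp add: c_def)
  show ?thesis
    unfolding c_def[symmetric]
  proof (rule ennreal_le_epsilon)
    fix e :: real assume "e > 0"
    then have "e / c > 0" using \<open>c > 0\<close> by simp
    then obtain U where U: "open U" "F \<subseteq> U" "measure \<nu> U \<le> measure \<nu> F + e / c"
      using finite_outer_regular_open[OF \<open>finite_measure \<nu>\<close> sets F] by blast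
    have "hausdorff_outer s F \<le> ennreal (c * measure \<nu> U)"
      using hausdorff_outer_le_open[OF sets U(1,2) _ \<open>t > 0\<close> dens] by (auto simp: c_def)
    also have "\<dots> \<le> ennreal (c * measure \<nu> F + e)"
      using U(3) \<open>c > 0\<close> by (intro ennreal_leI) (simp add: field_simps)
    also have "\<dots> = ennreal c * emeasure \<nu> F + ennreal e"
      using \<open>c > 0\<close> \<open>e > 0\<close> by (simp add: emeasure_eq_measure ennreal_mult)
    finally show "hausdorff_outer s F \<le> ennreal c * emeasure \<nu> F + ennreal e" .
  qed
qed

text \<open>The mass of a cover is compared set by set with its sum of powers of diameters. How
  small a covering set must be depends on the point of F it contains, hence the exhaustion by sets
  with a uniform scale. Closed C suffice because closure preserves the diameter.\<close>

lemma emeasure_le_hausdorff_outer: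
  fixes \<mu> :: "'a::metric_space measure"
  assumes sets: "sets \<mu> = sets borel" and F: "F \<in> sets borel" and "b > 0"
    and dens: "\<And>p. p \<in> F \<Longrightarrow> \<exists>d>0. \<forall>C. closed C \<longrightarrow> bounded C \<longrightarrow> p \<in> C \<longrightarrow> diameter C < d \<longrightarrow>
      emeasure \<mu> C \<le> ennreal (b * diameter C powr s)"
  shows "emeasure \<mu> F \<le> ennreal b * hausdorff_outer s F"
proof (cases "hausdorff_outer s F = \<top>")
  case True
  then show ?thesis using \<open>b > 0\<close> by (simp add: ennreal_mult_top)
next
  case False
  show ?thesis
  proof (rule ennreal_le_epsilon)
    fix e :: real assume "e > 0"
    \<comment> \<open>The sets \<open>G k\<close> need not be measurable, so they are replaced by Borel hulls \<open>W k\<close>;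
      the limes inferior of the hulls still covers \<open>F\<close>.\<close>
    define G where "G = (\<lambda>k::nat. {p\<in>F. \<forall>C. closed C \<longrightarrow> bounded C \<longrightarrow> p \<in> C \<longrightarrow> diameter C < 1 / real (Suc k) \<longrightarrow>
      emeasure \<mu> C \<le> ennreal (b * diameter C powr s)})"
    have G_mono: "G k \<subseteq> G l" if "k \<le> l" for k l
    proof -
      have "1 / real (Suc l) \<le> 1 / real (Suc k)" using that by (simp add: frac_le)
      then show ?thesis unfolding G_def by fastforce
    qed
    have F_eq: "\<exists>k. p \<in> G k" if p: "p \<in> F" for p
    proof -
      obtain d where d: "d > 0" "\<forall>C. closed C \<longrightarrow> bounded C \<longrightarrow> p \<in> C \<longrightarrow> diameter C < d \<longrightarrow>
          emeasure \<mu> C \<le> ennreal (b * diameter C powr s)"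
        using dens[OF p] by blast
      then obtain k where "1 / real (Suc k) < d"
        by (metis inverse_eq_divide reals_Archimedean)
      with d p have "p \<in> G k" unfolding G_def by fastforce
      then show ?thesis ..
    qed
    have "\<exists>W\<in>sets borel. G k \<subseteq> W \<and> emeasure \<mu> W \<le> ennreal b * (hausdorff_outer s F + ennreal (e / b))" for k
    proof -
      \<comment> \<open>Covers at scale 1/(k+2) have diameter strictly below 1/(k+1), as
        \<open>G k\<close> demands.\<close>
      have k: "1 / real (Suc (Suc k)) > 0" by simp
      have "e / b > 0" using \<open>e > 0\<close> \<open>b > 0\<close> by simp
      then have "hausdorff_pre s (1 / real (Suc (Suc k))) F < hausdorff_outer s F + ennreal (e / b)"
        using hausdorff_pre_le_outer[OF k] False
        by (metis add.right_neutral ennreal_add_left_cancel_less ennreal_eq_0_iff infinity_ennreal_def leD less_top linorder_not_le not_gr_zero order_le_less_trans order_less_le)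
      then obtain C where C: "F \<subseteq> (\<Union>n. C n)" "\<And>n. bounded (C n)" "\<And>n. diameter (C n) \<le> 1 / real (Suc (Suc k))"
         "(\<Sum>n. ennreal (diameter (C n) powr s)) < hausdorff_outer s F + ennreal (e / b)"
        using hausdorff_pre_lessE by blast
      \<comment> \<open>Nothing is known about the mass of covering sets that miss
        \<open>G k\<close>, so they are dropped.\<close>
      define C' where "C' = (\<lambda>n. if C n \<inter> G k = {} then {} else closure (C n))"
      have "G k \<subseteq> (\<Union>n. C' n)"
      proof
        fix p assume p: "p \<in> G k"
        then obtain n where "p \<in> C n" using C(1) by (auto simp: G_def)
        with p have "p \<in> C' n" using closure_subset[of "C n"] by (auto simp: C'_def)
        then show "p \<in> (\<Union>n. C' n)" by blast
      qed
      moreover have C'_sets: "C' n \<in> sets borel" for n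
        by (auto simp: C'_def)
      moreover have "emeasure \<mu> (\<Union>n. C' n) \<le> (\<Sum>n. emeasure \<mu> (C' n))"
        using C'_sets sets by (intro emeasure_subadditive_countably) auto
      moreover have "(\<Sum>n. emeasure \<mu> (C' n)) \<le> (\<Sum>n. ennreal b * ennreal (diameter (C n) powr s))"
      proof (rule suminf_le)
        fix n
        show "emeasure \<mu> (C' n) \<le> ennreal b * ennreal (diameter (C n) powr s)"
        proof (cases "C n \<inter> G k = {}")
          case False
          then obtain p where p: "p \<in> C n" "p \<in> G k" by auto
          have "diameter (closure (C n)) < 1 / real (Suc k)"
            using C(3)[of n] C(2)[of n] by (simp add: diameter_closure order_le_less_trans frac_less2)
          then have "emeasure \<mu> (closure (C n)) \<le> ennreal (b * diameter (closure (C n)) powr s)"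
            using p C(2)[of n] closure_subset[of "C n"] unfolding G_def by (auto simp: subset_eq)
          then show ?thesis
            using False C(2)[of n] \<open>b > 0\<close> by (simp add: C'_def diameter_closure ennreal_mult)
        qed (auto simp: C'_def)
      qed auto
      moreover have "(\<Sum>n. ennreal b * ennreal (diameter (C n) powr s))
          \<le> ennreal b * (hausdorff_outer s F + ennreal (e / b))"
        using C(4) by (auto intro!: mult_left_mono)
      ultimately show ?thesis
        by (intro bexI[of _ "\<Union>n. C' n"]) (auto intro: order_trans)
    qed
    then obtain W where W: "\<And>k. W k \<in> sets borel" "\<And>k. G k \<subseteq> W k"
        "\<And>k. emeasure \<mu> (W k) \<le> ennreal b * (hausdorff_outer s F + ennreal (e / b))"
      by metis
    define V where "V = (\<lambda>k. \<Inter>j\<in>{k..}. W j)"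
    have V_sets: "V k \<in> sets \<mu>" for k
      unfolding V_def sets using W(1) by (intro sets.countable_INT'') auto
    have "F \<subseteq> (\<Union>k. V k)"
    proof
      fix p assume "p \<in> F"
      then obtain k where "p \<in> G k" using F_eq by blast
      then have "p \<in> V k" using G_mono W(2) by (fastforce simp: V_def)
      then show "p \<in> (\<Union>k. V k)" by blast
    qed
    then have "emeasure \<mu> F \<le> emeasure \<mu> (\<Union>k. V k)"
      using V_sets by (intro emeasure_mono) auto
    also have "\<dots> = (SUP k. emeasure \<mu> (V k))"
      using V_sets by (intro SUP_emeasure_incseq[symmetric]) (auto simp: incseq_def V_def)
    also have "\<dots> \<le> ennreal b * (hausdorff_outer s F + ennreal (e / b))"
    proof (rule SUP_least)
      fix k
      have "emeasure \<mu> (V k) \<le> emeasure \<mu> (W k)"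
        using W(1) sets by (intro emeasure_mono) (auto simp: V_def)
      then show "emeasure \<mu> (V k) \<le> ennreal b * (hausdorff_outer s F + ennreal (e / b))"
        using W(3) order_trans by blast
    qed
    also have "\<dots> = ennreal b * hausdorff_outer s F + ennreal e"
      using \<open>b > 0\<close> \<open>e > 0\<close> by (simp add: distrib_left ennreal_mult[symmetric])
    finally show "emeasure \<mu> F \<le> ennreal b * hausdorff_outer s F + ennreal e" .
  qed
qed

section \<open>Densities of measures\<close>

text \<open>Fixing a scale \<rho> and letting it run through \<open>1 / Suc k\<close> replaces
  limits by countable set operations.\<close>

definition ball_ge :: "'a::metric_space measure \<Rightarrow> real \<Rightarrow> real \<Rightarrow> real \<Rightarrow> 'a \<Rightarrow> bool" where
  "ball_ge \<mu> s \<rho> t p \<longleftrightarrow> (\<forall>r. 0 < r \<longrightarrow> r < \<rho> \<longrightarrow> t * r powr s \<le> measure \<mu> (ball p r))"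

definition ball_le :: "'a::metric_space measure \<Rightarrow> real \<Rightarrow> real \<Rightarrow> real \<Rightarrow> 'a \<Rightarrow> bool" where
  "ball_le \<mu> s \<rho> t p \<longleftrightarrow> (\<forall>r. 0 < r \<longrightarrow> r < \<rho> \<longrightarrow> measure \<mu> (ball p r) \<le> t * r powr s)"

definition has_density :: "'a::metric_space measure \<Rightarrow> real \<Rightarrow> 'a \<Rightarrow> real \<Rightarrow> bool" where
  "has_density \<mu> s p c \<longleftrightarrow> ((\<lambda>\<epsilon>. measure \<mu> (ball p \<epsilon>) / \<epsilon> powr s) \<longlongrightarrow> c) (at_right 0)"

text \<open>The default 0 makes a nonzero value a certificate that the density exists.\<close>

definition dens :: "'a::metric_space measure \<Rightarrow> real \<Rightarrow> 'a \<Rightarrow> real" where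
  "dens \<mu> s p = (if \<exists>c. has_density \<mu> s p c then (THE c. has_density \<mu> s p c) else 0)"

lemma has_density_unique: "has_density \<mu> s p c \<Longrightarrow> has_density \<mu> s p c' \<Longrightarrow> c = c'"
  unfolding has_density_def by (rule tendsto_unique[OF trivial_limit_at_right_real])

lemma has_density_dens_eq: "has_density \<mu> s p c \<Longrightarrow> dens \<mu> s p = c"
  unfolding dens_def using has_density_unique by (metis the_equality)

lemma has_density_dens: "dens \<mu> s p \<noteq> 0 \<Longrightarrow> has_density \<mu> s p (dens \<mu> s p)"
  using has_density_dens_eq[of \<mu> s p] by (metis dens_def)

lemma has_density_iff:
  "has_density \<mu> s p c \<longleftrightarrow> (\<forall>t<c. \<exists>k::nat. ball_ge \<mu> s (1 / Suc k) t p) \<and> (\<forall>t>c. \<exists>k::nat. ball_le \<mu> s (1 / Suc k) t p)"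
proof -
  have ev: "(\<exists>k::nat. \<forall>r. 0 < r \<longrightarrow> r < 1 / Suc k \<longrightarrow> P r) \<longleftrightarrow> eventually P (at_right (0::real))" for P
  proof
    assume "\<exists>k::nat. \<forall>r. 0 < r \<longrightarrow> r < 1 / Suc k \<longrightarrow> P r"
    then obtain k :: nat where "\<forall>r. 0 < r \<longrightarrow> r < 1 / Suc k \<longrightarrow> P r" by blast
    then show "eventually P (at_right 0)"
      unfolding eventually_at_right_field by (intro exI[of _ "1 / Suc k"]) auto
  next
    assume "eventually P (at_right (0::real))"
    then obtain b where b: "b > 0" "\<And>r. 0 < r \<Longrightarrow> r < b \<Longrightarrow> P r"
      by (auto simp: eventually_at_right_field)
    moreover obtain k where "1 / real (Suc k) < b"
      using b(1) by (metis inverse_eq_divide reals_Archimedean)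
    ultimately show "\<exists>k::nat. \<forall>r. 0 < r \<longrightarrow> r < 1 / Suc k \<longrightarrow> P r"
      by (intro exI[of _ k]) (auto intro: less_trans)
  qed
  have pos: "eventually (\<lambda>r. r > 0) (at_right (0::real))"
    by (rule eventually_at_right_less)
  define g where "g = (\<lambda>r. measure \<mu> (ball p r) / r powr s)"
  have ge: "(\<exists>k::nat. ball_ge \<mu> s (1 / Suc k) t p) \<longleftrightarrow> eventually (\<lambda>r. t \<le> g r) (at_right 0)" for t
    unfolding ball_ge_def ev by (intro eventually_cong[OF pos]) (auto simp: g_def field_simps)
  have le: "(\<exists>k::nat. ball_le \<mu> s (1 / Suc k) t p) \<longleftrightarrow> eventually (\<lambda>r. g r \<le> t) (at_right 0)" for t
    unfolding ball_le_def ev by (intro eventually_cong[OF pos]) (auto simp: g_def field_simps)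
  show ?thesis
    unfolding ge le has_density_def g_def[symmetric] order_tendsto_iff
  proof safe
    fix t assume *: "\<forall>l<c. eventually (\<lambda>x. l < g x) (at_right 0)" "t < c"
    then have "eventually (\<lambda>r. t < g r) (at_right 0)" by blast
    then show "eventually (\<lambda>r. t \<le> g r) (at_right 0)"
      by (rule eventually_mono) simp
  next
    fix t assume *: "\<forall>u>c. eventually (\<lambda>x. g x < u) (at_right 0)" "t > c"
    then have "eventually (\<lambda>r. g r < t) (at_right 0)" by blast
    then show "eventually (\<lambda>r. g r \<le> t) (at_right 0)"
      by (rule eventually_mono) simp
  next
    fix t assume *: "\<forall>t<c. eventually (\<lambda>r. t \<le> g r) (at_right 0)" "t < c"
    then obtain t' where "t < t'" "t' < c" using dense by blast
    with * have "eventually (\<lambda>r. t' \<le> g r) (at_right 0)" by blast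
    then show "eventually (\<lambda>r. t < g r) (at_right 0)"
      by (rule eventually_mono) (use \<open>t < t'\<close> in simp)
  next
    fix t assume *: "\<forall>t>c. eventually (\<lambda>r. g r \<le> t) (at_right 0)" "t > c"
    then obtain t' where "t' < t" "c < t'" using dense by blast
    with * have "eventually (\<lambda>r. g r \<le> t') (at_right 0)" by blast
    then show "eventually (\<lambda>r. g r < t) (at_right 0)"
      by (rule eventually_mono) (use \<open>t' < t\<close> in simp)
  qed
qed

lemma ball_ge_mono: "ball_ge \<mu> s \<rho> t p \<Longrightarrow> t' \<le> t \<Longrightarrow> \<rho>' \<le> \<rho> \<Longrightarrow> ball_ge \<mu> s \<rho>' t' p"
  unfolding ball_ge_def by (meson mult_right_mono order_trans powr_ge_zero less_le_trans)

lemma ball_le_mono: "ball_le \<mu> s \<rho> t p \<Longrightarrow> t \<le> t' \<Longrightarrow> \<rho>' \<le> \<rho> \<Longrightarrow> ball_le \<mu> s \<rho>' t' p"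
  unfolding ball_le_def by (meson mult_right_mono order_trans powr_ge_zero less_le_trans)

lemma ball_ge_le:
  assumes "ball_ge \<mu> s \<rho> t p" "ball_le \<mu> s \<rho>' t' p" "\<rho> > 0" "\<rho>' > 0"
  shows "t \<le> t'"
proof -
  define r where "r = min \<rho> \<rho>' / 2"
  have r: "0 < r" "r < \<rho>" "r < \<rho>'" using assms by (auto simp: r_def min_def field_simps)
  then have "t * r powr s \<le> t' * r powr s"
    using assms unfolding ball_ge_def ball_le_def by (meson order_trans)
  then show ?thesis using r by simp
qed

text \<open>A Cauchy criterion that does not mention the limit and ranges over countable sets only.
  It yields measurability of the domain of existence, and it supplies the pieces of nearly constant
  density in \<open>AE_diameter_ratio_bound\<close>.\<close>

lemma ex_has_density_iff:
  "(\<exists>c. has_density \<mu> s p c) \<longleftrightarrow>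
    (\<forall>j::nat. \<exists>q\<in>\<rat>. \<exists>k::nat. ball_ge \<mu> s (1 / Suc k) q p \<and> ball_le \<mu> s (1 / Suc k) (q + 1 / Suc j) p)"
proof
  assume "\<exists>c. has_density \<mu> s p c"
  then obtain c where c: "has_density \<mu> s p c" ..
  show "\<forall>j::nat. \<exists>q\<in>\<rat>. \<exists>k::nat. ball_ge \<mu> s (1 / Suc k) q p \<and> ball_le \<mu> s (1 / Suc k) (q + 1 / Suc j) p"
  proof
    fix j :: nat
    have "c - 1 / Suc j < c" by simp
    then obtain q where q: "q \<in> \<rat>" "c - 1 / Suc j < q" "q < c"
      using Rats_dense_in_real by blast
    then have "c < q + 1 / Suc j" by simp
    then obtain l :: nat where l: "ball_le \<mu> s (1 / Suc l) (q + 1 / Suc j) p"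
      using c unfolding has_density_iff by blast
    obtain k :: nat where k: "ball_ge \<mu> s (1 / Suc k) q p"
      using c \<open>q < c\<close> unfolding has_density_iff by blast
    define m where "m = max k l"
    have "1 / real (Suc m) \<le> 1 / real (Suc k)" "1 / real (Suc m) \<le> 1 / real (Suc l)"
      by (auto simp: m_def intro!: divide_left_mono)
    then have "ball_ge \<mu> s (1 / Suc m) q p" "ball_le \<mu> s (1 / Suc m) (q + 1 / Suc j) p"
      using ball_ge_mono[OF k order_refl] ball_le_mono[OF l order_refl] by blast+
    with q show "\<exists>q\<in>\<rat>. \<exists>k::nat. ball_ge \<mu> s (1 / Suc k) q p \<and> ball_le \<mu> s (1 / Suc k) (q + 1 / Suc j) p"
      by blast
  qed
next
  assume *: "\<forall>j::nat. \<exists>q\<in>\<rat>. \<exists>k::nat. ball_ge \<mu> s (1 / Suc k) q p \<and> ball_le \<mu> s (1 / Suc k) (q + 1 / Suc j) p"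
  \<comment> \<open>The supremum of the lower bounds valid at some scale is the lower density; the
    criterion puts upper bounds arbitrarily close to it.\<close>
  define X where "X = {t. \<exists>k::nat. ball_ge \<mu> s (1 / Suc k) t p}"
  have upper: "t \<le> t'" if "t \<in> X" "ball_le \<mu> s (1 / Suc k) t' p" for t t' and k :: nat
    using that ball_ge_le by (fastforce simp: X_def)
  obtain q0 and k0 :: nat where "ball_ge \<mu> s (1 / Suc k0) q0 p" "ball_le \<mu> s (1 / Suc k0) (q0 + 1 / Suc 0) p"
    using * by blast
  then have X: "X \<noteq> {}" "bdd_above X"
    using upper by (auto simp: X_def intro!: bdd_aboveI)
  have "has_density \<mu> s p (Sup X)"
    unfolding has_density_iff
  proof (intro conjI allI impI)
    fix t assume "t < Sup X"
    then obtain t' where "t' \<in> X" "t < t'"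
      using X less_cSup_iff by blast
    then show "\<exists>k::nat. ball_ge \<mu> s (1 / Suc k) t p"
      using ball_ge_mono[OF _ less_imp_le order_refl] unfolding X_def by blast
  next
    fix t assume "t > Sup X"
    then obtain j where j: "1 / real (Suc j) < t - Sup X"
      by (metis diff_gt_0_iff_gt inverse_eq_divide reals_Archimedean)
    obtain q and k :: nat where q: "ball_ge \<mu> s (1 / Suc k) q p" "ball_le \<mu> s (1 / Suc k) (q + 1 / Suc j) p"
      using * by blast
    then have "q \<le> Sup X"
      using X by (intro cSup_upper) (auto simp: X_def)
    with q j show "\<exists>k::nat. ball_le \<mu> s (1 / Suc k) t p"
      by (intro exI[of _ k]) (auto elim: ball_le_mono)
  qed
  then show "\<exists>c. has_density \<mu> s p c" ..
qed

text \<open>Lower semicontinuity: slightly smaller concentric balls already carry more mass than c,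
  and they lie in the ball of radius r about every nearby centre.\<close>

lemma open_measure_ball_gt:
  fixes \<mu> :: "'a::metric_space measure"
  assumes "finite_measure \<mu>" and sets: "sets \<mu> = sets borel"
  shows "open {p. c < measure \<mu> (ball p r)}"
  unfolding open_contains_ball
proof clarify
  interpret finite_measure \<mu> by fact
  fix p assume c: "c < measure \<mu> (ball p r)"
  define B where "B = (\<lambda>n::nat. ball p (r - 1 / real (Suc n)))"
  have "(\<Union>n. B n) = ball p r"
  proof (intro equalityI subsetI)
    fix q assume "q \<in> ball p r"
    then have "r - dist p q > 0" by simp
    then obtain n where "1 / real (Suc n) < r - dist p q"
      by (metis inverse_eq_divide reals_Archimedean)
    then have "q \<in> B n" by (simp add: B_def)
    then show "q \<in> (\<Union>n. B n)" by blast
  next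
    fix q assume "q \<in> (\<Union>n. B n)"
    then obtain n where "dist p q < r - 1 / real (Suc n)" by (auto simp: B_def)
    moreover have "1 / real (Suc n) > 0" by simp
    ultimately show "q \<in> ball p r" unfolding mem_ball by linarith
  qed
  moreover have "incseq B"
    unfolding B_def incseq_def by (auto intro!: subset_ball divide_left_mono)
  ultimately have "(\<lambda>n. measure \<mu> (B n)) \<longlonglongrightarrow> measure \<mu> (ball p r)"
    using finite_Lim_measure_incseq[of B] sets by (simp add: B_def image_subset_iff)
  then have "eventually (\<lambda>n. c < measure \<mu> (B n)) sequentially"
    using c by (rule order_tendstoD)
  then obtain n where n: "c < measure \<mu> (B n)"
    by (auto simp: eventually_sequentially)
  have "ball p (1 / real (Suc n)) \<subseteq> {p. c < measure \<mu> (ball p r)}"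
  proof
    fix q assume q: "q \<in> ball p (1 / real (Suc n))"
    have "B n \<subseteq> ball q r"
    proof
      fix z assume "z \<in> B n"
      with q show "z \<in> ball q r"
        using dist_triangle[of q z p] by (simp add: B_def dist_commute)
    qed
    then have "measure \<mu> (B n) \<le> measure \<mu> (ball q r)"
      using sets by (intro finite_measure_mono) auto
    with n show "q \<in> {p. c < measure \<mu> (ball p r)}" by simp
  qed
  then show "\<exists>e>0. ball p e \<subseteq> {p. c < measure \<mu> (ball p r)}"
    by (intro exI[of _ "1 / real (Suc n)"]) auto
qed

lemma borel_measurable_measure_ball:
  fixes \<mu> :: "'a::metric_space measure"
  assumes "finite_measure \<mu>" "sets \<mu> = sets borel"
  shows "(\<lambda>p. measure \<mu> (ball p r)) \<in> borel_measurable borel"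
  unfolding borel_measurable_iff_greater using open_measure_ball_gt[OF assms] by auto

section \<open>Borel measurability of the density\<close>

context
  fixes \<mu> :: "'a::metric_space measure" and s :: real
  assumes fin: "finite_measure \<mu>" and sets: "sets \<mu> = sets borel"
begin

lemma measure_ball_mono: "r \<le> r' \<Longrightarrow> measure \<mu> (ball p r) \<le> measure \<mu> (ball p r')"
  using finite_measure.finite_measure_mono[OF fin] sets by (simp add: subset_ball)

text \<open>Mass grows with the radius and the power is continuous, so a violation at r persists at
  rational radii slightly below r; for upper bounds, slightly above.\<close>

lemma ball_ge_rat: "ball_ge \<mu> s \<rho> t p \<longleftrightarrow> (\<forall>r\<in>\<rat>. 0 < r \<longrightarrow> r < \<rho> \<longrightarrow> t * r powr s \<le> measure \<mu> (ball p r))"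
  unfolding ball_ge_def
proof (intro iffI allI impI)
  fix r assume *: "\<forall>r\<in>\<rat>. 0 < r \<longrightarrow> r < \<rho> \<longrightarrow> t * r powr s \<le> measure \<mu> (ball p r)" "0 < r" "r < \<rho>"
  show "t * r powr s \<le> measure \<mu> (ball p r)"
  proof (rule ccontr)
    assume "\<not> t * r powr s \<le> measure \<mu> (ball p r)"
    then have lt: "measure \<mu> (ball p r) < t * r powr s" by simp
    have "((\<lambda>q. t * q powr s) \<longlongrightarrow> t * r powr s) (at_left r)"
      using \<open>0 < r\<close> by (auto intro!: tendsto_intros)
    from order_tendstoD(1)[OF this lt]
    have ev: "eventually (\<lambda>q. measure \<mu> (ball p r) < t * q powr s) (at_left r)" .
    moreover have "eventually (\<lambda>q. 0 < q) (at_left r)"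
      using \<open>0 < r\<close> by (metis eventually_at_left_field)
    ultimately have "eventually (\<lambda>q. 0 < q \<and> measure \<mu> (ball p r) < t * q powr s) (at_left r)"
      by eventually_elim simp
    then obtain b where b: "b < r" "\<And>q. b < q \<Longrightarrow> q < r \<Longrightarrow> 0 < q \<and> measure \<mu> (ball p r) < t * q powr s"
      by (auto simp: eventually_at_left_field)
    obtain q where q: "q \<in> \<rat>" "b < q" "q < r"
      using Rats_dense_in_real[OF b(1)] by blast
    with b(2)[of q] *(1,3) measure_ball_mono[of q r p] show False
      by (force dest!: bspec[of _ _ q])
  qed
qed auto

lemma ball_le_rat: "ball_le \<mu> s \<rho> t p \<longleftrightarrow> (\<forall>r\<in>\<rat>. 0 < r \<longrightarrow> r < \<rho> \<longrightarrow> measure \<mu> (ball p r) \<le> t * r powr s)"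
  unfolding ball_le_def
proof (intro iffI allI impI)
  fix r assume *: "\<forall>r\<in>\<rat>. 0 < r \<longrightarrow> r < \<rho> \<longrightarrow> measure \<mu> (ball p r) \<le> t * r powr s" "0 < r" "r < \<rho>"
  show "measure \<mu> (ball p r) \<le> t * r powr s"
  proof (rule ccontr)
    assume "\<not> measure \<mu> (ball p r) \<le> t * r powr s"
    then have lt: "t * r powr s < measure \<mu> (ball p r)" by simp
    have "((\<lambda>q. t * q powr s) \<longlongrightarrow> t * r powr s) (at_right r)"
      using \<open>0 < r\<close> by (auto intro!: tendsto_intros)
    from order_tendstoD(2)[OF this lt]
    have ev: "eventually (\<lambda>q. t * q powr s < measure \<mu> (ball p r)) (at_right r)" .
    moreover have "eventually (\<lambda>q. q < \<rho>) (at_right r)"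
      using \<open>r < \<rho>\<close> by (metis eventually_at_right_field)
    ultimately have "eventually (\<lambda>q. q < \<rho> \<and> t * q powr s < measure \<mu> (ball p r)) (at_right r)"
      by eventually_elim simp
    then obtain b where b: "b > r" "\<And>q. r < q \<Longrightarrow> q < b \<Longrightarrow> q < \<rho> \<and> t * q powr s < measure \<mu> (ball p r)"
      by (auto simp: eventually_at_right_field)
    obtain q where q: "q \<in> \<rat>" "r < q" "q < b"
      using Rats_dense_in_real[OF b(1)] by blast
    with b(2)[of q] *(1,2) measure_ball_mono[of r q p] show False
      by (force dest!: bspec[of _ _ q])
  qed
qed auto

lemma sets_rational_radii:
  assumes "\<And>r. {x. P r x} \<in> sets borel"
  shows "{p. \<forall>r\<in>\<rat>. 0 < r \<longrightarrow> r < \<rho> \<longrightarrow> P r (measure \<mu> (ball p r))} \<in> sets borel"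
proof -
  have "{p. \<forall>r\<in>\<rat>. 0 < r \<longrightarrow> r < \<rho> \<longrightarrow> P r (measure \<mu> (ball p r))}
      = (\<Inter>r\<in>{r\<in>\<rat>. 0 < r \<and> r < \<rho>}. (\<lambda>p. measure \<mu> (ball p r)) -` {x. P r x})"
    by auto
  also have "\<dots> \<in> sets borel"
  proof (intro sets.countable_INT'')
    show "countable {r \<in> \<rat>. 0 < r \<and> r < \<rho>}"
      using countable_rat by (rule countable_subset[rotated]) auto
    show "(\<lambda>p. measure \<mu> (ball p r)) -` {x. P r x} \<in> sets borel" for r
      using measurable_sets[OF borel_measurable_measure_ball[OF fin sets] assms] by simp
  qed auto
  finally show ?thesis .
qed

lemma sets_ball_ge: "{p. ball_ge \<mu> s \<rho> t p} \<in> sets borel"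
  unfolding ball_ge_rat by (rule sets_rational_radii) auto

lemma sets_ball_le: "{p. ball_le \<mu> s \<rho> t p} \<in> sets borel"
  unfolding ball_le_rat by (rule sets_rational_radii) auto

lemma sets_ex_has_density: "{p. \<exists>c. has_density \<mu> s p c} \<in> sets borel"
proof -
  have "{p. \<exists>c. has_density \<mu> s p c} =
    (\<Inter>j::nat. \<Union>q\<in>\<rat>. \<Union>k::nat. {p. ball_ge \<mu> s (1 / Suc k) q p} \<inter> {p. ball_le \<mu> s (1 / Suc k) (q + 1 / Suc j) p})"
    unfolding ex_has_density_iff by auto
  also have "\<dots> \<in> sets borel"
    using countable_rat
    by (intro sets.countable_INT'' sets.countable_UN'' sets.Int sets_ball_ge sets_ball_le) auto
  finally show ?thesis .
qed

lemma borel_measurable_dens: "dens \<mu> s \<in> borel_measurable borel"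
  unfolding borel_measurable_iff_less
proof
  fix a :: real
  let ?D = "{p. \<exists>c. has_density \<mu> s p c}"
  let ?L = "\<Union>q\<in>{q\<in>\<rat>. q < a}. \<Union>k::nat. {p. ball_le \<mu> s (1 / Suc k) q p}"
  have "dens \<mu> s p < a \<longleftrightarrow> p \<in> ?L" if "p \<in> ?D" for p
  proof -
    obtain c where c: "has_density \<mu> s p c" using \<open>p \<in> ?D\<close> by blast
    have "c < a \<longleftrightarrow> p \<in> ?L"
    proof
      assume "c < a"
      then obtain q where "q \<in> \<rat>" "c < q" "q < a"
        using Rats_dense_in_real by blast
      then show "p \<in> ?L" using c unfolding has_density_iff by blast
    next
      assume "p \<in> ?L"
      then obtain q k where q: "q < a" "ball_le \<mu> s (1 / Suc k) q p" by blast
      have "c \<le> q"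
      proof (rule dense_ge)
        fix t assume "q < t"
        show "c \<le> t"
        proof (rule ccontr)
          assume "\<not> c \<le> t"
          then obtain l :: nat where "ball_ge \<mu> s (1 / Suc l) t p"
            using c unfolding has_density_iff by (meson not_le)
          from ball_ge_le[OF this q(2)] \<open>q < t\<close> show False by simp
        qed
      qed
      with q show "c < a" by simp
    qed
    then show ?thesis using has_density_dens_eq[OF c] by simp
  qed
  moreover have "dens \<mu> s p = 0" if "p \<notin> ?D" for p
    using that by (simp add: dens_def)
  \<comment> \<open>Off \<open>?D\<close> the default value 0 lies below a exactly when a is
    positive.\<close>
  ultimately have "dens \<mu> s p < a \<longleftrightarrow> p \<in> (?D \<inter> ?L) \<union> (if 0 < a then - ?D else {})" for p
    by (cases "p \<in> ?D"; cases "0 < a") (simp_all del: mem_Collect_eq UN_iff)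
  then have "{p. dens \<mu> s p < a} = (?D \<inter> ?L) \<union> (if 0 < a then - ?D else {})"
    by blast
  moreover have "?L \<in> sets borel"
  proof (intro sets.countable_UN'' sets_ball_le)
    show "countable {q \<in> \<rat>. q < a}"
      using countable_rat by (rule countable_subset[rotated]) auto
  qed auto
  ultimately show "{w \<in> space borel. dens \<mu> s w < a} \<in> sets borel"
    using sets_ex_has_density by (auto simp: borel_comp)
qed

text \<open>Open balls with radii decreasing to R. The case R = 0, where points turn out to carry no
  mass, relies on s > 0.\<close>

lemma measure_cball_le:
  assumes "ball_le \<mu> s \<rho> b p" "0 \<le> R" "R < \<rho>" "s > 0"
  shows "measure \<mu> (cball p R) \<le> b * R powr s"
proof (rule tendsto_lowerbound)
  show "((\<lambda>r. b * r powr s) \<longlongrightarrow> b * R powr s) (at_right R)"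
    using assms(2,4) by (auto intro!: tendsto_intros tendsto_powr' eventually_mono[OF eventually_at_right_less])
  have "eventually (\<lambda>r. r < \<rho>) (at_right R)"
    using \<open>R < \<rho>\<close> by (metis eventually_at_right_field)
  moreover have "eventually (\<lambda>r. r > R) (at_right R)"
    by (rule eventually_at_right_less)
  ultimately show "eventually (\<lambda>r. measure \<mu> (cball p R) \<le> b * r powr s) (at_right R)"
  proof eventually_elim
    case (elim r)
    have "measure \<mu> (cball p R) \<le> measure \<mu> (ball p r)"
      using elim sets by (intro finite_measure.finite_measure_mono[OF fin]) auto
    also have "\<dots> \<le> b * r powr s"
      using assms elim by (auto simp: ball_le_def)
    finally show ?case .
  qed
qed simp

end

section \<open>Hausdorff measure in full dimension\<close>

lemma measure_cball_lborel:
  fixes p :: "'a::euclidean_space"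
  assumes "r \<ge> 0"
  shows "measure lborel (cball p r) = unit_ball_vol DIM('a) * r powr DIM('a)"
  using content_cball[OF assms, of p] assms by (cases "r = 0") (auto simp: powr_realpow)

lemma emeasure_cball_lborel:
  fixes p :: "'a::euclidean_space"
  assumes "r \<ge> 0"
  shows "emeasure lborel (cball p r) = ennreal (unit_ball_vol DIM('a) * r powr DIM('a))"
  using measure_cball_lborel[OF assms, of p] emeasure_lborel_cball_finite[of p r]
  by (metis emeasure_eq_ennreal_measure infinity_ennreal_def less_irrefl)

text \<open>Uniqueness of Haar measure, by applying Fubini's theorem twice.\<close>
lemma translation_invariant_unique:
  fixes \<nu> :: "'a::euclidean_space measure"
  assumes "sigma_finite_measure \<nu>" and sets [measurable_cong]: "sets \<nu> = sets borel"
    and inv: "\<And>a. distr \<nu> borel ((+) a) = \<nu>"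
    and A [measurable]: "A \<in> sets borel" and Q [measurable]: "Q \<in> sets borel"
  shows "emeasure \<nu> A * emeasure lborel Q = emeasure \<nu> (uminus -` Q) * emeasure lborel A"
proof -
  interpret \<nu>: sigma_finite_measure \<nu> by fact
  interpret pair_sigma_finite lborel \<nu> by unfold_locales
  have [simp]: "space \<nu> = UNIV"
    using sets_eq_imp_space_eq[OF sets] by simp
  have Q': "uminus -` Q \<in> sets borel"
    using measurable_sets[of uminus borel borel Q] by simp
  have "emeasure \<nu> A * emeasure lborel Q = (\<integral>\<^sup>+y. indicator A y * emeasure lborel Q \<partial>\<nu>)"
    by (simp add: nn_integral_multc sets)
  also have "\<dots> = (\<integral>\<^sup>+y. (\<integral>\<^sup>+x. indicator A y * indicator Q (x - y) \<partial>lborel) \<partial>\<nu>)"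
  proof (rule nn_integral_cong)
    fix y
    have "emeasure lborel Q = (\<integral>\<^sup>+x. indicator Q x \<partial>distr lborel borel ((+) (- y)))"
      unfolding lborel_distr_plus by simp
    also have "\<dots> = (\<integral>\<^sup>+x. indicator Q (x - y) \<partial>lborel)"
      by (subst nn_integral_distr) auto
    finally show "indicator A y * emeasure lborel Q = (\<integral>\<^sup>+x. indicator A y * indicator Q (x - y) \<partial>lborel)"
      by (simp add: nn_integral_cmult)
  qed
  also have "\<dots> = (\<integral>\<^sup>+x. (\<integral>\<^sup>+y. indicator A y * indicator Q (x - y) \<partial>\<nu>) \<partial>lborel)"
    by (rule Fubini') measurable
  \<comment> \<open>The substitution y = x + z turns the second factor into one free of x, so that
    the next exchange of integrals separates the variables; this is where the reflected set comes
    from.\<close>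
  also have "\<dots> = (\<integral>\<^sup>+x. (\<integral>\<^sup>+z. indicator A (x + z) * indicator Q (- z) \<partial>\<nu>) \<partial>lborel)"
  proof (rule nn_integral_cong)
    fix x
    have "(\<integral>\<^sup>+y. indicator A y * indicator Q (x - y) \<partial>\<nu>)
        = (\<integral>\<^sup>+y. indicator A y * indicator Q (x - y) \<partial>distr \<nu> borel ((+) x))"
      by (simp add: inv)
    also have "\<dots> = (\<integral>\<^sup>+z. indicator A (x + z) * indicator Q (- z) \<partial>\<nu>)"
      by (subst nn_integral_distr) auto
    finally show "(\<integral>\<^sup>+y. indicator A y * indicator Q (x - y) \<partial>\<nu>)
        = (\<integral>\<^sup>+z. indicator A (x + z) * indicator Q (- z) \<partial>\<nu>)" .
  qed
  also have "\<dots> = (\<integral>\<^sup>+z. (\<integral>\<^sup>+x. indicator A (x + z) * indicator Q (- z) \<partial>lborel) \<partial>\<nu>)"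
    by (rule Fubini'[symmetric]) measurable
  also have "\<dots> = (\<integral>\<^sup>+z. emeasure lborel A * indicator (uminus -` Q) z \<partial>\<nu>)"
  proof (rule nn_integral_cong)
    fix z
    have "emeasure lborel A = (\<integral>\<^sup>+x. indicator A x \<partial>distr lborel borel ((+) z))"
      unfolding lborel_distr_plus by simp
    also have "\<dots> = (\<integral>\<^sup>+x. indicator A (x + z) \<partial>lborel)"
      by (subst nn_integral_distr) (auto simp: add.commute)
    finally show "(\<integral>\<^sup>+x. indicator A (x + z) * indicator Q (- z) \<partial>lborel)
        = emeasure lborel A * indicator (uminus -` Q) z"
      by (simp add: nn_integral_multc indicator_def)
  qed
  also have "\<dots> = emeasure \<nu> (uminus -` Q) * emeasure lborel A"
    using Q' by (simp add: nn_integral_cmult sets mult.commute)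
  finally show ?thesis .
qed

text \<open>The constant is the ratio of the two measures of the unit ball. Its exact value would
  take the isodiametric inequality; finiteness follows from the covering estimate and positivity
  from a crude comparison.\<close>

lemma hausdorff_outer_lborel:
  obtains c :: real where "c > 0"
    "\<And>B :: 'a::euclidean_space set. B \<in> sets borel \<Longrightarrow> hausdorff_outer DIM('a) B = ennreal c * emeasure lborel B"
proof -
  define n where "n = real DIM('a)"
  define V where "V = unit_ball_vol n"
  have "V > 0" "n > 0" by (auto simp: V_def n_def)
  define \<nu> where "\<nu> = (hausdorff_measure n :: 'a measure)"
  have sets: "sets \<nu> = sets borel" and \<nu>: "\<And>B. B \<in> sets borel \<Longrightarrow> emeasure \<nu> B = hausdorff_outer n B"
    by (auto simp: \<nu>_def emeasure_hausdorff_measure)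
  have fin: "hausdorff_outer n (ball (0::'a) R) \<noteq> \<infinity>" for R
  proof -
    have "hausdorff_outer n (ball (0::'a) R) \<le> ennreal (2 powr n / V * measure lborel (ball (0::'a) R))"
    proof (rule hausdorff_outer_le_open)
      fix p :: 'a and d :: real assume "d > 0"
      then show "\<exists>r>0. r < d \<and> V * r powr n \<le> measure lborel (cball p r)"
        by (intro exI[of _ "d / 2"]) (auto simp: measure_cball_lborel V_def n_def)
    qed (use \<open>V > 0\<close> emeasure_lborel_ball_finite[of "0::'a" R] in auto)
    then show ?thesis by (auto simp: top_unique)
  qed
  have "sigma_finite_measure \<nu>"
  proof
    show "\<exists>A::'a set set. countable A \<and> A \<subseteq> sets \<nu> \<and> \<Union>A = space \<nu> \<and> (\<forall>a\<in>A. emeasure \<nu> a \<noteq> \<infinity>)"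
    proof (intro exI conjI)
      have "\<exists>k::nat. norm x < real k" for x :: 'a
        by (rule reals_Archimedean2)
      then show "\<Union> (range (\<lambda>k::nat. ball (0::'a) (real k))) = space \<nu>"
        by (auto simp: \<nu>_def)
    qed (use sets \<nu> fin in auto)
  qed
  moreover have "distr \<nu> borel ((+) a) = \<nu>" for a
  proof (rule measure_eqI)
    fix B assume "B \<in> sets (distr \<nu> borel ((+) a))"
    then have B: "B \<in> sets borel" by simp
    have eq: "(+) a -` B = (+) (- a) ` B"
    proof (intro equalityI subsetI)
      fix x assume "x \<in> (+) a -` B"
      then show "x \<in> (+) (- a) ` B" by (intro image_eqI[of _ _ "a + x"]) auto
    qed auto
    have "(+) a -` B \<in> sets borel"
      using measurable_sets[of "(+) a" borel borel B] B by simp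
    moreover have "emeasure (distr \<nu> borel ((+) a)) B = emeasure \<nu> ((+) a -` B)"
      using B sets sets_eq_imp_space_eq[OF sets] by (subst emeasure_distr) (auto simp: measurable_cong_sets[OF sets refl])
    ultimately have "emeasure (distr \<nu> borel ((+) a)) B = hausdorff_outer n ((+) (- a) ` B)"
      using \<nu> eq by metis
    then show "emeasure (distr \<nu> borel ((+) a)) B = emeasure \<nu> B"
      unfolding hausdorff_outer_translate \<nu>[OF B] .
  qed (simp add: sets)
  ultimately have key: "emeasure \<nu> A * emeasure lborel (ball (0::'a) 1) = emeasure \<nu> (ball 0 1) * emeasure lborel A"
    if "A \<in> sets borel" for A
  proof -
    have "uminus -` ball (0::'a) 1 = ball 0 1" by auto
    then show ?thesis
      using translation_invariant_unique[OF \<open>sigma_finite_measure \<nu>\<close> sets \<open>\<And>a. distr \<nu> borel ((+) a) = \<nu>\<close> that, of "ball 0 1"]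
      by simp
  qed
  define v where "v = measure lborel (ball (0::'a) 1)"
  have v: "v > 0" "emeasure lborel (ball (0::'a) 1) = ennreal v"
    using emeasure_lborel_ball_finite[of "0::'a" 1]
    by (auto simp: v_def intro: emeasure_eq_ennreal_measure)
  define h where "h = enn2real (hausdorff_outer n (ball (0::'a) 1))"
  have h: "ennreal h = hausdorff_outer n (ball (0::'a) 1)" "h \<ge> 0"
    using fin[of 1] by (auto simp: h_def less_top)
  \<comment> \<open>A set lies in the ball about any of its points with its diameter as radius. The
    constant is far from sharp, but only positivity of h is at stake.\<close>
  have "emeasure lborel (ball (0::'a) 1) \<le> ennreal V * hausdorff_outer n (ball (0::'a) 1)"
  proof (rule emeasure_le_hausdorff_outer)
    fix p :: 'a
    have "emeasure lborel C \<le> ennreal (V * diameter C powr n)" if "closed C" "bounded C" "p \<in> C" for C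
    proof -
      have "C \<subseteq> cball p (diameter C)"
        using that diameter_bounded_bound[of C] by auto
      then have "emeasure lborel C \<le> emeasure lborel (cball p (diameter C))"
        by (intro emeasure_mono) auto
      then show ?thesis
        using diameter_ge_0[OF that(2)] by (simp add: emeasure_cball_lborel V_def n_def)
    qed
    then show "\<exists>d>0. \<forall>C. closed C \<longrightarrow> bounded C \<longrightarrow> p \<in> C \<longrightarrow> diameter C < d \<longrightarrow>
      emeasure lborel C \<le> ennreal (V * diameter C powr n)"
      by (intro exI[of _ 1]) auto
  qed (use \<open>V > 0\<close> in auto)
  then have "ennreal v \<le> ennreal (V * h)"
    using h \<open>V > 0\<close> v by (simp add: ennreal_mult)
  then have "h \<noteq> 0"
    using v by (auto simp: ennreal_le_iff2)
  with h have "h > 0" by simp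
  show ?thesis
  proof (rule that[of "h / v"])
    show "h / v > 0" using \<open>h > 0\<close> v by simp
    fix B :: "'a set" assume B: "B \<in> sets borel"
    then have "hausdorff_outer n B * ennreal v = ennreal h * emeasure lborel B"
      using key[OF B] v h by (simp add: \<nu>)
    then have "hausdorff_outer n B * (ennreal v * ennreal (1 / v)) = ennreal h * ennreal (1 / v) * emeasure lborel B"
      by (metis mult.assoc mult.commute)
    then show "hausdorff_outer DIM('a) B = ennreal (h / v) * emeasure lborel B"
      using v(1) h(2) by (simp add: ennreal_mult[symmetric] n_def)
  qed
qed

text \<open>The Vitali balls are chosen for \<mu> and weighed by volume. Counting radii instead of
  diameters avoids the factor 2^n of the Hausdorff estimate.\<close>

lemma lborel_le_measure:
  fixes \<mu> :: "'a::euclidean_space measure"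
  assumes fin: "finite_measure \<mu>" and sets: "sets \<mu> = sets borel" and F: "F \<in> sets borel"
    and "t > 0"
    and dens: "\<And>p d. p \<in> F \<Longrightarrow> d > 0 \<Longrightarrow> \<exists>r>0. r < d \<and> t * r powr DIM('a) \<le> measure \<mu> (cball p r)"
  shows "emeasure lborel F \<le> ennreal (unit_ball_vol DIM('a) / t) * emeasure \<mu> F"
proof (cases "F = {}")
  case False
  interpret finite_measure \<mu> by fact
  define V where "V = unit_ball_vol DIM('a)"
  have "V > 0" by (simp add: V_def)
  show ?thesis
    unfolding V_def[symmetric]
  proof (rule ennreal_le_epsilon)
    fix e :: real assume "e > 0"
    \<comment> \<open>Both the excess of U over F, multiplied by V/t, and the slack of the cover,
      multiplied by V, have to fit into e.\<close>
    define e' where "e' = e / (V / t + V)"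
    have "V / t + V > 0" using \<open>V > 0\<close> \<open>t > 0\<close> by (simp add: add_pos_pos)
    then have e': "e' > 0" "V / t * e' + V * e' = e"
      using \<open>e > 0\<close> unfolding distrib_right[symmetric] e'_def by simp_all
    obtain U where U: "open U" "F \<subseteq> U" "measure \<mu> U \<le> measure \<mu> F + e'"
      using finite_outer_regular_open[OF fin sets F e'(1)] by blast
    have "emeasure \<mu> U \<noteq> \<infinity>" by simp
    from vitali_cover_sequence[OF sets U(1,2) this False \<open>t > 0\<close> zero_less_one e'(1) dens]
    obtain x R where x: "range x \<subseteq> F" and R: "\<And>i. 0 \<le> R i" "\<And>i. R i \<le> 1" and
      cov: "F \<subseteq> (\<Union>i::nat. cball (x i) (R i))" and
      sum: "(\<Sum>i. ennreal (R i powr DIM('a))) \<le> ennreal (measure \<mu> U / t + e')"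
      by blast
    have "emeasure lborel F \<le> emeasure lborel (\<Union>i. cball (x i) (R i))"
      using cov by (intro emeasure_mono) auto
    also have "\<dots> \<le> (\<Sum>i. emeasure lborel (cball (x i) (R i)))"
      by (intro emeasure_subadditive_countably) auto
    also have "\<dots> = ennreal V * (\<Sum>i. ennreal (R i powr DIM('a)))"
      using R \<open>V > 0\<close> by (simp add: emeasure_cball_lborel V_def[symmetric] ennreal_mult)
    also have "\<dots> \<le> ennreal V * ennreal (measure \<mu> U / t + e')"
      using sum by (intro mult_left_mono) auto
    also have "\<dots> = ennreal (V * (measure \<mu> U / t + e'))"
      using \<open>V > 0\<close> \<open>t > 0\<close> e' by (intro ennreal_mult[symmetric]) auto
    also have "\<dots> \<le> ennreal (V / t * measure \<mu> F + e)"
    proof (rule ennreal_leI)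
      have "V / t * measure \<mu> U \<le> V / t * (measure \<mu> F + e')"
        using U(3) \<open>V > 0\<close> \<open>t > 0\<close> by (intro mult_left_mono) auto
      then show "V * (measure \<mu> U / t + e') \<le> V / t * measure \<mu> F + e"
        using e'(2) by (simp add: distrib_left)
    qed
    also have "\<dots> = ennreal (V / t) * emeasure \<mu> F + ennreal e"
      using \<open>V > 0\<close> \<open>t > 0\<close> \<open>e > 0\<close> by (simp add: emeasure_eq_measure ennreal_mult[symmetric])
    finally show "emeasure lborel F \<le> ennreal (V / t) * emeasure \<mu> F + ennreal e" .
  qed
qed auto

text \<open>Here the Vitali balls are chosen for Lebesgue measure, where every ball qualifies with t
  = V, and the density bound controls their \<mu>-mass. It applies because the balls are centred in
  the set being covered, namely the part \<open>G k\<close> of F where the bound holds below one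
  common scale.\<close>

lemma measure_le_lborel:
  fixes \<mu> :: "'a::euclidean_space measure"
  assumes fin: "finite_measure \<mu>" and sets: "sets \<mu> = sets borel" and F: "F \<in> sets borel"
    and "b > 0"
    and dens: "\<And>p. p \<in> F \<Longrightarrow> \<exists>k::nat. ball_le \<mu> DIM('a) (1 / Suc k) b p"
  shows "emeasure \<mu> F \<le> ennreal (b / unit_ball_vol DIM('a)) * emeasure lborel F"
proof (cases "emeasure lborel F = \<infinity>")
  case True
  have "b / unit_ball_vol DIM('a) > 0"
    using \<open>b > 0\<close> by simp
  then have "ennreal (b / unit_ball_vol DIM('a)) \<noteq> 0"
    by (simp only: ennreal_eq_0_iff not_le)
  with True show ?thesis
    by (simp only: infinity_ennreal_def ennreal_mult_top if_False top_greatest)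
next
  case False
  interpret finite_measure \<mu> by fact
  define n where "n = real DIM('a)"
  define V where "V = unit_ball_vol DIM('a)"
  have "V > 0" "n > 0" by (auto simp: V_def n_def)
  define G where "G = (\<lambda>k::nat. F \<inter> {p. ball_le \<mu> n (1 / Suc k) b p})"
  have G_sets: "G k \<in> sets borel" for k
    unfolding G_def using F sets_ball_le[OF fin sets] by (rule sets.Int)
  have G_le: "emeasure \<mu> (G k) \<le> ennreal (b / V) * emeasure lborel F" for k
  proof (cases "G k = {}")
    case nonempty: False
    show ?thesis
    proof (rule ennreal_le_epsilon)
      fix e :: real assume "e > 0"
      define e' where "e' = e / (b / V + b)"
      have "b / V + b > 0" using \<open>V > 0\<close> \<open>b > 0\<close> by (simp add: add_pos_pos)
      then have e': "e' > 0" "b / V * e' + b * e' = e"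
        using \<open>e > 0\<close> unfolding distrib_right[symmetric] e'_def by simp_all
      obtain U where U: "open U" "F \<subseteq> U" "emeasure lborel (U - F) < ennreal e'"
        using outer_regular_lborel[OF F e'(1)] by blast
      have "emeasure lborel U = emeasure lborel F + emeasure lborel (U - F)"
        using U F by (subst plus_emeasure) (auto simp: Un_absorb1)
      then have U_le: "emeasure lborel U \<le> emeasure lborel F + ennreal e'"
        using U(3) by (simp add: add_left_mono less_imp_le)
      then have U_fin: "emeasure lborel U \<noteq> \<infinity>"
        using False by (auto simp: top_unique)
      have sub: "G k \<subseteq> U" using U by (auto simp: G_def)
      have d: "1 / real (Suc (Suc k)) > 0" by simp
      have dens': "\<exists>r>0. r < d \<and> V * r powr n \<le> measure lborel (cball p r)" if "d > 0" for p :: 'a and d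
        using that by (intro exI[of _ "d / 2"]) (auto simp: measure_cball_lborel V_def n_def)
      obtain x R where x: "range x \<subseteq> G k" and R: "\<And>i. 0 \<le> R i" "\<And>i. R i \<le> 1 / real (Suc (Suc k))" and
        cov: "G k \<subseteq> (\<Union>i::nat. cball (x i) (R i))" and
        sum: "(\<Sum>i. ennreal (R i powr n)) \<le> ennreal (measure lborel U / V + e')"
        by (rule vitali_cover_sequence[OF sets_lborel U(1) sub U_fin nonempty \<open>V > 0\<close> d e'(1) dens']; blast)
      have ball: "measure \<mu> (cball (x i) (R i)) \<le> b * R i powr n" for i
      proof (rule measure_cball_le[OF fin sets _ R(1) _ \<open>n > 0\<close>])
        show "ball_le \<mu> n (1 / Suc k) b (x i)"
          using x by (auto simp: G_def)
        show "R i < 1 / real (Suc k)"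
          using R(2)[of i] by (rule order_le_less_trans) (simp add: frac_less2)
      qed
      have "emeasure \<mu> (G k) \<le> emeasure \<mu> (\<Union>i. cball (x i) (R i))"
        using cov by (intro emeasure_mono) (auto simp: sets)
      also have "\<dots> \<le> (\<Sum>i. emeasure \<mu> (cball (x i) (R i)))"
        by (intro emeasure_subadditive_countably) (auto simp: sets)
      also have "\<dots> \<le> (\<Sum>i. ennreal b * ennreal (R i powr n))"
      proof (rule suminf_le)
        show "emeasure \<mu> (cball (x i) (R i)) \<le> ennreal b * ennreal (R i powr n)" for i
          unfolding emeasure_eq_measure using ball[of i] \<open>b > 0\<close>
          by (subst ennreal_mult[symmetric]) (auto intro: ennreal_leI)
      qed auto
      also have "\<dots> = ennreal b * (\<Sum>i. ennreal (R i powr n))"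
        by simp
      also have "\<dots> \<le> ennreal b * ennreal (measure lborel U / V + e')"
        using sum by (intro mult_left_mono) auto
      also have "\<dots> = ennreal (b / V) * ennreal (measure lborel U) + ennreal (b * e')"
        using \<open>V > 0\<close> \<open>b > 0\<close> e'(1) by (simp add: ennreal_mult[symmetric] ennreal_plus[symmetric] distrib_left del: ennreal_plus)
      also have "ennreal (measure lborel U) = emeasure lborel U"
        using U_fin by (simp add: emeasure_eq_ennreal_measure)
      also have "ennreal (b / V) * emeasure lborel U + ennreal (b * e')
          \<le> ennreal (b / V) * (emeasure lborel F + ennreal e') + ennreal (b * e')"
        using U_le by (intro add_right_mono mult_left_mono) auto
      also have "\<dots> = ennreal (b / V) * emeasure lborel F + (ennreal (b / V * e') + ennreal (b * e'))"
        using \<open>V > 0\<close> \<open>b > 0\<close> e'(1) by (simp add: distrib_left ennreal_mult[symmetric] add.assoc)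
      also have "ennreal (b / V * e') + ennreal (b * e') = ennreal e"
        using \<open>V > 0\<close> \<open>b > 0\<close> e' by (subst ennreal_plus[symmetric]) auto
      finally show "emeasure \<mu> (G k) \<le> ennreal (b / V) * emeasure lborel F + ennreal e" .
    qed
  qed auto
  have "incseq G"
  proof (rule incseq_SucI)
    show "G k \<le> G (Suc k)" for k
      by (auto simp: G_def elim!: ball_le_mono intro: frac_le)
  qed
  moreover have "F = (\<Union>k. G k)"
    using dens by (auto simp: G_def n_def)
  ultimately have "emeasure \<mu> F = (SUP k. emeasure \<mu> (G k))"
    using G_sets sets by (subst SUP_emeasure_incseq) auto
  then show ?thesis
    unfolding V_def[symmetric] using G_le by (auto intro: SUP_least)
qed

section \<open>Supports of uniform measures are lines\<close>

text \<open>The reverse triangle inequality forces equality in the last hypothesis, and equality in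
  Cauchy-Schwarz makes y - x and z - x parallel with the same direction.\<close>

lemma point_on_ray:
  fixes x y z :: "'a::real_inner"
  assumes "dist x y = d" "dist x z = t" "d > 0" "dist y z \<le> \<bar>t - d\<bar>"
  shows "z = x + (t / d) *\<^sub>R (y - x)"
proof -
  define u w where "u = y - x" and "w = z - x"
  have n: "norm u = d" "norm w = t" "norm (u - w) \<le> \<bar>t - d\<bar>"
    using assms unfolding u_def w_def dist_norm by (simp_all add: norm_minus_commute)
  have "(norm (u - w))\<^sup>2 \<le> (t - d)\<^sup>2"
    using n(3) by (metis abs_le_square_iff abs_norm_cancel)
  moreover have "(norm (u - w))\<^sup>2 = d\<^sup>2 + t\<^sup>2 - 2 * (u \<bullet> w)"
    using n by (simp add: power2_norm_eq_inner inner_diff_left inner_diff_right inner_commute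
        flip: n(1) n(2))
  ultimately have uw: "u \<bullet> w \<ge> d * t"
    by (simp add: power2_eq_square algebra_simps)
  have "(norm (d *\<^sub>R w - t *\<^sub>R u))\<^sup>2 = d * d * (w \<bullet> w) + t * t * (u \<bullet> u) - 2 * d * t * (u \<bullet> w)"
    by (simp add: power2_norm_eq_inner inner_diff_left inner_diff_right inner_commute algebra_simps)
  also have "\<dots> = 2 * (d * t) * (d * t - u \<bullet> w)"
    using n(1,2) by (simp add: dot_square_norm power2_eq_square algebra_simps)
  also have "\<dots> \<le> 0"
    using uw \<open>d > 0\<close> n(2) norm_ge_zero[of w] by (intro mult_nonneg_nonpos) auto
  finally have "d *\<^sub>R w = t *\<^sub>R u"
    by simp
  have "w = (1 / d) *\<^sub>R (d *\<^sub>R w)"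
    using \<open>d > 0\<close> by simp
  also have "\<dots> = (t / d) *\<^sub>R u"
    unfolding \<open>d *\<^sub>R w = t *\<^sub>R u\<close> by simp
  finally have "w = (t / d) *\<^sub>R u" .
  then show ?thesis
    by (simp add: u_def w_def algebra_simps)
qed

text \<open>The combinatorial shadow of a measure with \<open>\<mu>(B(x,r)) = 2r\<close> for all \<open>x\<close> in its support \<open>S\<close>.\<close>
locale uniform_support =
  fixes S :: "'a::euclidean_space set"
  assumes closed_S: "closed S"
    and packing: "\<lbrakk>finite P; P \<subseteq> S \<times> {0<..}; x \<in> S; 0 < R;
      \<And>p q. p \<in> P \<Longrightarrow> q \<in> P \<Longrightarrow> p \<noteq> q \<Longrightarrow> snd p + snd q \<le> dist (fst p) (fst q);
      \<And>p. p \<in> P \<Longrightarrow> dist x (fst p) + snd p \<le> R\<rbrakk> \<Longrightarrow> (\<Sum>p\<in>P. snd p) \<le> R"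
    and covering: "\<lbrakk>finite P; P \<subseteq> S \<times> {0<..}; x \<in> S;
      S \<inter> cball x R \<subseteq> (\<Union>p\<in>P. ball (fst p) (snd p))\<rbrakk> \<Longrightarrow> R \<le> (\<Sum>p\<in>P. snd p)"
begin

text \<open>If no point of S had distance between \<rho> and \<rho> + e from x, the single ball of
  radius \<rho> would cover S inside radius \<rho> + e, against \<open>covering\<close>. Compactness
  removes e.\<close>

lemma sphere_meets:
  assumes x: "x \<in> S" and "\<rho> > 0"
  obtains z where "z \<in> S" "dist x z = \<rho>"
proof -
  have ex: "\<exists>z\<in>S. \<rho> \<le> dist x z \<and> dist x z \<le> \<rho> + e" if "e > 0" for e
  proof (rule ccontr)
    assume "\<not> ?thesis"
    then have "S \<inter> cball x (\<rho> + e) \<subseteq> (\<Union>p\<in>{(x, \<rho>)}. ball (fst p) (snd p))"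
      by (auto simp: not_le)
    from covering[OF _ _ x this] show False
      using x \<open>\<rho> > 0\<close> \<open>e > 0\<close> by auto
  qed
  define K where "K = S \<inter> (cball x (\<rho> + 1) - ball x \<rho>)"
  have "compact K"
    unfolding K_def Diff_eq using closed_S
    by (metis Diff_eq closed_Int_compact compact_cball compact_diff open_ball)
  moreover have "K \<noteq> {}"
    using ex[of 1] by (force simp: K_def)
  moreover have "continuous_on K (dist x)"
    by (intro continuous_intros)
  ultimately obtain z where z: "z \<in> K" "\<And>w. w \<in> K \<Longrightarrow> dist x z \<le> dist x w"
    using continuous_attains_inf[of K "dist x"] by metis
  have "dist x z \<le> \<rho>"
  proof (rule field_le_epsilon)
    fix e :: real assume "e > 0"
    then obtain w where "w \<in> S" "\<rho> \<le> dist x w" "dist x w \<le> \<rho> + min e 1"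
      using ex[of "min e 1"] by auto
    then show "dist x z \<le> \<rho> + e"
      using z(2)[of w] by (simp add: K_def min_def split: if_splits)
  qed
  with z(1) show ?thesis
    by (intro that[of z]) (auto simp: K_def)
qed

lemma annulus_subset_rays:
  assumes S: "x \<in> S" "y \<in> S" "y' \<in> S" "z \<in> S"
    and d: "dist x y = d" "dist x y' = d" "y \<noteq> y'"
    and z: "\<bar>dist x z - d\<bar> < dist y y' / 2"
  shows "z = x + (dist x z / d) *\<^sub>R (y - x) \<or> z = x + (dist x z / d) *\<^sub>R (y' - x)"
proof -
  define t where "t = dist x z"
  have e: "dist y y' \<le> 2 * d" "0 < dist y y'"
    using d dist_triangle2[of y y' x] by (auto simp: dist_commute)
  then have "d > 0" by linarith
  have "dist y z \<le> \<bar>t - d\<bar> \<or> dist y' z \<le> \<bar>t - d\<bar>"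
  proof (rule ccontr)
    assume "\<not> ?thesis"
    then have n: "dist y z > \<bar>t - d\<bar>" "dist y' z > \<bar>t - d\<bar>" by auto
    \<comment> \<open>\<sigma> must exceed |t - d| for z to lie strictly inside the annulus, stay
      below half of \<open>dist y y'\<close> to keep the balls about y and y' apart, and leave room
      between them and z.\<close>
    define \<delta> where "\<delta> = min (dist y y' / 2) (min (dist y z) (dist y' z))"
    have "\<bar>t - d\<bar> < \<delta>"
      unfolding \<delta>_def min_less_iff_conj using z n by (simp add: t_def)
    then obtain \<sigma> where \<sigma>: "\<bar>t - d\<bar> < \<sigma>" "\<sigma> < \<delta>"
      using dense by blast
    \<comment> \<open>The balls of radii \<open>d - \<sigma>\<close>, \<open>\<sigma>\<close>, \<open>\<sigma>\<close> about \<open>x\<close>, \<open>y\<close>, \<open>y'\<close> exhaust the ball of radius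
      \<open>d + \<sigma>\<close> about \<open>x\<close>, so there is no room for a fourth ball about \<open>z\<close>.\<close>
    have \<sigma>': "\<sigma> < dist y z" "\<sigma> < dist y' z" "2 * \<sigma> < dist y y'" "\<sigma> < d" "\<sigma> > 0"
      using \<sigma> e unfolding \<delta>_def by auto
    define \<kappa> where "\<kappa> = min (min (dist y z - \<sigma>) (dist y' z - \<sigma>)) (min (t - (d - \<sigma>)) (d + \<sigma> - t))"
    have \<kappa>: "\<kappa> > 0" "\<kappa> + \<sigma> \<le> dist y z" "\<kappa> + \<sigma> \<le> dist y' z" "\<kappa> + (d - \<sigma>) \<le> t" "t + \<kappa> \<le> d + \<sigma>"
      using \<sigma> \<sigma>' by (auto simp: \<kappa>_def)
    have ne: "x \<noteq> y" "x \<noteq> y'" "x \<noteq> z" "y \<noteq> z" "y' \<noteq> z"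
      using \<sigma>' \<kappa> \<open>d > 0\<close> d t_def by auto
    have "(\<Sum>p\<in>{(x, d - \<sigma>), (y, \<sigma>), (y', \<sigma>), (z, \<kappa>)}. snd p) \<le> d + \<sigma>"
    proof (rule packing[OF _ _ \<open>x \<in> S\<close>])
      fix p q
      assume "p \<in> {(x, d - \<sigma>), (y, \<sigma>), (y', \<sigma>), (z, \<kappa>)}" "q \<in> {(x, d - \<sigma>), (y, \<sigma>), (y', \<sigma>), (z, \<kappa>)}"
        "p \<noteq> q"
      then show "snd p + snd q \<le> dist (fst p) (fst q)"
        using d \<sigma>' \<kappa> by (auto simp: dist_commute t_def)
    qed (use S \<sigma>' \<kappa> d t_def in auto)
    moreover have "(\<Sum>p\<in>{(x, d - \<sigma>), (y, \<sigma>), (y', \<sigma>), (z, \<kappa>)}. snd p) = d + \<sigma> + \<kappa>"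
      using ne d by auto
    ultimately show False using \<kappa> by simp
  qed
  then show ?thesis
    using point_on_ray[of x y d z t] point_on_ray[of x y' d z t] d \<open>d > 0\<close> t_def by auto
qed

text \<open>One ray cannot sustain the growth in \<open>covering\<close> alone: if the y'-ray left S
  near radius t, a thin shell of S would lie on the y-ray, and one small ball would cover it too
  cheaply.\<close>

lemma ray_points_mem_aux:
  assumes S: "x \<in> S" "y \<in> S" "y' \<in> S"
    and d: "dist x y = d" "dist x y' = d" "y \<noteq> y'"
    and t: "\<bar>t - d\<bar> < dist y y' / 2"
    and y: "x + (t / d) *\<^sub>R (y - x) \<in> S"
  shows "x + (t / d) *\<^sub>R (y' - x) \<in> S"
proof (rule ccontr)
  define u where "u = (\<lambda>t. x + (t / d) *\<^sub>R (y - x))"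
  define u' where "u' = (\<lambda>t. x + (t / d) *\<^sub>R (y' - x))"
  have e: "dist y y' \<le> 2 * d" "0 < dist y y'"
    using d dist_triangle2[of y y' x] by (auto simp: dist_commute)
  then have "d > 0" by linarith
  assume "x + (t / d) *\<^sub>R (y' - x) \<notin> S"
  then have "u' t \<in> - S" by (simp add: u'_def)
  moreover have "open (u' -` (- S))"
    using closed_S \<open>d > 0\<close> unfolding u'_def
    by (intro open_vimage) (auto intro!: continuous_intros)
  ultimately obtain e1 where e1: "e1 > 0" "ball t e1 \<subseteq> u' -` (- S)"
    by (meson open_contains_ball vimageI)
  have "t > 0" using t e by linarith
  define \<eta> where "\<eta> = min (e1 / 2) (min (t / 2) ((dist y y' / 2 - \<bar>t - d\<bar>) / 2))"
  have \<eta>: "\<eta> > 0" "\<eta> < e1" "\<eta> < t" "\<bar>t - d\<bar> + \<eta> < dist y y' / 2"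
    using e1 t \<open>t > 0\<close> by (auto simp: \<eta>_def min_def field_simps)
  have d_uu: "dist (u a) (u b) = \<bar>a - b\<bar>" for a b
  proof -
    have "u a - u b = ((a - b) / d) *\<^sub>R (y - x)"
      by (simp add: u_def algebra_simps diff_divide_distrib)
    then show ?thesis
      using d(1) \<open>d > 0\<close> by (simp add: dist_norm norm_minus_commute)
  qed
  \<comment> \<open>The radii add up to t + 3\<eta>/4, less than the t + \<eta> that
    \<open>covering\<close> requires. The shell is within \<eta> of \<open>u t\<close>; the extra
    \<eta>/4 makes the covering ball open.\<close>
  have "S \<inter> cball x (t + \<eta>) \<subseteq> (\<Union>p\<in>{(x, t - \<eta> / 2), (u t, \<eta> + \<eta> / 4)}. ball (fst p) (snd p))"
  proof
    fix z assume z: "z \<in> S \<inter> cball x (t + \<eta>)"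
    show "z \<in> (\<Union>p\<in>{(x, t - \<eta> / 2), (u t, \<eta> + \<eta> / 4)}. ball (fst p) (snd p))"
    proof (cases "dist x z < t - \<eta> / 2")
      case False
      define a where "a = dist x z"
      have a: "\<bar>a - t\<bar> \<le> \<eta>"
        using z False \<eta> unfolding a_def mem_cball Int_iff abs_le_iff by auto
      have "\<bar>dist x z - d\<bar> < dist y y' / 2"
        using a \<eta> unfolding a_def by linarith
      then have "z = u a \<or> z = u' a"
        using annulus_subset_rays[OF S, of z d] z d unfolding u_def u'_def a_def by auto
      moreover have "u' a \<notin> S"
        using e1 a \<eta> by (force simp: dist_real_def)
      ultimately have "z = u a" using z by auto
      then have "dist (u t) z < \<eta> + \<eta> / 4"
        using d_uu[of t a] a \<eta> by (simp add: abs_minus_commute)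
      then show ?thesis by auto
    qed auto
  qed
  from covering[OF _ _ \<open>x \<in> S\<close> this]
  have "t + \<eta> \<le> (\<Sum>p\<in>{(x, t - \<eta> / 2), (u t, \<eta> + \<eta> / 4)}. snd p)"
    using S y \<eta> by (auto simp: u_def)
  moreover have "x \<noteq> u t"
    using \<open>t > 0\<close> \<open>d > 0\<close> d by (auto simp: u_def)
  ultimately show False
    using \<eta> by auto
qed

lemma ray_points_mem:
  assumes S: "x \<in> S" "y \<in> S" "y' \<in> S"
    and d: "dist x y = d" "dist x y' = d" "y \<noteq> y'"
    and t: "\<bar>t - d\<bar> < dist y y' / 2"
  shows "x + (t / d) *\<^sub>R (y - x) \<in> S" "x + (t / d) *\<^sub>R (y' - x) \<in> S"
proof -
  have e: "dist y y' \<le> 2 * d"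
    using d dist_triangle2[of y y' x] by (auto simp: dist_commute)
  with t have "t > 0" by linarith
  then obtain z where z: "z \<in> S" "dist x z = t"
    using sphere_meets[OF \<open>x \<in> S\<close>] by blast
  then have "x + (t / d) *\<^sub>R (y - x) \<in> S \<or> x + (t / d) *\<^sub>R (y' - x) \<in> S"
    using annulus_subset_rays[OF S z(1) d] t by auto
  then show "x + (t / d) *\<^sub>R (y - x) \<in> S" "x + (t / d) *\<^sub>R (y' - x) \<in> S"
    using ray_points_mem_aux[OF S d t] ray_points_mem_aux[of x y' y d t] S d t
    by (auto simp: dist_commute)
qed

text \<open>The local statements hold only for radii near d. The scales at which both rays meet S
  form a set that is open by \<open>step\<close> and closed because S is, hence all of the positive
  half-line.\<close>

lemma two_rays:
  assumes S: "x \<in> S" "y \<in> S" "y' \<in> S"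
    and d: "dist x y = d" "dist x y' = d" "y \<noteq> y'" and "t > 0"
  shows "x + t *\<^sub>R (y - x) \<in> S" "x + t *\<^sub>R (y' - x) \<in> S"
    "\<And>z. z \<in> S \<Longrightarrow> dist x z = t * d \<Longrightarrow> z = x + t *\<^sub>R (y - x) \<or> z = x + t *\<^sub>R (y' - x)"
proof -
  define u where "u = (\<lambda>t. x + t *\<^sub>R (y - x))"
  define u' where "u' = (\<lambda>t. x + t *\<^sub>R (y' - x))"
  define T where "T = {t. 0 < t \<and> u t \<in> S \<and> u' t \<in> S}"
  have "d > 0"
    using d by (metis dist_eq_0_iff zero_less_dist_iff)
  have du: "dist x (u a) = a * d" "dist x (u' a) = a * d" "dist (u a) (u' a) = a * dist y y'"
    if "a > 0" for a
  proof -
    show "dist x (u a) = a * d" "dist x (u' a) = a * d"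
      using d that by (simp_all add: u_def u'_def dist_norm norm_minus_commute)
    have "u a - u' a = a *\<^sub>R (y - y')"
      by (simp add: u_def u'_def algebra_simps)
    then show "dist (u a) (u' a) = a * dist y y'"
      using that by (simp add: dist_norm)
  qed
  \<comment> \<open>The local lemma is applied to the pair \<open>u a\<close>, \<open>u' a\<close>,
    whose distances to x and to each other are proportional to a.\<close>
  have step: "b \<in> T" if "a \<in> T" "\<bar>b - a\<bar> * d < a * dist y y' / 2" for a b
  proof -
    have a: "a > 0" "u a \<in> S" "u' a \<in> S" using that by (auto simp: T_def)
    have "dist y y' \<le> 2 * d"
      using d dist_triangle2[of y y' x] by (auto simp: dist_commute)
    then have "a * dist y y' / 2 \<le> a * d"
      using \<open>a > 0\<close> by simp
    then have "\<bar>b - a\<bar> * d < a * d" using that by linarith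
    then have "\<bar>b - a\<bar> < a"
      using \<open>d > 0\<close> by simp
    then have "b > 0" by linarith
    have "\<bar>b * d - a * d\<bar> < dist (u a) (u' a) / 2"
      using that \<open>d > 0\<close> du(3)[OF \<open>a > 0\<close>] by (simp add: left_diff_distrib[symmetric] abs_mult)
    moreover have "u a \<noteq> u' a"
      using du(3)[OF \<open>a > 0\<close>] d \<open>a > 0\<close> by auto
    ultimately have "x + (b * d / (a * d)) *\<^sub>R (u a - x) \<in> S" "x + (b * d / (a * d)) *\<^sub>R (u' a - x) \<in> S"
      using ray_points_mem[OF S(1) a(2,3) du(1,2)[OF \<open>a > 0\<close>]] by blast+
    then show ?thesis
      using \<open>a > 0\<close> \<open>b > 0\<close> \<open>d > 0\<close> by (simp add: T_def u_def u'_def)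
  qed
  have "open T"
    unfolding open_contains_ball
  proof
    fix a assume "a \<in> T"
    then have "a > 0" by (simp add: T_def)
    then have "a * dist y y' / 2 / d > 0"
      using d \<open>d > 0\<close> by simp
    moreover have "ball a (a * dist y y' / 2 / d) \<subseteq> T"
      using step[OF \<open>a \<in> T\<close>] \<open>d > 0\<close>
      by (auto simp: dist_real_def abs_minus_commute field_simps)
    ultimately show "\<exists>e>0. ball a e \<subseteq> T" by blast
  qed
  moreover have "closedin (top_of_set {0<..}) T"
  proof -
    have "T = {0<..} \<inter> (u -` S \<inter> u' -` S)"
      by (auto simp: T_def)
    moreover have "closed (u -` S \<inter> u' -` S)"
      using closed_S unfolding u_def u'_def
      by (intro closed_Int closed_vimage) (auto intro!: continuous_intros)
    ultimately show ?thesis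
      using closedin_closed by blast
  qed
  moreover have "openin (top_of_set {0<..}) T" if "open T"
    using that by (intro open_subset) (auto simp: T_def)
  moreover have "1 \<in> T"
    using S by (simp add: T_def u_def u'_def)
  ultimately have "T = {0<..}"
    using connected_clopen[of "{0<..}::real set"] by (metis connected_Ioi empty_iff)
  then have t: "u t \<in> S" "u' t \<in> S"
    using \<open>t > 0\<close> by (auto simp: T_def)
  then show "x + t *\<^sub>R (y - x) \<in> S" "x + t *\<^sub>R (y' - x) \<in> S"
    by (auto simp: u_def u'_def)
  fix z assume z: "z \<in> S" "dist x z = t * d"
  have "u t \<noteq> u' t"
    using du(3)[OF \<open>t > 0\<close>] d \<open>t > 0\<close> by auto
  then show "z = x + t *\<^sub>R (y - x) \<or> z = x + t *\<^sub>R (y' - x)"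
    using annulus_subset_rays[OF S(1) t z(1), of "t * d"] du[OF \<open>t > 0\<close>] z \<open>d > 0\<close> \<open>t > 0\<close>
    by (auto simp: u_def u'_def)
qed

text \<open>The part of S between radii 1 and 2 about x is split into points near y and points far
  from y. Both parts are compact and their distances to x cover [1, 2], so by connectedness some
  distance occurs in both. The two points found may coincide, and then y serves as apex instead of
  x.\<close>

lemma ex_isosceles:
  assumes "S \<noteq> {}"
  obtains x y y' where "x \<in> S" "y \<in> S" "y' \<in> S" "dist x y = dist x y'" "y \<noteq> y'"
proof -
  obtain x where x: "x \<in> S" using assms by auto
  obtain y where y: "y \<in> S" "dist x y = 1"
    using sphere_meets[OF x, of 1] by auto
  obtain v where v: "v \<in> S" "dist x v = 2"
    using sphere_meets[OF x, of 2] by auto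
  define K1 where "K1 = S \<inter> cball x 2 \<inter> cball y 1 - ball x 1"
  define K2 where "K2 = S \<inter> cball x 2 - ball x 1 - ball y 1"
  have "compact K1" "compact K2"
    using closed_S unfolding K1_def K2_def
    by (auto intro!: compact_diff compact_Int_closed closed_Int_compact)
  then have cl: "closed (dist x ` K1)" "closed (dist x ` K2)"
    by (auto intro!: compact_imp_closed compact_continuous_image continuous_intros)
  have "y \<in> K1" "v \<in> K2"
    using x y v dist_triangle2[of x v y] dist_triangle[of x v y] by (auto simp: K1_def K2_def dist_commute)
  have "{1..2} \<subseteq> dist x ` K1 \<union> dist x ` K2"
  proof
    fix t :: real assume t: "t \<in> {1..2}"
    then obtain z where "z \<in> S" "dist x z = t"
      using sphere_meets[OF x, of t] by auto
    with t have "z \<in> K1 \<union> K2" by (auto simp: K1_def K2_def)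
    with \<open>dist x z = t\<close> show "t \<in> dist x ` K1 \<union> dist x ` K2" by auto
  qed
  moreover have "1 \<in> dist x ` K1 \<inter> {1..2}" "2 \<in> dist x ` K2 \<inter> {1..2}"
    using \<open>y \<in> K1\<close> \<open>v \<in> K2\<close> y v by (auto intro!: image_eqI[of _ "dist x"])
  ultimately have "dist x ` K1 \<inter> dist x ` K2 \<inter> {1..2} \<noteq> {}"
    using cl connected_closedD[OF connected_Icc[of "1::real" 2], of "dist x ` K1" "dist x ` K2"]
    by (metis empty_iff)
  then obtain w w' where w: "w \<in> K1" "w' \<in> K2" "dist x w = dist x w'" by auto
  show ?thesis
  proof (cases "w = w'")
    case True
    \<comment> \<open>A common point of \<open>K1\<close> and \<open>K2\<close> lies on the unit
      sphere about y, as x does.\<close>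
    then have "dist y w = 1" "w \<noteq> x" "w \<in> S"
      using w by (auto simp: K1_def K2_def)
    then show ?thesis
      using that[of y x w] x y by (auto simp: dist_commute)
  next
    case False
    then show ?thesis
      using that[of x w w'] w x by (auto simp: K1_def K2_def)
  qed
qed

text \<open>The two rays from x might still form an angle. This is settled by changing the apex: y
  is the midpoint between x and another point of S, so the two rays from y form a line.\<close>

theorem is_line:
  assumes "S \<noteq> {}"
  obtains a v where "norm v = 1" "S = range (\<lambda>t. a + t *\<^sub>R v)"
proof -
  obtain x y y' where S: "x \<in> S" "y \<in> S" "y' \<in> S" and d: "dist x y = dist x y'" "y \<noteq> y'"
    using ex_isosceles[OF assms] by metis
  define w where "w = y - x"
  have "norm w > 0"
    using d unfolding w_def by (metis dist_eq_0_iff right_minus_eq zero_less_norm_iff)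
  define y2 where "y2 = x + 2 *\<^sub>R w"
  \<comment> \<open>Seen from \<open>y\<close>, the two rays are opposite: one runs through \<open>x\<close>, the other away from it.\<close>
  have "y2 - y = w"
    by (simp add: y2_def w_def algebra_simps scaleR_2)
  then have y2: "y2 \<in> S" "dist y x = norm w" "dist y y2 = norm w" "x \<noteq> y2"
    using two_rays(1)[OF S _ _ d(2), of "dist x y" 2] d \<open>norm w > 0\<close>
    by (auto simp: y2_def w_def dist_norm norm_minus_commute[of y])
  have mem: "y + t *\<^sub>R w \<in> S" for t
  proof (cases t "0::real" rule: linorder_cases)
    case less
    then show ?thesis
      using two_rays(1)[OF S(2,1) y2, of "-t"] by (simp add: w_def algebra_simps)
  next
    case greater
    with \<open>y2 - y = w\<close> show ?thesis
      using two_rays(2)[OF S(2,1) y2, of t] by simp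
  qed (use S in auto)
  have sub: "\<exists>t. z = y + t *\<^sub>R w" if "z \<in> S" for z
  proof (cases "z = y")
    case False
    define t where "t = dist y z / norm w"
    have "t > 0" "dist y z = t * norm w"
      using False \<open>norm w > 0\<close> by (auto simp: t_def)
    then have "z = y + t *\<^sub>R (x - y) \<or> z = y + t *\<^sub>R (y2 - y)"
      using two_rays(3)[OF S(2,1) y2] that by blast
    moreover have "x - y = - w"
      by (simp add: w_def)
    ultimately show ?thesis
      using \<open>y2 - y = w\<close> by (metis scaleR_minus_left scaleR_minus_right)
  qed (auto intro: exI[of _ 0])
  show ?thesis
  proof
    show "norm (w /\<^sub>R norm w) = 1" using \<open>norm w > 0\<close> by simp
    show "S = range (\<lambda>t. y + t *\<^sub>R (w /\<^sub>R norm w))"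
    proof (intro equalityI subsetI)
      fix z assume "z \<in> S"
      then obtain t where "z = y + t *\<^sub>R w" using sub by blast
      then have "z = y + (t * norm w) *\<^sub>R (w /\<^sub>R norm w)"
        using \<open>norm w > 0\<close> by simp
      then show "z \<in> range (\<lambda>t. y + t *\<^sub>R (w /\<^sub>R norm w))" by blast
    qed (use mem in auto)
  qed
qed

end

section \<open>Blow-ups of one-dimensional densities\<close>

text \<open>Upper and lower Kuratowski limit agree; \<open>kuratowski_limit\<close> is the lower
  one.\<close>

definition kuratowski_convergent :: "(nat \<Rightarrow> 'a::metric_space set) \<Rightarrow> bool" where
  "kuratowski_convergent S \<longleftrightarrow>
    (\<forall>x. (\<forall>e>0. \<exists>\<^sub>F n in sequentially. S n \<inter> ball x e \<noteq> {}) \<longrightarrow>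
       (\<forall>e>0. \<forall>\<^sub>F n in sequentially. S n \<inter> ball x e \<noteq> {}))"

definition kuratowski_limit :: "(nat \<Rightarrow> 'a::metric_space set) \<Rightarrow> 'a set" where
  "kuratowski_limit S = {x. \<forall>e>0. \<forall>\<^sub>F n in sequentially. S n \<inter> ball x e \<noteq> {}}"

text \<open>For each member of a countable base a subsequence either meets it eventually or misses
  it eventually; a diagonal subsequence decides all of them, and this property depends on tails
  only.\<close>

lemma ex_kuratowski_convergent_subseq:
  fixes S :: "nat \<Rightarrow> 'a::{metric_space, second_countable_topology} set"
  obtains \<phi> :: "nat \<Rightarrow> nat" where "strict_mono \<phi>" "kuratowski_convergent (S \<circ> \<phi>)"
proof -
  obtain B :: "'a set set" where B: "countable B" "topological_basis B"
    using ex_countable_basis by blast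
  define b where "b = from_nat_into B"
  define P where "P = (\<lambda>k (s::nat\<Rightarrow>nat). (\<forall>\<^sub>F n in sequentially. S (s n) \<inter> b k \<noteq> {}) \<or> (\<forall>\<^sub>F n in sequentially. S (s n) \<inter> b k = {}))"
  interpret subseqs P
  proof
    fix k and s :: "nat \<Rightarrow> nat" assume "strict_mono s"
    show "\<exists>r'. strict_mono r' \<and> P k (s \<circ> r')"
    proof (cases "\<forall>\<^sub>F n in sequentially. S (s n) \<inter> b k = {}")
      case True
      then show ?thesis
        by (intro exI[of _ id]) (auto simp: P_def strict_mono_def)
    next
      case False
      then have "infinite {n. S (s n) \<inter> b k \<noteq> {}}"
        unfolding cofinite_eq_sequentially[symmetric] eventually_cofinite by simp
      then obtain r :: "nat \<Rightarrow> nat" where "strict_mono r" "\<And>n. r n \<in> {n. S (s n) \<inter> b k \<noteq> {}}"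
        using infinite_enumerate by blast
      then show ?thesis
        by (intro exI[of _ r]) (auto simp: P_def)
    qed
  qed
  have "P k (diagseq \<circ> ((+) (Suc k)))" for k
  proof (rule diagseq_holds)
    fix r s :: "nat \<Rightarrow> nat" and n assume "strict_mono r" "P n s"
    then show "P n (s \<circ> r)"
      unfolding P_def comp_def by (auto dest: eventually_subseq)
  qed
  define \<phi> where "\<phi> = diagseq"
  have diag: "P k \<phi>" for k
  proof -
    have "P k (\<phi> \<circ> ((+) (Suc k)))"
      using \<open>\<And>k. P k (diagseq \<circ> ((+) (Suc k)))\<close> by (simp only: \<phi>_def)
    then show ?thesis
      unfolding P_def comp_def add.commute[of "Suc k"]
      using eventually_sequentially_seg[of "\<lambda>n. S (\<phi> n) \<inter> b k \<noteq> {}" "Suc k"]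
        eventually_sequentially_seg[of "\<lambda>n. S (\<phi> n) \<inter> b k = {}" "Suc k"]
      by blast
  qed
  have "kuratowski_convergent (S \<circ> \<phi>)"
    unfolding kuratowski_convergent_def comp_def
  proof (intro allI impI)
    fix x and e :: real
    assume fr: "\<forall>e>0. \<exists>\<^sub>F n in sequentially. S (\<phi> n) \<inter> ball x e \<noteq> {}" and "e > 0"
    obtain W where W: "W \<in> B" "x \<in> W" "W \<subseteq> ball x e"
      using topological_basisE[OF B(2), of "ball x e" x] \<open>e > 0\<close> by auto
    then obtain k where k: "b k = W"
      unfolding b_def using from_nat_into_surj[OF B(1)] by blast
    have "open W" using W B(2) topological_basis_open by blast
    then obtain e' where e': "e' > 0" "ball x e' \<subseteq> W"
      using W open_contains_ball by blast
    have "\<exists>\<^sub>F n in sequentially. S (\<phi> n) \<inter> b k \<noteq> {}"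
      using fr[rule_format, OF e'(1)] by (rule frequently_elim1) (use e' k in blast)
    then have "\<not> (\<forall>\<^sub>F n in sequentially. S (\<phi> n) \<inter> b k = {})"
      by (simp add: frequently_def)
    then have "\<forall>\<^sub>F n in sequentially. S (\<phi> n) \<inter> b k \<noteq> {}"
      using diag[of k] unfolding P_def by blast
    then show "\<forall>\<^sub>F n in sequentially. S (\<phi> n) \<inter> ball x e \<noteq> {}"
      by (rule eventually_mono) (use W k in blast)
  qed
  then show ?thesis
    using that subseq_diagseq unfolding \<phi>_def by blast
qed

lemma kuratowski_convergent_subseq:
  assumes "kuratowski_convergent S" "strict_mono \<phi>"
  shows "kuratowski_convergent (S \<circ> \<phi>)"
  unfolding kuratowski_convergent_def
proof (intro allI impI)
  fix x and e :: real
  assume fr: "\<forall>e>0. \<exists>\<^sub>F n in sequentially. (S \<circ> \<phi>) n \<inter> ball x e \<noteq> {}" and "e > 0"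
  have "\<exists>\<^sub>F n in sequentially. S n \<inter> ball x e \<noteq> {}" if "e > 0" for e
    using fr that eventually_subseq[OF assms(2)] unfolding frequently_def comp_def by blast
  then have "\<forall>\<^sub>F n in sequentially. S n \<inter> ball x e \<noteq> {}"
    using assms(1) \<open>e > 0\<close> unfolding kuratowski_convergent_def by blast
  then show "\<forall>\<^sub>F n in sequentially. (S \<circ> \<phi>) n \<inter> ball x e \<noteq> {}"
    using eventually_subseq[OF assms(2)] by auto
qed

lemma closed_kuratowski_limit: "closed (kuratowski_limit S)"
proof -
  have "x \<in> kuratowski_limit S" if app: "\<forall>e>0. \<exists>y\<in>kuratowski_limit S. dist y x < e" for x
    unfolding kuratowski_limit_def
  proof clarify
    fix e :: real assume "e > 0"
    then obtain y where y: "y \<in> kuratowski_limit S" "dist y x < e / 2"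
      using app half_gt_zero by blast
    then have "\<forall>\<^sub>F n in sequentially. S n \<inter> ball y (e / 2) \<noteq> {}"
      using \<open>e > 0\<close> by (auto simp: kuratowski_limit_def)
    moreover have "ball y (e / 2) \<subseteq> ball x e"
    proof
      fix z assume "z \<in> ball y (e / 2)"
      then show "z \<in> ball x e"
        using y(2) dist_triangle[of x z y] by (simp add: dist_commute)
    qed
    ultimately show "\<forall>\<^sub>F n in sequentially. S n \<inter> ball x e \<noteq> {}"
      by (elim eventually_mono) blast
  qed
  then show ?thesis
    by (meson closed_approachable closure_approachable closure_subset_eq subsetI)
qed

text \<open>Each point of Z has a ball that \<open>S n\<close> eventually misses, and finitely many
  such balls cover Z. This transfers ball covers of bounded parts of the limit set to
  \<open>S n\<close>.\<close>

lemma eventually_disjoint_compact: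
  assumes "kuratowski_convergent S" "compact Z" "Z \<inter> kuratowski_limit S = {}"
  shows "\<forall>\<^sub>F n in sequentially. S n \<inter> Z = {}"
proof -
  have "\<exists>e>0. \<forall>\<^sub>F n in sequentially. S n \<inter> ball z e = {}" if "z \<in> Z" for z
  proof -
    have "z \<notin> kuratowski_limit S" using assms(3) that by blast
    then have "\<not> (\<forall>e>0. \<exists>\<^sub>F n in sequentially. S n \<inter> ball z e \<noteq> {})"
      using assms(1) unfolding kuratowski_convergent_def kuratowski_limit_def by blast
    then show ?thesis by (auto simp: frequently_def)
  qed
  then obtain e where e: "\<And>z. z \<in> Z \<Longrightarrow> e z > 0" "\<And>z. z \<in> Z \<Longrightarrow> \<forall>\<^sub>F n in sequentially. S n \<inter> ball z (e z) = {}"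
    by metis
  have "Z \<subseteq> (\<Union>z\<in>Z. ball z (e z))"
    using e(1) by force
  then obtain F where F: "F \<subseteq> Z" "finite F" "Z \<subseteq> (\<Union>z\<in>F. ball z (e z))"
    using compactE_image[OF assms(2), of Z "\<lambda>z. ball z (e z)"] by auto
  have "\<forall>\<^sub>F n in sequentially. \<forall>z\<in>F. S n \<inter> ball z (e z) = {}"
    using F e by (intro eventually_ball_finite) auto
  then show ?thesis
    by (rule eventually_mono) (use F(3) in blast)
qed

text \<open>\<open>M n\<close> stands for rescaled copies of the measure and \<open>S n\<close> for
  the rescaled set of points with nearly constant density. The error bounds are uniform over all
  centres in \<open>S n\<close>, bounded or not, and \<open>S n\<close> carries almost all mass of
  each bounded region.\<close>

locale blowup_sequence =
  fixes M :: "nat \<Rightarrow> 'a::euclidean_space measure" and S :: "nat \<Rightarrow> 'a set" and \<theta> :: real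
  assumes fin: "\<And>n. finite_measure (M n)" and sets: "\<And>n. sets (M n) = sets borel"
    and S_sets: "\<And>n. S n \<in> sets borel" and \<theta>: "\<theta> > 0" and zero: "\<And>n. 0 \<in> S n"
    and ball: "\<And>R e. e > 0 \<Longrightarrow> \<forall>\<^sub>F n in sequentially. \<forall>q\<in>S n. \<forall>r. 0 < r \<longrightarrow> r \<le> R \<longrightarrow>
       \<bar>measure (M n) (ball q r) - \<theta> * r\<bar> \<le> e"
    and rest: "\<And>R e. e > 0 \<Longrightarrow> \<forall>\<^sub>F n in sequentially. measure (M n) (ball 0 R - S n) \<le> e"
begin

lemma blowup_subsequence:
  assumes "strict_mono \<phi>"
  shows "blowup_sequence (M \<circ> \<phi>) (S \<circ> \<phi>) \<theta>"
proof (rule blowup_sequence.intro)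
  fix R e :: real assume "e > 0"
  then show "\<forall>\<^sub>F n in sequentially. \<forall>q\<in>(S \<circ> \<phi>) n. \<forall>r. 0 < r \<longrightarrow> r \<le> R \<longrightarrow>
       \<bar>measure ((M \<circ> \<phi>) n) (ball q r) - \<theta> * r\<bar> \<le> e"
    "\<forall>\<^sub>F n in sequentially. measure ((M \<circ> \<phi>) n) (ball 0 R - (S \<circ> \<phi>) n) \<le> e"
    using eventually_subseq[OF assms ball] eventually_subseq[OF assms rest] by auto
qed (simp_all add: fin sets S_sets \<theta> zero)

lemma measure_M_mono: "A \<subseteq> B \<Longrightarrow> B \<in> sets borel \<Longrightarrow> measure (M n) A \<le> measure (M n) B"
  by (intro finite_measure.finite_measure_mono[OF fin]) (auto simp: sets)

lemma eventually_near:
  assumes "finite X" "X \<subseteq> kuratowski_limit S" "\<kappa> > 0"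
  shows "\<forall>\<^sub>F n in sequentially. \<forall>x\<in>X. \<exists>y\<in>S n. dist x y < \<kappa>"
proof (intro eventually_ball_finite[OF assms(1)] ballI)
  fix x assume "x \<in> X"
  then have "\<forall>\<^sub>F n in sequentially. S n \<inter> ball x \<kappa> \<noteq> {}"
    using assms by (auto simp: kuratowski_limit_def)
  then show "\<forall>\<^sub>F n in sequentially. \<exists>y\<in>S n. dist x y < \<kappa>"
    by (rule eventually_mono) auto
qed

text \<open>Centres move to nearby points of \<open>S n\<close> and radii shrink by \<kappa>, so the
  balls stay disjoint and inside a slightly larger one; additivity of \<open>M n\<close> does the
  rest.\<close>

lemma limit_packing:
  assumes P: "finite P" "P \<subseteq> kuratowski_limit S \<times> {0<..}" and x: "x \<in> kuratowski_limit S" and "R > 0"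
    and disj: "\<And>p q. p \<in> P \<Longrightarrow> q \<in> P \<Longrightarrow> p \<noteq> q \<Longrightarrow> snd p + snd q \<le> dist (fst p) (fst q)"
    and sub: "\<And>p. p \<in> P \<Longrightarrow> dist x (fst p) + snd p \<le> R"
  shows "(\<Sum>p\<in>P. snd p) \<le> R"
proof (rule ccontr)
  assume "\<not> ?thesis"
  then have gt: "R < (\<Sum>p\<in>P. snd p)" by simp
  define N where "N = real (card P)"
  have "P \<noteq> {}" using gt \<open>R > 0\<close> by auto
  \<comment> \<open>Each of the N balls loses 2\<kappa> and the large ball gains 2\<kappa>, a total
    of (2N + 2)\<kappa>, below the excess. The second term keeps the reduced radii positive.\<close>
  define \<kappa> where "\<kappa> = min (((\<Sum>p\<in>P. snd p) - R) / (4 * (N + 1))) (Min (snd ` P) / 2)"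
  have "Min (snd ` P) > 0"
    using P \<open>P \<noteq> {}\<close> by (subst Min_gr_iff) auto
  have "N \<ge> 0" by (simp add: N_def)
  have \<kappa>: "\<kappa> > 0"
    using gt \<open>N \<ge> 0\<close> \<open>Min (snd ` P) > 0\<close> by (auto simp: \<kappa>_def)
  have \<kappa>P: "\<kappa> < snd p" if "p \<in> P" for p
  proof -
    have "Min (snd ` P) \<le> snd p" using P that by auto
    then show ?thesis
      using \<open>Min (snd ` P) > 0\<close> unfolding \<kappa>_def by linarith
  qed
  have \<kappa>N: "4 * (N + 1) * \<kappa> \<le> (\<Sum>p\<in>P. snd p) - R"
  proof -
    have "\<kappa> \<le> ((\<Sum>p\<in>P. snd p) - R) / (4 * (N + 1))" by (simp add: \<kappa>_def)
    then show ?thesis using \<open>N \<ge> 0\<close> by (simp add: field_simps)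
  qed
  have near: "\<forall>\<^sub>F n in sequentially. \<forall>y\<in>insert x (fst ` P). \<exists>z\<in>S n. dist y z < \<kappa>"
    using P x \<kappa> by (intro eventually_near) auto
  have "\<theta> * \<kappa> > 0" using \<kappa> \<theta> by simp
  from eventually_happens'[OF sequentially_bot eventually_conj[OF near ball[OF this, of "R + \<kappa>"]]]
  obtain n where n0: "\<forall>y\<in>insert x (fst ` P). \<exists>z\<in>S n. dist y z < \<kappa>"
      "\<forall>q\<in>S n. \<forall>r. 0 < r \<longrightarrow> r \<le> R + \<kappa> \<longrightarrow> \<bar>measure (M n) (ball q r) - \<theta> * r\<bar> \<le> \<theta> * \<kappa>"
    by blast
  note n = n0[rule_format]
  obtain x' where x': "x' \<in> S n" "dist x x' < \<kappa>" using n(1)[of x] by auto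
  have "\<forall>p\<in>P. \<exists>z\<in>S n. dist (fst p) z < \<kappa>" using n(1) by auto
  then obtain y where y: "\<And>p. p \<in> P \<Longrightarrow> y p \<in> S n" "\<And>p. p \<in> P \<Longrightarrow> dist (fst p) (y p) < \<kappa>"
    by metis
  define b where "b = (\<lambda>p. ball (y p) (snd p - \<kappa>))"
  have b_sub: "b p \<subseteq> ball (fst p) (snd p)" if "p \<in> P" for p
  proof
    fix z assume "z \<in> b p"
    then show "z \<in> ball (fst p) (snd p)"
      using y(2)[OF that] dist_triangle[of "fst p" z "y p"] by (simp add: b_def)
  qed
  have "(\<Sum>p\<in>P. \<theta> * (snd p - \<kappa>) - \<theta> * \<kappa>) \<le> (\<Sum>p\<in>P. measure (M n) (b p))"
  proof (rule sum_mono)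
    fix p assume p: "p \<in> P"
    have "snd p - \<kappa> \<le> R + \<kappa>" using sub[OF p] zero_le_dist[of x "fst p"] \<kappa> by linarith
    then show "\<theta> * (snd p - \<kappa>) - \<theta> * \<kappa> \<le> measure (M n) (b p)"
      using n(2)[OF y(1)[OF p], of "snd p - \<kappa>"] \<kappa>P[OF p] unfolding b_def by auto
  qed
  also have "\<dots> = measure (M n) (\<Union>p\<in>P. b p)"
  proof (rule finite_measure.finite_measure_finite_Union[OF fin P(1), symmetric])
    show "disjoint_family_on b P"
      unfolding disjoint_family_on_def
    proof (intro ballI impI)
      fix p q assume pq: "p \<in> P" "q \<in> P" "p \<noteq> q"
      have "ball (fst p) (snd p) \<inter> ball (fst q) (snd q) = {}"
      proof (rule ccontr)
        assume "\<not> ?thesis"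
        then obtain z where "dist (fst p) z < snd p" "dist (fst q) z < snd q" by auto
        then show False
          using disj[OF pq] dist_triangle2[of "fst p" "fst q" z] by linarith
      qed
      then show "b p \<inter> b q = {}" using b_sub pq by blast
    qed
  qed (auto simp: b_def sets)
  also have "\<dots> \<le> measure (M n) (ball x' (R + \<kappa>))"
  proof (rule measure_M_mono)
    show "(\<Union>p\<in>P. b p) \<subseteq> ball x' (R + \<kappa>)"
    proof
      fix z assume "z \<in> (\<Union>p\<in>P. b p)"
      then obtain p where p: "p \<in> P" "z \<in> ball (fst p) (snd p)" using b_sub by blast
      then have "dist x z < R"
        using sub[OF p(1)] dist_triangle[of x z "fst p"] by simp
      then show "z \<in> ball x' (R + \<kappa>)"
        using x'(2) dist_triangle[of x' z x] by (simp add: dist_commute)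
    qed
  qed simp
  also have "\<dots> \<le> \<theta> * (R + \<kappa>) + \<theta> * \<kappa>"
    using n(2)[OF x'(1), of "R + \<kappa>"] \<kappa> \<open>R > 0\<close> by auto
  also have "(\<Sum>p\<in>P. \<theta> * (snd p - \<kappa>) - \<theta> * \<kappa>) = \<theta> * ((\<Sum>p\<in>P. snd p) - 2 * N * \<kappa>)"
    by (simp add: sum_subtractf sum_distrib_left[symmetric] N_def algebra_simps)
  finally have "\<theta> * ((\<Sum>p\<in>P. snd p) - 2 * N * \<kappa>) \<le> \<theta> * (R + 2 * \<kappa>)"
    by (simp add: algebra_simps)
  then have "(\<Sum>p\<in>P. snd p) - 2 * N * \<kappa> \<le> R + 2 * \<kappa>"
    using \<theta> by simp
  with \<kappa>N have "2 * (N + 1) * \<kappa> \<le> 0"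
    by (simp add: algebra_simps)
  then show False
    using \<kappa> \<open>N \<ge> 0\<close> by (simp add: mult_le_0_iff)
qed

text \<open>The counterpart with enlarged radii. Points of \<open>S n\<close> are covered eventually
  by compactness, and the mass off \<open>S n\<close> is an error term.\<close>

lemma limit_covering:
  assumes conv: "kuratowski_convergent S"
    and P: "finite P" "P \<subseteq> kuratowski_limit S \<times> {0<..}" and x: "x \<in> kuratowski_limit S"
    and cov: "kuratowski_limit S \<inter> cball x R \<subseteq> (\<Union>p\<in>P. ball (fst p) (snd p))"
  shows "R \<le> (\<Sum>p\<in>P. snd p)"
proof (rule ccontr)
  assume "\<not> ?thesis"
  then have gt: "(\<Sum>p\<in>P. snd p) < R" by simp
  have sum_nonneg: "(\<Sum>p\<in>P. snd p) \<ge> 0"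
    using P by (intro sum_nonneg) auto
  then have "R > 0" using gt by simp
  define N where "N = real (card P)"
  have "N \<ge> 0" by (simp add: N_def)
  \<comment> \<open>The errors are 2\<kappa> for the large ball, \<kappa> for the mass off
    \<open>S n\<close> and 2\<kappa> for each of the N balls, in all (2N + 3)\<kappa>. The 8 also
    gives 8\<kappa> \<le> R, which keeps the radii in range.\<close>
  define \<kappa> where "\<kappa> = (R - (\<Sum>p\<in>P. snd p)) / (4 * N + 8)"
  have \<kappa>: "\<kappa> > 0" "(4 * N + 8) * \<kappa> = R - (\<Sum>p\<in>P. snd p)"
    using gt \<open>N \<ge> 0\<close> by (auto simp: \<kappa>_def)
  have "8 * \<kappa> \<le> R"
  proof -
    have "8 * \<kappa> \<le> (4 * N + 8) * \<kappa>" using \<kappa> \<open>N \<ge> 0\<close> by (intro mult_right_mono) auto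
    then show ?thesis using \<kappa>(2) sum_nonneg by linarith
  qed
  have disj: "\<forall>\<^sub>F n in sequentially. S n \<inter> (cball x R - (\<Union>p\<in>P. ball (fst p) (snd p))) = {}"
    using cov by (intro eventually_disjoint_compact[OF conv]) (auto intro!: compact_diff open_UN)
  have near: "\<forall>\<^sub>F n in sequentially. \<forall>y\<in>insert x (fst ` P). \<exists>z\<in>S n. dist y z < \<kappa>"
    using P x \<kappa> by (intro eventually_near) auto
  have "\<theta> * \<kappa> > 0" using \<kappa> \<theta> by simp
  from eventually_happens'[OF sequentially_bot eventually_conj[OF disj eventually_conj[OF near
      eventually_conj[OF ball[OF this, of "2 * R"] rest[OF this, of "norm x + 2 * R"]]]]]
  obtain n where n0: "S n \<inter> (cball x R - (\<Union>p\<in>P. ball (fst p) (snd p))) = {}"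
      "\<forall>y\<in>insert x (fst ` P). \<exists>z\<in>S n. dist y z < \<kappa>"
      "\<forall>q\<in>S n. \<forall>r. 0 < r \<longrightarrow> r \<le> 2 * R \<longrightarrow> \<bar>measure (M n) (ball q r) - \<theta> * r\<bar> \<le> \<theta> * \<kappa>"
      "measure (M n) (ball 0 (norm x + 2 * R) - S n) \<le> \<theta> * \<kappa>"
    by blast
  note n = n0(1) n0(2,3)[rule_format] n0(4)
  obtain x' where x': "x' \<in> S n" "dist x x' < \<kappa>" using n(2)[of x] by auto
  have "\<forall>p\<in>P. \<exists>z\<in>S n. dist (fst p) z < \<kappa>" using n(2) by auto
  then obtain y where y: "\<And>p. p \<in> P \<Longrightarrow> y p \<in> S n" "\<And>p. p \<in> P \<Longrightarrow> dist (fst p) (y p) < \<kappa>"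
    by metis
  define b where "b = (\<lambda>p. ball (y p) (snd p + \<kappa>))"
  have b_sets: "(\<Union>p\<in>P. b p) \<in> sets borel"
    unfolding b_def by (intro borel_open open_UN) auto
  have "\<theta> * (R - \<kappa>) - \<theta> * \<kappa> \<le> measure (M n) (ball x' (R - \<kappa>))"
    using n(3)[OF x'(1), of "R - \<kappa>"] \<kappa> \<open>8 * \<kappa> \<le> R\<close> by auto
  also have "\<dots> \<le> measure (M n) ((\<Union>p\<in>P. b p) \<union> (ball 0 (norm x + 2 * R) - S n))"
  proof (rule measure_M_mono)
    show "ball x' (R - \<kappa>) \<subseteq> (\<Union>p\<in>P. b p) \<union> (ball 0 (norm x + 2 * R) - S n)"
    proof
      fix z assume "z \<in> ball x' (R - \<kappa>)"
      then have z: "dist x z < R"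
        using x'(2) dist_triangle[of x z x'] by simp
      then have "norm z < norm x + 2 * R"
        using norm_triangle_ineq2[of z x] \<open>R > 0\<close> by (simp add: dist_norm norm_minus_commute)
      moreover have "z \<in> (\<Union>p\<in>P. b p)" if zS: "z \<in> S n"
      proof -
        have "z \<in> cball x R" using z by simp
        then obtain p where p: "p \<in> P" "z \<in> ball (fst p) (snd p)"
          using zS n(1) by blast
        then have "z \<in> b p"
          using y(2)[OF p(1)] dist_triangle[of "y p" z "fst p"] by (simp add: b_def dist_commute)
        with p show ?thesis by blast
      qed
      ultimately show "z \<in> (\<Union>p\<in>P. b p) \<union> (ball 0 (norm x + 2 * R) - S n)"
        by auto
    qed
  qed (use b_sets S_sets in auto)
  also have "\<dots> \<le> measure (M n) (\<Union>p\<in>P. b p) + measure (M n) (ball 0 (norm x + 2 * R) - S n)"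
    using b_sets S_sets by (intro measure_Un_le) (auto simp: sets)
  also have "\<dots> \<le> (\<Sum>p\<in>P. measure (M n) (b p)) + \<theta> * \<kappa>"
    using P(1) n(4) by (intro add_mono measure_UNION_le) (auto simp: sets b_def)
  also have "\<dots> \<le> (\<Sum>p\<in>P. \<theta> * (snd p + \<kappa>) + \<theta> * \<kappa>) + \<theta> * \<kappa>"
  proof (intro add_right_mono sum_mono)
    fix p assume p: "p \<in> P"
    have "snd p \<le> (\<Sum>p\<in>P. snd p)"
      using P p by (intro member_le_sum) auto
    then have "snd p + \<kappa> \<le> 2 * R" using gt \<open>8 * \<kappa> \<le> R\<close> \<open>R > 0\<close> by linarith
    moreover have "snd p > 0" using P p by auto
    ultimately show "measure (M n) (b p) \<le> \<theta> * (snd p + \<kappa>) + \<theta> * \<kappa>"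
      using n(3)[OF y(1)[OF p], of "snd p + \<kappa>"] \<kappa> unfolding b_def by auto
  qed
  also have "(\<Sum>p\<in>P. \<theta> * (snd p + \<kappa>) + \<theta> * \<kappa>) = \<theta> * ((\<Sum>p\<in>P. snd p) + 2 * N * \<kappa>)"
    by (simp add: sum.distrib sum_distrib_left[symmetric] N_def algebra_simps)
  finally have "\<theta> * (R - 3 * \<kappa>) \<le> \<theta> * ((\<Sum>p\<in>P. snd p) + 2 * N * \<kappa>)"
    by (simp add: algebra_simps)
  then have "R - 3 * \<kappa> \<le> (\<Sum>p\<in>P. snd p) + 2 * N * \<kappa>"
    using \<theta> by simp
  then have "(4 * N + 8) * \<kappa> \<le> 3 * \<kappa> + 2 * N * \<kappa>"
    unfolding \<kappa>(2) by simp
  then have "(2 * N + 5) * \<kappa> \<le> 0"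
    by (simp add: algebra_simps)
  then show False
    using \<kappa> \<open>N \<ge> 0\<close> by (simp add: mult_le_0_iff)
qed

lemma uniform_support_limit:
  assumes "kuratowski_convergent S"
  shows "uniform_support (kuratowski_limit S)"
proof (rule uniform_support.intro)
  fix P :: "('a \<times> real) set" and x R
  assume *: "finite P" "P \<subseteq> kuratowski_limit S \<times> {0<..}" "x \<in> kuratowski_limit S"
  show "(\<Sum>p\<in>P. snd p) \<le> R" if "0 < R"
    "\<And>p q. p \<in> P \<Longrightarrow> q \<in> P \<Longrightarrow> p \<noteq> q \<Longrightarrow> snd p + snd q \<le> dist (fst p) (fst q)"
    "\<And>p. p \<in> P \<Longrightarrow> dist x (fst p) + snd p \<le> R"
    by (rule limit_packing[OF * that])
  show "R \<le> (\<Sum>p\<in>P. snd p)"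
    if "kuratowski_limit S \<inter> cball x R \<subseteq> (\<Union>p\<in>P. ball (fst p) (snd p))"
    by (rule limit_covering[OF assms * that])
qed (rule closed_kuratowski_limit)

text \<open>Convergence of \<open>C n \<inter> S n\<close> is used besides that of
  \<open>S n\<close>: its limit sits on the line and keeps the diameter bound 1, so half a unit
  about the midpoint suffices, and compactness carries this inclusion back to large n. Centring the
  ball on the limit set is essential, since the mass of other balls is not controlled.\<close>

lemma limit_diameter_bound:
  assumes conv: "kuratowski_convergent S" and convC: "kuratowski_convergent (\<lambda>n. C n \<inter> S n)"
    and C: "\<And>n. C n \<in> sets borel" "\<And>n x y. x \<in> C n \<Longrightarrow> y \<in> C n \<Longrightarrow> dist x y \<le> 1" "\<And>n. C n \<subseteq> cball 0 1"
    and "h > 0"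
  shows "\<forall>\<^sub>F n in sequentially. measure (M n) (C n) \<le> \<theta> / 2 + h"
proof -
  interpret L: uniform_support "kuratowski_limit S"
    using uniform_support_limit[OF conv] .
  have "0 \<in> kuratowski_limit S"
    unfolding kuratowski_limit_def
  proof (intro CollectI allI impI always_eventually)
    show "S n \<inter> ball 0 e \<noteq> {}" if "e > 0" for e n
      using zero[of n] centre_in_ball[of 0 e] that by blast
  qed
  then obtain a v where v: "norm v = 1" and line: "kuratowski_limit S = range (\<lambda>t. a + t *\<^sub>R v)"
    using L.is_line by blast
  define K where "K = kuratowski_limit (\<lambda>n. C n \<inter> S n)"
  have "K \<subseteq> kuratowski_limit S"
    unfolding K_def kuratowski_limit_def
  proof clarify
    fix x and e :: real assume "\<forall>e>0. \<forall>\<^sub>F n in sequentially. C n \<inter> S n \<inter> ball x e \<noteq> {}" "e > 0"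
    then have "\<forall>\<^sub>F n in sequentially. C n \<inter> S n \<inter> ball x e \<noteq> {}" by blast
    then show "\<forall>\<^sub>F n in sequentially. S n \<inter> ball x e \<noteq> {}"
      by (rule eventually_mono) blast
  qed
  have dist_K: "dist x y \<le> 1" if "x \<in> K" "y \<in> K" for x y
  proof (rule field_le_epsilon)
    fix e :: real assume "e > 0"
    then have "\<forall>\<^sub>F n in sequentially. C n \<inter> S n \<inter> ball x (e / 2) \<noteq> {}" "\<forall>\<^sub>F n in sequentially. C n \<inter> S n \<inter> ball y (e / 2) \<noteq> {}"
      using that by (auto simp: K_def kuratowski_limit_def)
    then have "\<forall>\<^sub>F n in sequentially. C n \<inter> S n \<inter> ball x (e / 2) \<noteq> {} \<and> C n \<inter> S n \<inter> ball y (e / 2) \<noteq> {}"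
      by (rule eventually_conj)
    from eventually_happens'[OF sequentially_bot this]
    obtain n where "C n \<inter> S n \<inter> ball x (e / 2) \<noteq> {}" "C n \<inter> S n \<inter> ball y (e / 2) \<noteq> {}"
      by blast
    then obtain x' y' where "x' \<in> C n" "y' \<in> C n" "dist x x' < e / 2" "dist y y' < e / 2" by auto
    then show "dist x y \<le> 1 + e"
      using C(2)[of x' n y'] dist_triangle[of x y x'] dist_triangle[of x' y y'] by (simp add: dist_commute)
  qed
  have d_line: "dist (a + s *\<^sub>R v) (a + t *\<^sub>R v) = \<bar>s - t\<bar>" for s t
    using v by (simp add: dist_norm scaleR_left_diff_distrib[symmetric])
  have "\<exists>m\<in>kuratowski_limit S. K \<subseteq> cball m (1 / 2)"
  proof (cases "K = {}")
    case True
    then show ?thesis using \<open>0 \<in> kuratowski_limit S\<close> by auto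
  next
    case False
    define T where "T = {t. a + t *\<^sub>R v \<in> K}"
    have "T \<noteq> {}"
      using False \<open>K \<subseteq> kuratowski_limit S\<close> line by (auto simp: T_def)
    then obtain t0 where t0: "t0 \<in> T" by auto
    have T: "\<bar>s - t\<bar> \<le> 1" if "s \<in> T" "t \<in> T" for s t
      using dist_K[of "a + s *\<^sub>R v" "a + t *\<^sub>R v"] that unfolding d_line T_def by blast
    have bdd: "bdd_above T" "bdd_below T"
      using T[OF _ t0] by (auto intro!: bdd_aboveI[of _ "t0 + 1"] bdd_belowI[of _ "t0 - 1"] dest!: T[OF _ t0])
    have "Sup T - Inf T \<le> 1"
    proof -
      have "Sup T \<le> 1 + Inf T"
      proof (rule cSup_least[OF \<open>T \<noteq> {}\<close>])
        fix s assume "s \<in> T"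
        have "s - 1 \<le> Inf T"
          using T[OF \<open>s \<in> T\<close>] by (intro cInf_greatest[OF \<open>T \<noteq> {}\<close>]) force
        then show "s \<le> 1 + Inf T" by simp
      qed
      then show ?thesis by simp
    qed
    define m where "m = (Sup T + Inf T) / 2"
    have "K \<subseteq> cball (a + m *\<^sub>R v) (1 / 2)"
    proof
      fix x assume "x \<in> K"
      then obtain t where t: "x = a + t *\<^sub>R v" "t \<in> T"
        using \<open>K \<subseteq> kuratowski_limit S\<close> line by (auto simp: T_def)
      have "t \<le> Sup T" "Inf T \<le> t"
        using t bdd by (auto intro: cSup_upper cInf_lower)
      then have "\<bar>m - t\<bar> \<le> 1 / 2"
        using \<open>Sup T - Inf T \<le> 1\<close> unfolding m_def abs_le_iff by (simp add: field_simps)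
      then show "x \<in> cball (a + m *\<^sub>R v) (1 / 2)"
        unfolding t(1) mem_cball d_line .
    qed
    then show ?thesis using line by blast
  qed
  then obtain m where m: "m \<in> kuratowski_limit S" "K \<subseteq> cball m (1 / 2)" by blast
  \<comment> \<open>The enlargement of the radius by 2\<kappa> costs h/4; the ball error and the
    mass off \<open>S n\<close> cost another h/4 each.\<close>
  define \<kappa> where "\<kappa> = h / (8 * \<theta>)"
  have \<kappa>: "\<kappa> > 0" "\<theta> * \<kappa> = h / 8" using \<open>h > 0\<close> \<theta> by (auto simp: \<kappa>_def)
  have "\<forall>\<^sub>F n in sequentially. (C n \<inter> S n) \<inter> (cball 0 1 - ball m (1 / 2 + \<kappa>)) = {}"
  proof (rule eventually_disjoint_compact[OF convC])
    show "(cball 0 1 - ball m (1 / 2 + \<kappa>)) \<inter> kuratowski_limit (\<lambda>n. C n \<inter> S n) = {}"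
      using m(2) \<kappa> unfolding K_def by force
  qed (auto intro!: compact_diff)
  moreover have "\<forall>\<^sub>F n in sequentially. \<forall>y\<in>{m}. \<exists>z\<in>S n. dist y z < \<kappa>"
    using m \<kappa> by (intro eventually_near) auto
  moreover have "\<forall>\<^sub>F n in sequentially. \<forall>q\<in>S n. \<forall>r. 0 < r \<longrightarrow> r \<le> 1 / 2 + 2 * \<kappa> \<longrightarrow> \<bar>measure (M n) (ball q r) - \<theta> * r\<bar> \<le> h / 4"
    using \<open>h > 0\<close> by (intro ball) auto
  moreover have "\<forall>\<^sub>F n in sequentially. measure (M n) (ball 0 2 - S n) \<le> h / 4"
    using \<open>h > 0\<close> by (intro rest) auto
  ultimately show ?thesis
  proof eventually_elim
    case (elim n)
    then obtain m' where m': "m' \<in> S n" "dist m m' < \<kappa>" by auto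
    have "measure (M n) (C n) \<le> measure (M n) (ball m' (1 / 2 + 2 * \<kappa>) \<union> (ball 0 2 - S n))"
    proof (rule measure_M_mono)
      show "C n \<subseteq> ball m' (1 / 2 + 2 * \<kappa>) \<union> (ball 0 2 - S n)"
      proof
        fix z assume z: "z \<in> C n"
        then have n1: "norm z \<le> 1" using C(3)[of n] by auto
        show "z \<in> ball m' (1 / 2 + 2 * \<kappa>) \<union> (ball 0 2 - S n)"
        proof (cases "z \<in> S n")
          case True
          then have "dist m z < 1 / 2 + \<kappa>" using elim(1) z n1 by auto
          then show ?thesis
            using m'(2) dist_triangle[of m' z m] by (simp add: dist_commute)
        qed (use n1 in auto)
      qed
    qed (use S_sets in auto)
    also have "\<dots> \<le> measure (M n) (ball m' (1 / 2 + 2 * \<kappa>)) + measure (M n) (ball 0 2 - S n)"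
      using S_sets by (intro measure_Un_le) (auto simp: sets)
    also have "measure (M n) (ball m' (1 / 2 + 2 * \<kappa>)) \<le> \<theta> * (1 / 2 + 2 * \<kappa>) + h / 4"
      using elim(3) m'(1) \<kappa> by (auto dest!: bspec[of _ _ m'] spec[of _ "1 / 2 + 2 * \<kappa>"])
    also have "\<theta> * (1 / 2 + 2 * \<kappa>) + h / 4 = \<theta> / 2 + h / 2"
      using \<kappa>(2) by (simp add: algebra_simps)
    finally show "measure (M n) (C n) \<le> \<theta> / 2 + h"
      using elim(4) \<open>h > 0\<close> by simp
  qed
qed

lemma not_diameter_excess:
  assumes C: "\<And>n. C n \<in> sets borel" "\<And>n x y. x \<in> C n \<Longrightarrow> y \<in> C n \<Longrightarrow> dist x y \<le> 1" "\<And>n. C n \<subseteq> cball 0 1"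
    and "h > 0"
  shows "\<exists>n. measure (M n) (C n) \<le> \<theta> / 2 + h"
proof -
  obtain \<phi> :: "nat \<Rightarrow> nat" where \<phi>: "strict_mono \<phi>" "kuratowski_convergent (S \<circ> \<phi>)"
    using ex_kuratowski_convergent_subseq by blast
  obtain \<psi> :: "nat \<Rightarrow> nat" where \<psi>: "strict_mono \<psi>" "kuratowski_convergent ((\<lambda>n. C (\<phi> n) \<inter> S (\<phi> n)) \<circ> \<psi>)"
    using ex_kuratowski_convergent_subseq by blast
  interpret B: blowup_sequence "M \<circ> (\<phi> \<circ> \<psi>)" "S \<circ> (\<phi> \<circ> \<psi>)" \<theta>
    using \<phi>(1) \<psi>(1) by (intro blowup_subsequence strict_mono_o)
  have "\<forall>\<^sub>F n in sequentially. measure ((M \<circ> (\<phi> \<circ> \<psi>)) n) ((C \<circ> (\<phi> \<circ> \<psi>)) n) \<le> \<theta> / 2 + h"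
  proof (rule B.limit_diameter_bound)
    show "kuratowski_convergent (S \<circ> (\<phi> \<circ> \<psi>))"
      using kuratowski_convergent_subseq[OF \<phi>(2) \<psi>(1)] by (simp add: comp_assoc)
    show "kuratowski_convergent (\<lambda>n. (C \<circ> (\<phi> \<circ> \<psi>)) n \<inter> (S \<circ> (\<phi> \<circ> \<psi>)) n)"
      using \<psi>(2) by (simp add: comp_def)
    show "(C \<circ> (\<phi> \<circ> \<psi>)) n \<in> sets borel" "(C \<circ> (\<phi> \<circ> \<psi>)) n \<subseteq> cball 0 1" for n
      using C(1,3) by auto
    show "dist x y \<le> 1" if "x \<in> (C \<circ> (\<phi> \<circ> \<psi>)) n" "y \<in> (C \<circ> (\<phi> \<circ> \<psi>)) n" for n x y
      using that unfolding comp_def by (rule C(2))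
  qed fact
  then show ?thesis
    by (auto simp: eventually_sequentially)
qed

end

text \<open>Otherwise, rescaling a sequence of bad sets to diameter 1 gives a blow-up whose limit set is a
  line, and a piece of diameter 1 of a line lies in a ball of radius 1/2 centred on the line.\<close>
lemma diameter_ratio_bound:
  fixes \<mu> :: "'a::euclidean_space measure"
  assumes fin: "finite_measure \<mu>" and sets: "sets \<mu> = sets borel" and "\<theta> > 0" "h > 0"
    and reg: "\<And>\<epsilon>. \<epsilon> > 0 \<Longrightarrow> \<exists>G\<in>sets borel. \<exists>r0>0. p \<in> G \<and>
      (\<forall>q\<in>G. \<forall>r. 0 < r \<longrightarrow> r < r0 \<longrightarrow> \<bar>measure \<mu> (ball q r) - \<theta> * r\<bar> \<le> \<epsilon> * r) \<and>
      (\<forall>r. 0 < r \<longrightarrow> r < r0 \<longrightarrow> measure \<mu> (ball p r - G) \<le> \<epsilon> * r)"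
  shows "\<exists>d>0. \<forall>C. closed C \<longrightarrow> bounded C \<longrightarrow> p \<in> C \<longrightarrow> diameter C < d \<longrightarrow>
    measure \<mu> C \<le> (\<theta> / 2 + h) * diameter C"
proof (rule ccontr)
  assume neg: "\<not> ?thesis"
  have "\<exists>G r0 C. G \<in> sets borel \<and> 0 < r0 \<and> p \<in> G \<and>
      (\<forall>q\<in>G. \<forall>r. 0 < r \<longrightarrow> r < r0 \<longrightarrow> \<bar>measure \<mu> (ball q r) - \<theta> * r\<bar> \<le> 1 / Suc n * r) \<and>
      (\<forall>r. 0 < r \<longrightarrow> r < r0 \<longrightarrow> measure \<mu> (ball p r - G) \<le> 1 / Suc n * r) \<and>
      closed C \<and> bounded C \<and> p \<in> C \<and> diameter C < r0 / Suc n \<and> (\<theta> / 2 + h) * diameter C < measure \<mu> C" for n :: nat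
  proof -
    obtain G r0 where G: "G \<in> sets borel" "0 < r0" "p \<in> G"
      "\<forall>q\<in>G. \<forall>r. 0 < r \<longrightarrow> r < r0 \<longrightarrow> \<bar>measure \<mu> (ball q r) - \<theta> * r\<bar> \<le> 1 / Suc n * r"
      "\<forall>r. 0 < r \<longrightarrow> r < r0 \<longrightarrow> measure \<mu> (ball p r - G) \<le> 1 / Suc n * r"
      using reg[of "1 / Suc n"] by auto
    \<comment> \<open>Bad sets are taken of diameter below r0/(n+1), so that after rescaling to
      diameter 1 the regularity reaches radii up to n+1.\<close>
    have "r0 / Suc n > 0" using G(2) by simp
    then have "\<exists>C. closed C \<and> bounded C \<and> p \<in> C \<and> diameter C < r0 / Suc n \<and> (\<theta> / 2 + h) * diameter C < measure \<mu> C"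
      using neg by (meson not_le)
    with G show ?thesis by blast
  qed
  then obtain G r0 C where
      G: "\<And>n. G n \<in> sets borel" "\<And>n. p \<in> G n" and r0: "\<And>n. 0 < r0 n"
      and G_ball: "\<And>n. \<forall>q\<in>G n. \<forall>r. 0 < r \<longrightarrow> r < r0 n \<longrightarrow> \<bar>measure \<mu> (ball q r) - \<theta> * r\<bar> \<le> 1 / Suc n * r"
      and G_rest: "\<And>n. \<forall>r. 0 < r \<longrightarrow> r < r0 n \<longrightarrow> measure \<mu> (ball p r - G n) \<le> 1 / Suc n * r"
      and C: "\<And>n. closed (C n)" "\<And>n. bounded (C n)" "\<And>n. p \<in> C n"
      and diam: "\<And>n. diameter (C n) < r0 n / Suc n"
      and big: "\<And>n. (\<theta> / 2 + h) * diameter (C n) < measure \<mu> (C n)"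
    by metis
  define d where "d = (\<lambda>n. diameter (C n))"
  \<comment> \<open>A bad set of diameter 0 would be {p}, to which the bounds on small balls about p
    leave no mass.\<close>
  have d_pos: "d n > 0" for n
  proof (rule ccontr)
    assume "\<not> d n > 0"
    then have "diameter (C n) = 0"
      using diameter_ge_0[OF C(2)[of n]] by (simp add: d_def)
    then have "C n \<subseteq> {p}"
      using diameter_bounded_bound[OF C(2) C(3)[of n]] by fastforce
    have "measure \<mu> (C n) \<le> 0"
    proof (rule field_le_epsilon)
      fix e :: real assume "e > 0"
      define r where "r = min (r0 n / 2) (e / (\<theta> + 1))"
      have "r \<le> e / (\<theta> + 1)" by (simp add: r_def)
      then have "(\<theta> + 1) * r \<le> e"
        using \<open>\<theta> > 0\<close> by (simp add: pos_le_divide_eq mult.commute)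
      moreover have "0 < r" "r < r0 n"
        using \<open>e > 0\<close> r0[of n] \<open>\<theta> > 0\<close> unfolding r_def by (simp_all add: min_less_iff_disj)
      ultimately have r: "0 < r" "r < r0 n" "(\<theta> + 1) * r \<le> e" by auto
      have "measure \<mu> (C n) \<le> measure \<mu> (ball p r)"
        using \<open>C n \<subseteq> {p}\<close> r sets by (intro finite_measure.finite_measure_mono[OF fin]) auto
      also have "\<dots> \<le> \<theta> * r + 1 / Suc n * r"
        using G_ball[of n] G(2)[of n] r by force
      also have "\<dots> \<le> \<theta> * r + 1 * r"
        using r by (intro add_left_mono mult_right_mono) auto
      also have "\<dots> \<le> e"
        using r(3) by (simp add: algebra_simps)
      finally show "measure \<mu> (C n) \<le> 0 + e" by simp
    qed
    with big[of n] \<open>diameter (C n) = 0\<close> show False by simp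
  qed
  define \<tau> where "\<tau> = (\<lambda>n z. (1 / d n) *\<^sub>R (z - p))"
  define \<sigma> where "\<sigma> = (\<lambda>n x. p + d n *\<^sub>R x)"
  have inv: "\<sigma> n (\<tau> n z) = z" for n z
    using d_pos[of n] by (simp add: \<sigma>_def \<tau>_def)
  have [measurable]: "\<tau> n \<in> borel_measurable borel" "\<sigma> n \<in> borel_measurable borel" for n
    unfolding \<tau>_def \<sigma>_def by measurable
  have \<tau>_meas: "\<tau> n \<in> measurable \<mu> borel" for n
    by (simp add: measurable_cong_sets[OF sets refl])
  have space: "space \<mu> = UNIV"
    using sets_eq_imp_space_eq[OF sets] by simp
  \<comment> \<open>Masses and lengths are divided by the same factor, which preserves
    one-dimensional densities.\<close>
  define M where "M = (\<lambda>n. scale_measure (ennreal (1 / d n)) (distr \<mu> borel (\<tau> n)))"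
  have M: "measure (M n) X = measure \<mu> (\<tau> n -` X) / d n" if "X \<in> sets borel" for n X
  proof -
    have "measure (M n) X = enn2real (ennreal (1 / d n) * emeasure \<mu> (\<tau> n -` X))"
      unfolding M_def measure_def using that \<tau>_meas by (simp add: emeasure_distr space)
    then show ?thesis
      using d_pos[of n] by (simp add: enn2real_mult measure_def)
  qed
  have vball: "\<tau> n -` ball x r = ball (\<sigma> n x) (d n * r)" for n x r
  proof -
    have "dist x (\<tau> n z) * d n = dist (\<sigma> n x) z" for z
    proof -
      have "\<sigma> n x - z = d n *\<^sub>R (x - \<tau> n z)"
        using d_pos[of n] by (simp add: \<sigma>_def \<tau>_def algebra_simps)
      then show ?thesis
        using d_pos[of n] by (simp add: dist_norm)
    qed
    then have "dist x (\<tau> n z) < r \<longleftrightarrow> dist (\<sigma> n x) z < d n * r" for z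
      using d_pos[of n] by (metis mult.commute mult_less_cancel_left_pos)
    then show ?thesis by auto
  qed
  define S where "S = (\<lambda>n. \<sigma> n -` G n)"
  have S_sets: "S n \<in> sets borel" for n
    unfolding S_def using measurable_sets[of "\<sigma> n" borel borel "G n"] G(1) by simp
  have vS: "\<tau> n -` S n = G n" for n
    by (auto simp: S_def inv)
  have small: "d n * r < r0 n" if "0 < r" "r \<le> R" "R < real (Suc n)" for n r R
  proof -
    have "d n * r < d n * Suc n"
      using that d_pos[of n] by (intro mult_strict_left_mono) auto
    also have "\<dots> < r0 n"
      using diam[of n] by (simp add: d_def field_simps)
    finally show ?thesis .
  qed
  have ev: "\<forall>\<^sub>F n in sequentially. R < real (Suc n) \<and> R / real (Suc n) \<le> e" if "e > 0" for R e :: real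
  proof -
    have "\<forall>\<^sub>F n in sequentially. \<bar>R\<bar> / e + \<bar>R\<bar> < real n"
      using filterlim_real_sequentially by (simp add: filterlim_at_top_dense)
    then show ?thesis
    proof eventually_elim
      case (elim n)
      have "0 \<le> \<bar>R\<bar> / e" using \<open>e > 0\<close> by simp
      then have "R < real (Suc n)" "\<bar>R\<bar> / e < real (Suc n)" using elim by linarith+
      moreover have "R / e \<le> \<bar>R\<bar> / e" using \<open>e > 0\<close> by (intro divide_right_mono) auto
      ultimately have "R < real (Suc n)" "R / e < real (Suc n)" by linarith+
      then show ?case
        using \<open>e > 0\<close> by (simp add: field_simps)
    qed
  qed
  interpret B: blowup_sequence M S \<theta>
  proof (rule blowup_sequence.intro)
    fix n
    interpret \<mu>: finite_measure \<mu> by fact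
    show "finite_measure (M n)"
      using \<mu>.emeasure_finite[of UNIV] \<tau>_meas[of n] space
      by (intro finite_measureI) (simp add: M_def space_scale_measure emeasure_distr ennreal_mult_eq_top_iff)
    show "sets (M n) = sets borel" by (simp add: M_def)
    show "0 \<in> S n" using G(2) by (simp add: S_def \<sigma>_def)
  next
    fix R e :: real assume "e > 0"
    from ev[OF this, of R]
    show "\<forall>\<^sub>F n in sequentially. \<forall>q\<in>S n. \<forall>r. 0 < r \<longrightarrow> r \<le> R \<longrightarrow> \<bar>measure (M n) (ball q r) - \<theta> * r\<bar> \<le> e"
    proof eventually_elim
      case (elim n)
      show ?case
      proof (intro ballI allI impI)
        fix q r assume q: "q \<in> S n" and r: "0 < r" "r \<le> R"
        have "\<bar>measure \<mu> (ball (\<sigma> n q) (d n * r)) - \<theta> * (d n * r)\<bar> \<le> 1 / Suc n * (d n * r)"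
          using G_ball[of n] q r small[OF r, of n] elim d_pos[of n] by (auto simp: S_def)
        then have "\<bar>measure \<mu> (ball (\<sigma> n q) (d n * r)) - \<theta> * (d n * r)\<bar> / d n \<le> 1 / Suc n * (d n * r) / d n"
          using d_pos[of n] by (intro divide_right_mono) auto
        moreover have "\<bar>measure \<mu> (ball (\<sigma> n q) (d n * r)) - \<theta> * (d n * r)\<bar> / d n
            = \<bar>measure (M n) (ball q r) - \<theta> * r\<bar>"
        proof -
          have "measure (M n) (ball q r) - \<theta> * r = (measure \<mu> (ball (\<sigma> n q) (d n * r)) - \<theta> * (d n * r)) / d n"
            using d_pos[of n] by (simp add: M vball diff_divide_distrib)
          then show ?thesis using d_pos[of n] by simp
        qed
        moreover have "1 / Suc n * (d n * r) / d n \<le> R / Suc n"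
          using d_pos[of n] r by (simp add: divide_right_mono)
        ultimately show "\<bar>measure (M n) (ball q r) - \<theta> * r\<bar> \<le> e"
          using elim by linarith
      qed
    qed
    from ev[OF \<open>e > 0\<close>, of R]
    show "\<forall>\<^sub>F n in sequentially. measure (M n) (ball 0 R - S n) \<le> e"
    proof eventually_elim
      case (elim n)
      show ?case
      proof (cases "R > 0")
        case True
        have "measure (M n) (ball 0 R - S n) = measure \<mu> (ball p (d n * R) - G n) / d n"
          using M[of "ball 0 R - S n" n] S_sets[of n] by (simp add: vimage_Diff vball vS) (simp add: \<sigma>_def)
        also have "\<dots> \<le> 1 / Suc n * (d n * R) / d n"
          using G_rest[of n] True small[OF True order_refl, of n] elim d_pos[of n] by (intro divide_right_mono) auto
        also have "\<dots> \<le> e"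
          using elim d_pos[of n] by simp
        finally show ?thesis .
      next
        case False
        then show ?thesis using \<open>e > 0\<close> by (simp add: ball_empty)
      qed
    qed
  qed (use S_sets \<open>\<theta> > 0\<close> in auto)
  define C' where "C' = (\<lambda>n. \<sigma> n -` C n)"
  have vC: "\<tau> n -` C' n = C n" for n
    by (auto simp: C'_def inv)
  have C'_dist: "dist x y \<le> 1" if "x \<in> C' n" "y \<in> C' n" for n x y
  proof -
    have "dist (\<sigma> n x) (\<sigma> n y) \<le> d n"
      using that diameter_bounded_bound[OF C(2)[of n]] by (auto simp: C'_def d_def)
    moreover have "dist (\<sigma> n x) (\<sigma> n y) = d n * dist x y"
      using d_pos[of n] by (simp add: \<sigma>_def dist_norm flip: scaleR_diff_right)
    ultimately show ?thesis using d_pos[of n] by simp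
  qed
  have C'_sets: "C' n \<in> sets borel" for n
    unfolding C'_def using measurable_sets[of "\<sigma> n" borel borel "C n"] C(1) by simp
  have "0 \<in> C' n" for n
    using C(3) by (simp add: C'_def \<sigma>_def)
  then have "C' n \<subseteq> cball 0 1" for n
    using C'_dist[of 0] by force
  then obtain n where "measure (M n) (C' n) \<le> \<theta> / 2 + h"
    using B.not_diameter_excess[of C' h] C'_sets C'_dist \<open>h > 0\<close> by blast
  then have "measure \<mu> (C n) \<le> (\<theta> / 2 + h) * d n"
    using M[OF C'_sets, of n n] vC d_pos[of n] by (simp add: field_simps)
  with big[of n] show False by (simp add: d_def)
qed

text \<open>The exceptional set is null for \<open>\<mu>\<close> restricted to the complement of \<open>G\<close>, hence null for the
  Hausdorff measure by the covering argument, hence null for \<open>\<mu>\<close> by the upper bound on balls.\<close>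
lemma AE_density_point:
  fixes \<mu> :: "'a::euclidean_space measure"
  assumes fin: "finite_measure \<mu>" and sets: "sets \<mu> = sets borel" and G: "G \<in> sets borel"
    and "s > 0" "\<rho> > 0" and le: "\<And>p. p \<in> G \<Longrightarrow> ball_le \<mu> s \<rho> c p"
  shows "AE p in \<mu>. p \<in> G \<longrightarrow> (\<forall>e>0. \<exists>r0>0. \<forall>r. 0 < r \<longrightarrow> r < r0 \<longrightarrow> measure \<mu> (ball p r - G) \<le> e * r powr s)"
proof -
  interpret \<mu>: finite_measure \<mu> by fact
  have space: "space \<mu> = UNIV"
    using sets_eq_imp_space_eq[OF sets] by simp
  define b where "b = max c 1"
  have b: "b > 0" "\<And>p. p \<in> G \<Longrightarrow> ball_le \<mu> s \<rho> b p"
    using ball_le_mono[OF le] by (auto simp: b_def)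
  define \<nu> where "\<nu> = density \<mu> (indicator (- G))"
  have \<nu>_sets: "sets \<nu> = sets borel"
    by (simp add: \<nu>_def sets)
  have \<nu>: "emeasure \<nu> X = emeasure \<mu> (X - G)" if "X \<in> sets borel" for X
  proof -
    have "emeasure \<nu> X = (\<integral>\<^sup>+x. indicator (- G) x * indicator X x \<partial>\<mu>)"
      unfolding \<nu>_def using that G sets by (intro emeasure_density) (auto simp: borel_comp)
    also have "\<dots> = (\<integral>\<^sup>+x. indicator (X - G) x \<partial>\<mu>)"
      by (intro nn_integral_cong) (auto simp: indicator_def)
    also have "\<dots> = emeasure \<mu> (X - G)"
      using that G sets by (intro nn_integral_indicator) auto
    finally show ?thesis .
  qed
  then have \<nu>m: "measure \<nu> X = measure \<mu> (X - G)" if "X \<in> sets borel" for X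
    using that by (simp add: measure_def)
  have \<nu>_fin: "finite_measure \<nu>"
    using \<nu>[of UNIV] \<mu>.emeasure_finite[of "UNIV - G"] by (intro finite_measureI) (simp add: \<nu>_def space)
  \<comment> \<open>These are the points of G where balls of arbitrarily small radius r have
    \<nu>-mass above \<open>t * r powr s\<close>; the unions over r are open, so no restriction to
    rational radii is called for.\<close>
  define N where "N = (\<lambda>t. G \<inter> (\<Inter>k::nat. \<Union>r\<in>{0<..<1 / Suc k}. {p. t * r powr s < measure \<nu> (ball p r)}))"
  have N_sets: "N t \<in> sets borel" for t
    unfolding N_def using G open_measure_ball_gt[OF \<nu>_fin \<nu>_sets]
    by (intro sets.Int[OF G] sets.countable_INT'' borel_open open_UN) auto
  have N_null: "emeasure \<mu> (N t) = 0" if "t > 0" for t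
  proof -
    have "hausdorff_outer s (N t) \<le> ennreal (2 powr s / t) * emeasure \<nu> (N t)"
    proof (rule hausdorff_outer_le_measure[OF \<nu>_fin \<nu>_sets N_sets \<open>t > 0\<close>])
      fix p and d :: real assume p: "p \<in> N t" and "d > 0"
      obtain k where k: "1 / real (Suc k) < d"
        using \<open>d > 0\<close> by (metis inverse_eq_divide reals_Archimedean)
      obtain r where r: "0 < r" "r < 1 / Suc k" "t * r powr s < measure \<nu> (ball p r)"
        using p unfolding N_def by (auto dest!: spec[of _ k])
      have "measure \<nu> (ball p r) \<le> measure \<nu> (cball p r)"
        by (intro finite_measure.finite_measure_mono[OF \<nu>_fin]) (auto simp: \<nu>_sets)
      with r k show "\<exists>r>0. r < d \<and> t * r powr s \<le> measure \<nu> (cball p r)"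
        by (intro exI[of _ r]) auto
    qed
    also have "emeasure \<nu> (N t) = 0"
    proof -
      have "N t - G = {}" by (auto simp: N_def)
      then show ?thesis using \<nu>[OF N_sets, of t] by (metis emeasure_empty)
    qed
    finally have H0: "hausdorff_outer s (N t) = 0" by simp
    have "emeasure \<mu> (N t) \<le> ennreal b * hausdorff_outer s (N t)"
    proof (rule emeasure_le_hausdorff_outer[OF sets N_sets b(1)])
      fix p assume "p \<in> N t"
      then have "ball_le \<mu> s \<rho> b p" using b by (auto simp: N_def)
      have "emeasure \<mu> C \<le> ennreal (b * diameter C powr s)"
        if C: "closed C" "bounded C" "p \<in> C" "diameter C < \<rho>" for C
      proof -
        have "C \<subseteq> cball p (diameter C)"
          using C diameter_bounded_bound[of C] by auto
        then have "measure \<mu> C \<le> measure \<mu> (cball p (diameter C))"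
          by (intro \<mu>.finite_measure_mono) (auto simp: sets)
        also have "\<dots> \<le> b * diameter C powr s"
          by (rule measure_cball_le[OF fin sets \<open>ball_le \<mu> s \<rho> b p\<close> diameter_ge_0[OF C(2)] C(4) \<open>s > 0\<close>])
        finally show ?thesis
          by (simp add: \<mu>.emeasure_eq_measure ennreal_leI)
      qed
      with \<open>\<rho> > 0\<close> show "\<exists>d>0. \<forall>C. closed C \<longrightarrow> bounded C \<longrightarrow> p \<in> C \<longrightarrow> diameter C < d \<longrightarrow>
          emeasure \<mu> C \<le> ennreal (b * diameter C powr s)"
        by blast
    qed
    then show ?thesis using H0 by simp
  qed
  have "AE p in \<mu>. \<forall>j::nat. p \<notin> N (1 / Suc j)"
    unfolding AE_all_countable using N_null N_sets sets
    by (intro allI AE_not_in) (auto simp: null_sets_def)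
  then show ?thesis
  proof (rule AE_mp, intro AE_I2 impI allI)
    fix p and e :: real assume N: "\<forall>j::nat. p \<notin> N (1 / Suc j)" and "p \<in> G" and "e > 0"
    obtain j where j: "1 / real (Suc j) < e"
      using \<open>e > 0\<close> by (metis inverse_eq_divide reals_Archimedean)
    obtain k :: nat where k: "\<And>r. 0 < r \<Longrightarrow> r < 1 / Suc k \<Longrightarrow> \<not> 1 / Suc j * r powr s < measure \<nu> (ball p r)"
      using N[rule_format, of j] \<open>p \<in> G\<close> unfolding N_def by fastforce
    have "measure \<mu> (ball p r - G) \<le> e * r powr s" if "0 < r" "r < 1 / Suc k" for r
    proof -
      have "measure \<mu> (ball p r - G) \<le> 1 / Suc j * r powr s"
        using k[OF that] \<nu>m[of "ball p r"] by simp
      also have "\<dots> \<le> e * r powr s"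
        using j by (intro mult_right_mono) auto
      finally show ?thesis .
    qed
    then show "\<exists>r0>0. \<forall>r. 0 < r \<longrightarrow> r < r0 \<longrightarrow> measure \<mu> (ball p r - G) \<le> e * r powr s"
      by (intro exI[of _ "1 / Suc k"]) auto
  qed
qed

text \<open>A positive density at p does not make nearby densities similar. The countably many sets
  \<open>G j q k\<close>, on each of which ball ratios stay in a band of width 1/(j+1) below a
  common scale, do: almost every point is a density point of all those that contain it.\<close>

lemma AE_diameter_ratio_bound:
  fixes \<mu> :: "'a::euclidean_space measure"
  assumes fin: "finite_measure \<mu>" and sets: "sets \<mu> = sets borel"
  shows "AE p in \<mu>. \<forall>\<theta>>0. has_density \<mu> 1 p \<theta> \<longrightarrow> (\<forall>h>0. \<exists>d>0. \<forall>C. closed C \<longrightarrow> bounded C \<longrightarrow> p \<in> C \<longrightarrow> diameter C < d \<longrightarrow>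
    measure \<mu> C \<le> (\<theta> / 2 + h) * diameter C)"
proof -
  define G where "G = (\<lambda>(j::nat) q (k::nat). {p. ball_ge \<mu> 1 (1 / Suc k) q p} \<inter> {p. ball_le \<mu> 1 (1 / Suc k) (q + 1 / Suc j) p})"
  have G_sets: "G j q k \<in> sets borel" for j q k
    unfolding G_def using sets_ball_ge[OF fin sets] sets_ball_le[OF fin sets] by (intro sets.Int)
  have "AE p in \<mu>. p \<in> G j q k \<longrightarrow> (\<forall>e>0. \<exists>r0>0. \<forall>r. 0 < r \<longrightarrow> r < r0 \<longrightarrow> measure \<mu> (ball p r - G j q k) \<le> e * r powr 1)" for j q k
    by (rule AE_density_point[OF fin sets G_sets, of 1 "1 / Suc k" j q k "q + 1 / Suc j"]) (auto simp: G_def)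
  then have "AE p in \<mu>. \<forall>j. \<forall>q\<in>\<rat>. \<forall>k. p \<in> G j q k \<longrightarrow> (\<forall>e>0. \<exists>r0>0. \<forall>r. 0 < r \<longrightarrow> r < r0 \<longrightarrow> measure \<mu> (ball p r - G j q k) \<le> e * r powr 1)"
    unfolding AE_all_countable AE_ball_countable[OF countable_rat] by blast
  then show ?thesis
  proof (rule AE_mp, intro AE_I2 impI allI)
    fix \<theta> h :: real and p :: 'a
    assume dp: "\<forall>j. \<forall>q\<in>\<rat>. \<forall>k. p \<in> G j q k \<longrightarrow> (\<forall>e>0. \<exists>r0>0. \<forall>r. 0 < r \<longrightarrow> r < r0 \<longrightarrow> measure \<mu> (ball p r - G j q k) \<le> e * r powr 1)"
      and "\<theta> > 0" and d: "has_density \<mu> 1 p \<theta>" and "h > 0"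
    show "\<exists>d>0. \<forall>C. closed C \<longrightarrow> bounded C \<longrightarrow> p \<in> C \<longrightarrow> diameter C < d \<longrightarrow>
        measure \<mu> C \<le> (\<theta> / 2 + h) * diameter C"
    proof (rule diameter_ratio_bound[OF fin sets \<open>\<theta> > 0\<close> \<open>h > 0\<close>])
      fix \<epsilon> :: real assume "\<epsilon> > 0"
      obtain j where j: "1 / real (Suc j) < \<epsilon>"
        using \<open>\<epsilon> > 0\<close> by (metis inverse_eq_divide reals_Archimedean)
      obtain q and k :: nat where q: "q \<in> \<rat>" "ball_ge \<mu> 1 (1 / Suc k) q p" "ball_le \<mu> 1 (1 / Suc k) (q + 1 / Suc j) p"
        using d ex_has_density_iff[of \<mu> 1 p] by blast
      then have pG: "p \<in> G j q k" by (simp add: G_def)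
      \<comment> \<open>The density at p lies in the same band as the ball ratios on the piece, so
        \<theta> may replace the ratio at every centre there.\<close>
      have "q \<le> \<theta>"
      proof (rule dense_ge)
        fix t assume "\<theta> < t"
        then obtain l :: nat where "ball_le \<mu> 1 (1 / Suc l) t p"
          using d unfolding has_density_iff by blast
        then show "q \<le> t" using ball_ge_le[OF q(2)] by simp
      qed
      have "\<theta> \<le> q + 1 / Suc j"
      proof (rule dense_le)
        fix t assume "t < \<theta>"
        then obtain l :: nat where "ball_ge \<mu> 1 (1 / Suc l) t p"
          using d unfolding has_density_iff by blast
        then show "t \<le> q + 1 / Suc j" using ball_ge_le[OF _ q(3)] by simp
      qed
      obtain r1 where r1: "r1 > 0" "\<forall>r. 0 < r \<longrightarrow> r < r1 \<longrightarrow> measure \<mu> (ball p r - G j q k) \<le> \<epsilon> * r powr 1"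
        using dp q(1) pG \<open>\<epsilon> > 0\<close> by blast
      define r0 where "r0 = min r1 (1 / Suc k)"
      have "\<bar>measure \<mu> (ball y r) - \<theta> * r\<bar> \<le> \<epsilon> * r" if y: "y \<in> G j q k" and r: "0 < r" "r < r0" for y r
      proof -
        have "q * r \<le> measure \<mu> (ball y r)" "measure \<mu> (ball y r) \<le> (q + 1 / Suc j) * r"
          using y r by (auto simp: G_def ball_ge_def ball_le_def r0_def)
        moreover have "q * r \<le> \<theta> * r" "\<theta> * r \<le> (q + 1 / Suc j) * r"
          using \<open>q \<le> \<theta>\<close> \<open>\<theta> \<le> q + 1 / Suc j\<close> r by (auto intro!: mult_right_mono)
        ultimately have "\<bar>measure \<mu> (ball y r) - \<theta> * r\<bar> \<le> (q + 1 / Suc j) * r - q * r"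
          by linarith
        also have "\<dots> = 1 / Suc j * r" by (simp add: algebra_simps)
        also have "\<dots> \<le> \<epsilon> * r" using j r by (intro mult_right_mono) auto
        finally show ?thesis .
      qed
      moreover have "measure \<mu> (ball p r - G j q k) \<le> \<epsilon> * r" if "0 < r" "r < r0" for r
        using r1(2) that by (auto simp: r0_def)
      moreover have "r0 > 0" using r1 by (simp add: r0_def)
      ultimately show "\<exists>G\<in>sets borel. \<exists>r0>0. p \<in> G \<and>
          (\<forall>q\<in>G. \<forall>r. 0 < r \<longrightarrow> r < r0 \<longrightarrow> \<bar>measure \<mu> (ball q r) - \<theta> * r\<bar> \<le> \<epsilon> * r) \<and>
          (\<forall>r. 0 < r \<longrightarrow> r < r0 \<longrightarrow> measure \<mu> (ball p r - G) \<le> \<epsilon> * r)"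
        using G_sets[of j q k] pG by blast
    qed
  qed
qed

section \<open>Measures with positive density\<close>

lemma ennreal_le_of_le_mult:
  fixes x y :: ennreal
  assumes "\<And>c::real. c > 1 \<Longrightarrow> x \<le> ennreal c * y"
  shows "x \<le> y"
proof (cases "y = \<top>")
  case False
  then have fin: "x \<noteq> \<top>"
    using assms[of 2] by (auto simp: top_unique ennreal_mult_eq_top_iff)
  define a b where "a = enn2real x" and "b = enn2real y"
  have ab: "x = ennreal a" "y = ennreal b" "a \<ge> 0" "b \<ge> 0"
    using False fin by (auto simp: a_def b_def less_top)
  have le: "a \<le> c * b" if "c > 1" for c
    using assms[OF that] ab that by (simp add: ennreal_mult[symmetric] ennreal_le_iff)
  have "a \<le> b"
  proof (rule field_le_epsilon)
    fix e :: real assume "e > 0"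
    have "a \<le> (1 + e / (b + 1)) * b"
      using \<open>e > 0\<close> ab by (intro le) auto
    also have "\<dots> = b + e * (b / (b + 1))"
      by (simp add: algebra_simps)
    also have "\<dots> \<le> b + e * 1"
      using \<open>e > 0\<close> ab by (intro add_left_mono mult_left_mono) (auto simp: field_simps)
    finally show "a \<le> b + e" by simp
  qed
  then show ?thesis
    using ab by (simp add: ennreal_leI)
qed auto

text \<open>On slices where \<theta> varies by a factor l the measures agree up to a factor close to
  1. Geometric slices give multiplicative errors, which pass through the sum over all slices even
  when it is infinite, and reach down to arbitrarily small positive \<theta>.\<close>

lemma emeasure_eq_nn_integral_density:
  fixes \<mu> \<nu> :: "'a::topological_space measure" and \<theta> :: "'a \<Rightarrow> real"
  assumes sets: "sets \<mu> = sets borel" "sets \<nu> = sets borel"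
    and \<theta> [measurable]: "\<theta> \<in> borel_measurable borel" and "\<kappa> > 0"
    and lo: "\<And>F a. F \<in> sets borel \<Longrightarrow> a > 0 \<Longrightarrow> (\<And>p. p \<in> F \<Longrightarrow> a < \<theta> p) \<Longrightarrow>
       ennreal (\<kappa> * a) * emeasure \<nu> F \<le> emeasure \<mu> F"
    and hi: "\<And>F b. F \<in> sets borel \<Longrightarrow> b > 0 \<Longrightarrow> (\<And>p. p \<in> F \<Longrightarrow> 0 < \<theta> p \<and> \<theta> p < b) \<Longrightarrow>
       emeasure \<mu> F \<le> ennreal (\<kappa> * b) * emeasure \<nu> F"
    and B: "B \<in> sets borel" "\<And>p. p \<in> B \<Longrightarrow> 0 < \<theta> p"
  shows "emeasure \<mu> B = (\<integral>\<^sup>+p. ennreal (\<kappa> * \<theta> p) * indicator B p \<partial>\<nu>)"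
proof -
  define \<eta> where "\<eta> = density \<nu> (\<lambda>p. ennreal (\<kappa> * \<theta> p))"
  have \<eta>_sets: "sets \<eta> = sets borel" by (simp add: \<eta>_def sets)
  have [measurable]: "\<theta> \<in> borel_measurable \<nu>"
    using \<theta> by (simp add: measurable_cong_sets[OF sets(2) refl])
  have \<eta>: "emeasure \<eta> X = (\<integral>\<^sup>+p. ennreal (\<kappa> * \<theta> p) * indicator X p \<partial>\<nu>)" if "X \<in> sets borel" for X
    unfolding \<eta>_def using that sets(2) by (intro emeasure_density) auto
  have both: "emeasure \<mu> B \<le> ennreal c * emeasure \<eta> B \<and> emeasure \<eta> B \<le> ennreal c * emeasure \<mu> B" if "c > 1" for c :: real
  proof -
    define l where "l = sqrt c"
    have l: "l > 1" "l * l = c" using that by (auto simp: l_def)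
    then have "0 \<le> l" "0 \<le> c" using that by auto
    define X where "X = (\<lambda>k::int. B \<inter> {p. l powr k \<le> \<theta> p \<and> \<theta> p < l powr (k + 1)})"
    have X_sets: "X k \<in> sets borel" for k
      unfolding X_def using B(1) by measurable
    have disj: "disjoint_family X"
    proof (unfold disjoint_family_on_def, intro ballI impI)
      have "X i \<inter> X j = {}" if "i < j" for i j
      proof -
        have "l powr (i + 1) \<le> l powr j" using that l by (intro powr_mono) auto
        then show ?thesis by (auto simp: X_def)
      qed
      then show "X i \<inter> X j = {}" if "i \<noteq> j" for i j
        using that by (metis Int_commute linorder_neqE)
    qed
    have B_eq: "B = (\<Union>k. X k)"
    proof (intro equalityI subsetI)
      fix p assume p: "p \<in> B"
      then have "\<theta> p > 0" by (rule B(2))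
      define k where "k = \<lfloor>log l (\<theta> p)\<rfloor>"
      have "k \<le> log l (\<theta> p)" "log l (\<theta> p) < k + 1" by (auto simp: k_def)
      then have "l powr k \<le> \<theta> p" "\<theta> p < l powr (k + 1)"
        using l \<open>\<theta> p > 0\<close> by (auto simp: le_log_iff log_less_iff)
      with p show "p \<in> (\<Union>k. X k)" by (auto simp: X_def)
    qed (auto simp: X_def)
    have piece: "emeasure \<mu> (X k) \<le> ennreal c * emeasure \<eta> (X k) \<and> emeasure \<eta> (X k) \<le> ennreal c * emeasure \<mu> (X k)" for k
    proof -
      have l_pos: "l powr k > 0" "l powr (k + 1) = l * l powr k" "l powr k = l * l powr (k - 1)" "l powr (k - 1) > 0"
        using l by (auto simp: powr_add powr_diff)
      have up: "emeasure \<eta> (X k) \<le> ennreal (\<kappa> * l powr (k + 1)) * emeasure \<nu> (X k)"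
      proof -
        have "emeasure \<eta> (X k) \<le> (\<integral>\<^sup>+p. ennreal (\<kappa> * l powr (k + 1)) * indicator (X k) p \<partial>\<nu>)"
          unfolding \<eta>[OF X_sets] using \<open>\<kappa> > 0\<close>
          by (intro nn_integral_mono) (auto simp: X_def indicator_def intro!: ennreal_leI)
        also have "\<dots> = ennreal (\<kappa> * l powr (k + 1)) * emeasure \<nu> (X k)"
          using X_sets sets by (intro nn_integral_cmult_indicator) auto
        finally show ?thesis .
      qed
      have down: "ennreal (\<kappa> * l powr k) * emeasure \<nu> (X k) \<le> emeasure \<eta> (X k)"
      proof -
        have "ennreal (\<kappa> * l powr k) * emeasure \<nu> (X k) = (\<integral>\<^sup>+p. ennreal (\<kappa> * l powr k) * indicator (X k) p \<partial>\<nu>)"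
          using X_sets sets by (intro nn_integral_cmult_indicator[symmetric]) auto
        also have "\<dots> \<le> emeasure \<eta> (X k)"
          unfolding \<eta>[OF X_sets] using \<open>\<kappa> > 0\<close>
          by (intro nn_integral_mono) (auto simp: X_def indicator_def intro!: ennreal_leI)
        finally show ?thesis .
      qed
      have "emeasure \<mu> (X k) \<le> ennreal (\<kappa> * l powr (k + 1)) * emeasure \<nu> (X k)"
      proof (rule hi[OF X_sets])
        show "0 < l powr (k + 1)" using l by simp
      qed (simp add: X_def B(2))
      also have "\<dots> = ennreal l * (ennreal (\<kappa> * l powr k) * emeasure \<nu> (X k))"
      proof -
        have "\<kappa> * l powr (k + 1) = l * (\<kappa> * l powr k)"
          unfolding l_pos(2) by simp
        then have "ennreal (\<kappa> * l powr (k + 1)) = ennreal l * ennreal (\<kappa> * l powr k)"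
          using \<open>0 \<le> l\<close> by (simp only: ennreal_mult')
        then show ?thesis by (simp only: mult.assoc)
      qed
      also have "\<dots> \<le> ennreal c * emeasure \<eta> (X k)"
      proof (intro mult_mono ennreal_leI down)
        have "l * 1 \<le> l * l" using l by (intro mult_left_mono) auto
        then show "l \<le> c" using l by simp
      qed auto
      finally have 1: "emeasure \<mu> (X k) \<le> ennreal c * emeasure \<eta> (X k)" .
      \<comment> \<open>\<open>lo\<close> needs a strict lower bound, but \<theta> may equal
        \<open>l powr k\<close> on the slice. Stepping down to \<open>l powr (k - 1)\<close> costs a
        second factor l, hence the choice of l as the square root of c.\<close>
      have "\<kappa> * l powr (k + 1) = c * (\<kappa> * l powr (k - 1))"
        unfolding l_pos(2) l_pos(3) l(2)[symmetric] by simp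
      then have "ennreal (\<kappa> * l powr (k + 1)) = ennreal c * ennreal (\<kappa> * l powr (k - 1))"
        using \<open>0 \<le> c\<close> by (simp only: ennreal_mult')
      then have "emeasure \<eta> (X k) \<le> ennreal c * (ennreal (\<kappa> * l powr (k - 1)) * emeasure \<nu> (X k))"
        using up by (simp only: mult.assoc)
      also have "\<dots> \<le> ennreal c * emeasure \<mu> (X k)"
      proof (intro mult_left_mono lo)
        fix p assume "p \<in> X k"
        then have "l powr k \<le> \<theta> p" by (simp add: X_def)
        moreover have "l powr (k - 1) < l powr k"
          using l by (intro powr_less_mono) auto
        ultimately show "l powr (k - 1) < \<theta> p" by linarith
      qed (use l_pos X_sets in auto)
      finally show ?thesis using 1 by blast
    qed
    have sum: "emeasure M B = (\<integral>\<^sup>+k. emeasure M (X k) \<partial>count_space UNIV)" if "sets M = sets borel" for M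
      unfolding B_eq using X_sets that disj by (intro emeasure_UN_countable) auto
    have "emeasure \<mu> B \<le> (\<integral>\<^sup>+k. ennreal c * emeasure \<eta> (X k) \<partial>count_space UNIV)"
      unfolding sum[OF sets(1)] using piece by (intro nn_integral_mono) auto
    moreover have "emeasure \<eta> B \<le> (\<integral>\<^sup>+k. ennreal c * emeasure \<mu> (X k) \<partial>count_space UNIV)"
      unfolding sum[OF \<eta>_sets] using piece by (intro nn_integral_mono) auto
    ultimately show ?thesis
      unfolding sum[OF sets(1)] sum[OF \<eta>_sets] by (simp add: nn_integral_cmult)
  qed
  have "emeasure \<mu> B = emeasure \<eta> B"
  proof (rule antisym)
    show "emeasure \<mu> B \<le> emeasure \<eta> B"
      by (rule ennreal_le_of_le_mult) (use both in blast)
    show "emeasure \<eta> B \<le> emeasure \<mu> B"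
      by (rule ennreal_le_of_le_mult) (use both in blast)
  qed
  then show ?thesis using \<eta> B by simp
qed

lemma ex_cball_ge:
  assumes fin: "finite_measure \<mu>" and sets: "sets \<mu> = sets borel"
    and "has_density \<mu> s p \<theta>" "a < \<theta>" "d > 0"
  shows "\<exists>r>0. r < d \<and> a * r powr s \<le> measure \<mu> (cball p r)"
proof -
  obtain k :: nat where k: "ball_ge \<mu> s (1 / Suc k) a p"
    using assms(3,4) unfolding has_density_iff by blast
  define m where "m = min d (1 / Suc k)"
  define r where "r = m / 2"
  have "m > 0" "m \<le> d" "m \<le> 1 / Suc k" using \<open>d > 0\<close> by (auto simp: m_def)
  then have r: "0 < r" "r < d" "r < 1 / Suc k" unfolding r_def by linarith+
  have "a * r powr s \<le> measure \<mu> (ball p r)"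
    using k r by (auto simp: ball_ge_def)
  also have "\<dots> \<le> measure \<mu> (cball p r)"
    by (intro finite_measure.finite_measure_mono[OF fin]) (auto simp: sets)
  finally show ?thesis using r by blast
qed

text \<open>A ball has volume V r^n, so \<mu> has Lebesgue density \<open>dens\<close> / V, and
  Hausdorff measure is c times Lebesgue measure; the resulting constant 1/(c V) does not depend on
  \<mu>.\<close>

lemma density_eq_hausdorff_full_dim:
  obtains c :: real where "c > 0"
    "\<And>(\<mu> :: 'a::euclidean_space measure) B. finite_measure \<mu> \<Longrightarrow> sets \<mu> = sets borel \<Longrightarrow>
      B \<in> sets borel \<Longrightarrow> (\<And>p. p \<in> B \<Longrightarrow> 0 < dens \<mu> DIM('a) p) \<Longrightarrow>
      emeasure \<mu> B = (\<integral>\<^sup>+p. ennreal (c * dens \<mu> DIM('a) p) * indicator B p \<partial>hausdorff_measure DIM('a))"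
proof -
  define n where "n = real DIM('a)"
  define V where "V = unit_ball_vol n"
  have "V > 0" by (simp add: V_def n_def)
  obtain c where c: "c > 0" "\<And>B :: 'a set. B \<in> sets borel \<Longrightarrow> hausdorff_outer n B = ennreal c * emeasure lborel B"
    using hausdorff_outer_lborel unfolding n_def by blast
  show ?thesis
  proof (rule that[of "1 / (c * V)"])
    show "0 < 1 / (c * V)" using c \<open>V > 0\<close> by simp
    fix \<mu> :: "'a measure" and B
    assume fin: "finite_measure \<mu>" and sets: "sets \<mu> = sets borel"
      and B: "B \<in> sets borel" "\<And>p. p \<in> B \<Longrightarrow> 0 < dens \<mu> DIM('a) p"
    show "emeasure \<mu> B = (\<integral>\<^sup>+p. ennreal (1 / (c * V) * dens \<mu> DIM('a) p) * indicator B p \<partial>hausdorff_measure DIM('a))"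
      unfolding n_def[symmetric]
    proof (rule emeasure_eq_nn_integral_density)
      show "dens \<mu> n \<in> borel_measurable borel"
        by (rule borel_measurable_dens[OF fin sets])
      show "1 / (c * V) > 0" using c \<open>V > 0\<close> by simp
      show "0 < dens \<mu> n p" if "p \<in> B" for p using B that by (simp add: n_def)
    next
      fix F and a :: real assume F: "F \<in> sets borel" and "a > 0" and a: "\<And>p. p \<in> F \<Longrightarrow> a < dens \<mu> n p"
      have "emeasure lborel F \<le> ennreal (V / a) * emeasure \<mu> F"
        unfolding V_def n_def
      proof (rule lborel_le_measure[OF fin sets F \<open>a > 0\<close>])
        fix p and d :: real assume "p \<in> F" "d > 0"
        then show "\<exists>r>0. r < d \<and> a * r powr real DIM('a) \<le> measure \<mu> (cball p r)"
          using a[of p] \<open>a > 0\<close> unfolding n_def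
          by (intro ex_cball_ge[OF fin sets has_density_dens]) auto
      qed
      then have "ennreal (1 / (c * V) * a) * (ennreal c * emeasure lborel F)
          \<le> ennreal (1 / (c * V) * a) * (ennreal c * (ennreal (V / a) * emeasure \<mu> F))"
        by (intro mult_left_mono) auto
      also have "\<dots> = ennreal (1 / (c * V) * a * c * (V / a)) * emeasure \<mu> F"
        using c \<open>V > 0\<close> \<open>a > 0\<close> by (simp add: ennreal_mult[symmetric] mult.assoc[symmetric] del: times_divide_eq_left times_divide_eq_right)
      also have "1 / (c * V) * a * c * (V / a) = 1"
        using c \<open>V > 0\<close> \<open>a > 0\<close> by simp
      finally show "ennreal (1 / (c * V) * a) * emeasure (hausdorff_measure n) F \<le> emeasure \<mu> F"
        using F by (simp add: emeasure_hausdorff_measure c(2))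
    next
      fix F and b :: real assume F: "F \<in> sets borel" and "b > 0"
        and b: "\<And>p. p \<in> F \<Longrightarrow> 0 < dens \<mu> n p \<and> dens \<mu> n p < b"
      have "emeasure \<mu> F \<le> ennreal (b / V) * emeasure lborel F"
        unfolding V_def n_def
      proof (rule measure_le_lborel[OF fin sets F \<open>b > 0\<close>])
        fix p assume "p \<in> F"
        then show "\<exists>k::nat. ball_le \<mu> (real DIM('a)) (1 / Suc k) b p"
          using b[of p] has_density_dens[of \<mu> n p] unfolding has_density_iff n_def by auto
      qed
      also have "b / V = 1 / (c * V) * b * c"
        using c by simp
      also have "ennreal (1 / (c * V) * b * c) * emeasure lborel F = ennreal (1 / (c * V) * b) * (ennreal c * emeasure lborel F)"
        using c \<open>V > 0\<close> \<open>b > 0\<close> by (simp add: ennreal_mult[symmetric] mult.assoc[symmetric] del: times_divide_eq_left times_divide_eq_right)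
      finally show "emeasure \<mu> F \<le> ennreal (1 / (c * V) * b) * emeasure (hausdorff_measure n) F"
        using F by (simp add: emeasure_hausdorff_measure c(2))
    qed (use sets B in auto)
  qed
qed

text \<open>Both estimates produce 1/2: the lower one because Vitali balls have diameter 2r, the
  upper one from the almost everywhere bound for sets of small diameter.\<close>

lemma density_eq_hausdorff_dim_one:
  fixes \<mu> :: "'a::euclidean_space measure"
  assumes fin: "finite_measure \<mu>" and sets: "sets \<mu> = sets borel"
    and B: "B \<in> sets borel" "\<And>p. p \<in> B \<Longrightarrow> 0 < dens \<mu> 1 p"
  shows "emeasure \<mu> B = (\<integral>\<^sup>+p. ennreal (1 / 2 * dens \<mu> 1 p) * indicator B p \<partial>hausdorff_measure 1)"
proof (rule emeasure_eq_nn_integral_density)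
  interpret \<mu>: finite_measure \<mu> by fact
  show "dens \<mu> 1 \<in> borel_measurable borel"
    by (rule borel_measurable_dens[OF fin sets])
next
  fix F and a :: real assume F: "F \<in> sets borel" and "a > 0" and a: "\<And>p. p \<in> F \<Longrightarrow> a < dens \<mu> 1 p"
  have "hausdorff_outer 1 F \<le> ennreal (2 powr 1 / a) * emeasure \<mu> F"
  proof (rule hausdorff_outer_le_measure[OF fin sets F \<open>a > 0\<close>])
    fix p and d :: real assume "p \<in> F" "d > 0"
    then show "\<exists>r>0. r < d \<and> a * r powr 1 \<le> measure \<mu> (cball p r)"
      using a[of p] \<open>a > 0\<close> by (intro ex_cball_ge[OF fin sets has_density_dens]) auto
  qed
  then have "ennreal (1 / 2 * a) * hausdorff_outer 1 F \<le> ennreal (1 / 2 * a) * (ennreal (2 / a) * emeasure \<mu> F)"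
    by (intro mult_left_mono) auto
  also have "\<dots> = ennreal (1 / 2 * a * (2 / a)) * emeasure \<mu> F"
    using \<open>a > 0\<close> by (simp add: ennreal_mult[symmetric] mult.assoc[symmetric] del: times_divide_eq_left times_divide_eq_right)
  also have "1 / 2 * a * (2 / a) = 1" using \<open>a > 0\<close> by simp
  finally show "ennreal (1 / 2 * a) * emeasure (hausdorff_measure 1) F \<le> emeasure \<mu> F"
    using F by (simp add: emeasure_hausdorff_measure)
next
  interpret \<mu>: finite_measure \<mu> by fact
  fix F and b :: real assume F: "F \<in> sets borel" and "b > 0" and b: "\<And>p. p \<in> F \<Longrightarrow> 0 < dens \<mu> 1 p \<and> dens \<mu> 1 p < b"
  obtain N where N: "N \<in> null_sets \<mu>" and good: "\<And>p. p \<notin> N \<Longrightarrow> \<forall>\<theta>>0. has_density \<mu> 1 p \<theta> \<longrightarrow> (\<forall>h>0. \<exists>d>0. \<forall>C. closed C \<longrightarrow> bounded C \<longrightarrow> p \<in> C \<longrightarrow> diameter C < d \<longrightarrow>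
    measure \<mu> C \<le> (\<theta> / 2 + h) * diameter C)"
    using AE_E3[OF AE_diameter_ratio_bound[OF fin sets]] sets_eq_imp_space_eq[OF sets]
    by (metis DiffI UNIV_I space_borel)
  have N_sets: "N \<in> sets borel" using N sets by auto
  \<comment> \<open>Discarding the null set costs no mass and can only lower the Hausdorff measure,
    the right direction for an upper bound.\<close>
  have "emeasure \<mu> F = emeasure \<mu> (F - N)"
    using N F sets by (metis emeasure_Diff_null_set)
  also have "\<dots> \<le> ennreal (1 / 2 * b) * hausdorff_outer 1 (F - N)"
  proof (rule emeasure_le_hausdorff_outer[OF sets])
    fix p assume p: "p \<in> F - N"
    then have "dens \<mu> 1 p > 0" "has_density \<mu> 1 p (dens \<mu> 1 p)" "dens \<mu> 1 p < b"
      using b[of p] has_density_dens[of \<mu> 1 p] by auto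
    \<comment> \<open>With this h the bound \<theta>/2 + h becomes b/2, the same at every
      point.\<close>
    moreover have "(b - dens \<mu> 1 p) / 2 > 0" using \<open>dens \<mu> 1 p < b\<close> by simp
    ultimately obtain d where d: "d > 0" "\<And>C. closed C \<Longrightarrow> bounded C \<Longrightarrow> p \<in> C \<Longrightarrow> diameter C < d \<Longrightarrow>
        measure \<mu> C \<le> (dens \<mu> 1 p / 2 + (b - dens \<mu> 1 p) / 2) * diameter C"
      using good[of p] p by blast
    have "emeasure \<mu> C \<le> ennreal (1 / 2 * b * diameter C powr 1)"
      if "closed C" "bounded C" "p \<in> C" "diameter C < d" for C
      using d(2)[OF that] diameter_ge_0[OF that(2)]
      by (simp add: \<mu>.emeasure_eq_measure ennreal_leI add_divide_distrib[symmetric])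
    with d(1) show "\<exists>d>0. \<forall>C. closed C \<longrightarrow> bounded C \<longrightarrow> p \<in> C \<longrightarrow> diameter C < d \<longrightarrow>
        emeasure \<mu> C \<le> ennreal (1 / 2 * b * diameter C powr 1)"
      by blast
  qed (use F N_sets \<open>b > 0\<close> in auto)
  also have "\<dots> \<le> ennreal (1 / 2 * b) * hausdorff_outer 1 F"
    by (intro mult_left_mono hausdorff_outer_mono) auto
  finally show "emeasure \<mu> F \<le> ennreal (1 / 2 * b) * emeasure (hausdorff_measure 1) F"
    using F by (simp add: emeasure_hausdorff_measure)
qed (use sets B in auto)

section \<open>The lift function\<close>

text \<open>The metric on the product is Euclidean, so balls are discs and \<pi> is their area
  constant.\<close>

lemma rho_eps_scaled:
  assumes "\<epsilon> > 0"
  shows "\<epsilon> powr (2 - s) * rho_eps \<mu> \<epsilon> p = measure \<mu> (ball p \<epsilon>) / \<epsilon> powr s / pi"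
proof -
  have "measure lborel (ball (0::real\<times>real) \<epsilon>) = pi * \<epsilon>\<^sup>2"
    using content_ball[of \<epsilon> "0::real\<times>real"] assms by (simp add: unit_ball_vol_2 power2_eq_square)
  moreover have "\<epsilon> powr (2 - s) = \<epsilon>\<^sup>2 / \<epsilon> powr s"
    using assms by (simp add: powr_diff powr_realpow)
  ultimately show ?thesis
    using assms by (simp add: rho_eps_def field_simps)
qed

lemma rho_tilde_eq_dens:
  assumes s: "s_fun \<mu> p = ereal s" and d: "rho_tilde_defined \<mu> p"
  shows "rho_tilde \<mu> p = dens \<mu> s p / pi"
proof -
  have eq: "eventually (\<lambda>\<epsilon>. \<epsilon> powr (2 - s) * rho_eps \<mu> \<epsilon> p = measure \<mu> (ball p \<epsilon>) / \<epsilon> powr s / pi) (at_right 0)"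
    using eventually_at_right_less[of 0] by (rule eventually_mono) (rule rho_eps_scaled)
  obtain c where c: "((\<lambda>\<epsilon>. \<epsilon> powr (2 - s) * rho_eps \<mu> \<epsilon> p) \<longlongrightarrow> c) (at_right 0)"
    using d s by (auto simp: rho_tilde_defined_def)
  then have "((\<lambda>\<epsilon>. measure \<mu> (ball p \<epsilon>) / \<epsilon> powr s / pi) \<longlongrightarrow> c) (at_right 0)"
    using tendsto_cong[OF eq] by simp
  from tendsto_mult_right[OF this, of pi] have "has_density \<mu> s p (c * pi)"
    by (simp add: has_density_def)
  then have "dens \<mu> s p = c * pi"
    by (rule has_density_dens_eq)
  then show ?thesis
    using tendsto_Lim[OF trivial_limit_at_right_real c] s by (simp add: rho_tilde_def)
qed

text \<open>A law gives no mass to the zero set of its own density; applied to both marginals, it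
  makes the denominator of the lift positive almost everywhere.\<close>

lemma AE_marginal_density_pos:
  assumes sets: "sets \<mu> = sets borel" and f [measurable]: "f \<in> borel_measurable borel"
    and X [measurable]: "X \<in> borel_measurable borel"
    and eq: "distr \<mu> lborel X = density lborel (\<lambda>x. ennreal (f x))"
  shows "AE p in \<mu>. f (X p) > 0"
proof -
  have X': "X \<in> measurable \<mu> lborel"
    using X by (simp add: measurable_cong_sets[OF sets refl])
  have "AE x in density lborel (\<lambda>x. ennreal (f x)). f x > 0"
    by (subst AE_density) auto
  then have "AE x in distr \<mu> lborel X. f x > 0"
    by (simp only: eq)
  then show ?thesis
    by (subst (asm) AE_distr_iff[OF X']) auto
qed

lemma lift_radon_nikodym:
  fixes \<mu> :: "(real \<times> real) measure"
  assumes "prob_space \<mu>" and sets: "sets \<mu> = sets borel"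
    and \<rho>X: "\<And>x. 0 \<le> \<rho>X x" "\<rho>X \<in> borel_measurable borel"
    and \<rho>Y: "\<And>y. 0 \<le> \<rho>Y y" "\<rho>Y \<in> borel_measurable borel"
    and margX: "distr \<mu> lborel fst = density lborel (\<lambda>x. ennreal (\<rho>X x))"
    and margY: "distr \<mu> lborel snd = density lborel (\<lambda>y. ennreal (\<rho>Y y))"
    and A: "A \<in> sets borel" and s: "\<And>p. p \<in> A \<Longrightarrow> s_fun \<mu> p = ereal s"
    and lim: "AE p in \<mu>. p \<in> A \<longrightarrow> (\<exists>c>0. has_density \<mu> s p c)"
    and "\<kappa> > 0"
    and rep: "\<And>B. B \<in> sets borel \<Longrightarrow> (\<And>p. p \<in> B \<Longrightarrow> 0 < dens \<mu> s p) \<Longrightarrow>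
      emeasure \<mu> B = (\<integral>\<^sup>+p. ennreal (\<kappa> * dens \<mu> s p) * indicator B p \<partial>hausdorff_measure s)"
  shows "\<exists>f :: real \<times> real \<Rightarrow> real.
       f \<in> borel_measurable borel \<and> (\<forall>p\<in>A. 0 \<le> f p) \<and>
       density (density (restrict_space (hausdorff_measure s) A)
                  (\<lambda>p. ennreal (\<rho>X (fst p) * \<rho>Y (snd p)))) (\<lambda>p. ennreal (f p))
         = restrict_space \<mu> A \<and>
       (\<forall>p\<in>A. lift_defined \<mu> \<rho>X \<rho>Y p \<longrightarrow> lift \<mu> \<rho>X \<rho>Y p = 1 / (pi * \<kappa>) * f p)"
proof -
  interpret prob_space \<mu> by fact
  have fin: "finite_measure \<mu>" by unfold_locales
  have space: "space \<mu> = UNIV" using sets_eq_imp_space_eq[OF sets] by simp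
  note [measurable] = \<rho>X(2) \<rho>Y(2) A borel_measurable_dens[OF fin sets, of s]
  define g where "g = (\<lambda>p. \<rho>X (fst p) * \<rho>Y (snd p))"
  have g_meas [measurable]: "g \<in> borel_measurable borel"
    unfolding g_def by (simp add: borel_prod[symmetric])
  have g_nonneg: "g p \<ge> 0" for p by (simp add: g_def \<rho>X \<rho>Y)
  \<comment> \<open>This version of the derivative is given pointwise through the density, which
    makes the identity hold at every point where the lift is defined, not just almost
    everywhere.\<close>
  define f where "f = (\<lambda>p. \<kappa> * dens \<mu> s p / g p)"
  have dens_nonneg: "dens \<mu> s p \<ge> 0" for p
  proof (cases "\<exists>c. has_density \<mu> s p c")
    case True
    then obtain c where c: "has_density \<mu> s p c" ..
    then have "c \<ge> 0"
      unfolding has_density_def by (rule tendsto_lowerbound) (auto intro!: always_eventually)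
    then show ?thesis using has_density_dens_eq[OF c] by simp
  qed (simp add: dens_def)
  have f_meas [measurable]: "f \<in> borel_measurable borel"
    unfolding f_def by measurable
  have f_nonneg: "f p \<ge> 0" for p
    using g_nonneg dens_nonneg \<open>\<kappa> > 0\<close> by (simp add: f_def)
  define E where "E = {p\<in>A. dens \<mu> s p > 0 \<and> g p > 0}"
  have E_sets [measurable]: "E \<in> sets borel"
    unfolding E_def by measurable
  have AE_E: "AE p in \<mu>. p \<in> A \<longrightarrow> p \<in> E"
  proof -
    have "AE p in \<mu>. \<rho>X (fst p) > 0"
      using margX \<rho>X(2) by (intro AE_marginal_density_pos[OF sets]) (auto simp: borel_prod[symmetric])
    moreover have "AE p in \<mu>. \<rho>Y (snd p) > 0"
      using margY \<rho>Y(2) by (intro AE_marginal_density_pos[OF sets]) (auto simp: borel_prod[symmetric])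
    ultimately show ?thesis
      using lim by eventually_elim (auto simp: E_def g_def dest: has_density_dens_eq)
  qed
  have "density (density (restrict_space (hausdorff_measure s) A) (\<lambda>p. ennreal (g p))) (\<lambda>p. ennreal (f p)) = restrict_space \<mu> A" (is "?D = _")
  proof (rule measure_eqI)
    show "sets ?D = sets (restrict_space \<mu> A)"
      by (simp add: sets_restrict_space sets)
    fix B assume "B \<in> sets ?D"
    then have B: "B \<in> sets borel" "B \<subseteq> A"
      using A by (auto simp: sets_restrict_space)
    have BR: "B \<in> sets (restrict_space (hausdorff_measure s) A)"
      using B by (auto simp: sets_restrict_space)
    have m: "h \<in> borel_measurable (restrict_space (hausdorff_measure s) A)" if "h \<in> borel_measurable borel" for h :: "real \<times> real \<Rightarrow> ennreal"
      using that by (intro measurable_restrict_space1) (simp add: measurable_cong_sets[OF sets_hausdorff_measure refl])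
    have "emeasure ?D B
      = emeasure (density (restrict_space (hausdorff_measure s) A) (\<lambda>p. ennreal (g p) * ennreal (f p))) B"
      by (subst density_density_eq) (auto intro!: m)
    also have "\<dots> = (\<integral>\<^sup>+p. ennreal (g p) * ennreal (f p) * indicator B p \<partial>restrict_space (hausdorff_measure s) A)"
      using BR by (intro emeasure_density m) auto
    also have "\<dots> = (\<integral>\<^sup>+p. ennreal (g p) * ennreal (f p) * indicator B p * indicator A p \<partial>hausdorff_measure s)"
      using A by (intro nn_integral_restrict_space) auto
    also have "\<dots> = (\<integral>\<^sup>+p. ennreal (\<kappa> * dens \<mu> s p) * indicator (B \<inter> E) p \<partial>hausdorff_measure s)"
    proof (rule nn_integral_cong)
      fix p
      show "ennreal (g p) * ennreal (f p) * indicator B p * indicator A p = ennreal (\<kappa> * dens \<mu> s p) * indicator (B \<inter> E) p"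
      proof (cases "p \<in> B")
        case True
        have "ennreal (g p) * ennreal (f p) = ennreal (g p * f p)"
          using g_nonneg f_nonneg by (simp add: ennreal_mult)
        \<comment> \<open>On B off E either g or the density vanishes. In the first case the first
          factor is 0, in the second f is 0.\<close>
        moreover have "g p * f p = (if p \<in> E then \<kappa> * dens \<mu> s p else 0)"
          using True B g_nonneg[of p] dens_nonneg[of p] by (auto simp: f_def E_def)
        ultimately show ?thesis
          using True B by (auto simp: indicator_def)
      qed auto
    qed
    also have "\<dots> = emeasure \<mu> (B \<inter> E)"
      using B E_sets by (intro rep[symmetric] sets.Int) (simp_all add: E_def)
    also have "\<dots> = emeasure \<mu> B"
      using AE_E B E_sets by (intro emeasure_eq_AE) (auto simp: sets)
    also have "\<dots> = emeasure (restrict_space \<mu> A) B"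
      using A B by (intro emeasure_restrict_space[symmetric]) (auto simp: sets)
    finally show "emeasure ?D B = emeasure (restrict_space \<mu> A) B" .
  qed
  moreover have "lift \<mu> \<rho>X \<rho>Y p = 1 / (pi * \<kappa>) * f p" if "p \<in> A" "lift_defined \<mu> \<rho>X \<rho>Y p" for p
    using rho_tilde_eq_dens[OF s[OF that(1)]] that(2) \<open>\<kappa> > 0\<close>
    by (simp add: lift_def lift_defined_def f_def g_def)
  ultimately show ?thesis
    using f_meas f_nonneg unfolding g_def by blast
qed

theorem theorem1:
  fixes s :: real
  assumes "s = 1 \<or> s = 2"
  shows "\<exists>\<alpha>::real. \<forall>(\<mu> :: (real \<times> real) measure) (\<rho>X :: real \<Rightarrow> real) (\<rho>Y :: real \<Rightarrow> real) (A :: (real \<times> real) set).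
    prob_space \<mu> \<and> sets \<mu> = sets borel \<and>
    (\<forall>x. 0 \<le> \<rho>X x) \<and> \<rho>X \<in> borel_measurable borel \<and>
    (\<forall>y. 0 \<le> \<rho>Y y) \<and> \<rho>Y \<in> borel_measurable borel \<and>
    distr \<mu> lborel fst = density lborel (\<lambda>x. ennreal (\<rho>X x)) \<and>
    distr \<mu> lborel snd = density lborel (\<lambda>y. ennreal (\<rho>Y y)) \<and>
    A \<in> sets borel \<and>
    (\<forall>p\<in>A. s_fun \<mu> p = ereal s) \<and>
    (AE p in \<mu>. p \<in> A \<longrightarrow>
       (\<exists>c>0. ((\<lambda>\<epsilon>. measure \<mu> (ball p \<epsilon>) / \<epsilon> powr s) \<longlongrightarrow> c) (at_right 0))) \<and>
    sigma_finite_measure (restrict_space (hausdorff_measure s) A)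
    \<longrightarrow>
    (\<exists>f :: real \<times> real \<Rightarrow> real.
       f \<in> borel_measurable borel \<and> (\<forall>p\<in>A. 0 \<le> f p) \<and>
       density (density (restrict_space (hausdorff_measure s) A)
                  (\<lambda>p. ennreal (\<rho>X (fst p) * \<rho>Y (snd p)))) (\<lambda>p. ennreal (f p))
         = restrict_space \<mu> A \<and>
       (\<forall>p\<in>A. lift_defined \<mu> \<rho>X \<rho>Y p \<longrightarrow> lift \<mu> \<rho>X \<rho>Y p = \<alpha> * f p))"
proof -
  \<comment> \<open>The order of quantifiers matters: \<kappa> precedes \<mu> and B, so the final
    constant can depend on s alone.\<close>
  have "\<exists>\<kappa>>0. \<forall>(\<mu> :: (real \<times> real) measure) B. finite_measure \<mu> \<longrightarrow> sets \<mu> = sets borel \<longrightarrow>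
      B \<in> sets borel \<longrightarrow> (\<forall>p\<in>B. 0 < dens \<mu> s p) \<longrightarrow>
      emeasure \<mu> B = (\<integral>\<^sup>+p. ennreal (\<kappa> * dens \<mu> s p) * indicator B p \<partial>hausdorff_measure s)"
    using assms
  proof
    assume "s = 1"
    show ?thesis
      unfolding \<open>s = 1\<close>
    proof (intro exI[of _ "1 / 2"] conjI allI impI)
      fix \<mu> :: "(real \<times> real) measure" and B
      assume "finite_measure \<mu>" "sets \<mu> = sets borel" "B \<in> sets borel" "\<forall>p\<in>B. 0 < dens \<mu> 1 p"
      then show "emeasure \<mu> B = (\<integral>\<^sup>+p. ennreal (1 / 2 * dens \<mu> 1 p) * indicator B p \<partial>hausdorff_measure 1)"
        by (intro density_eq_hausdorff_dim_one[of \<mu> B]) blast+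
    qed simp
  next
    assume "s = 2"
    obtain c :: real where "c > 0" and c:
      "\<And>(\<mu> :: (real \<times> real) measure) B. finite_measure \<mu> \<Longrightarrow> sets \<mu> = sets borel \<Longrightarrow>
      B \<in> sets borel \<Longrightarrow> (\<And>p. p \<in> B \<Longrightarrow> 0 < dens \<mu> DIM(real \<times> real) p) \<Longrightarrow>
      emeasure \<mu> B = (\<integral>\<^sup>+p. ennreal (c * dens \<mu> DIM(real \<times> real) p) * indicator B p \<partial>hausdorff_measure DIM(real \<times> real))"
      using density_eq_hausdorff_full_dim by blast
    have dim: "real DIM(real \<times> real) = s"
      using \<open>s = 2\<close> by simp
    show ?thesis
    proof (intro exI[of _ c] conjI allI impI)
      fix \<mu> :: "(real \<times> real) measure" and B
      assume "finite_measure \<mu>" "sets \<mu> = sets borel" "B \<in> sets borel" "\<forall>p\<in>B. 0 < dens \<mu> s p"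
      then show "emeasure \<mu> B = (\<integral>\<^sup>+p. ennreal (c * dens \<mu> s p) * indicator B p \<partial>hausdorff_measure s)"
        by (intro c[of \<mu> B, unfolded dim]) blast+
    qed fact
  qed
  then obtain \<kappa> where "\<kappa> > 0" and \<kappa>: "\<forall>(\<mu> :: (real \<times> real) measure) B. finite_measure \<mu> \<longrightarrow> sets \<mu> = sets borel \<longrightarrow>
      B \<in> sets borel \<longrightarrow> (\<forall>p\<in>B. 0 < dens \<mu> s p) \<longrightarrow>
      emeasure \<mu> B = (\<integral>\<^sup>+p. ennreal (\<kappa> * dens \<mu> s p) * indicator B p \<partial>hausdorff_measure s)"
    by (elim exE conjE)
  show ?thesis
  \<comment> \<open>The lift is \<open>dens\<close> / (\<pi> g) and the derivative is \<kappa>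
    \<open>dens\<close> / g; this is their ratio.\<close>
  proof (intro exI[of _ "1 / (pi * \<kappa>)"] allI impI, elim conjE)
    fix \<mu> :: "(real \<times> real) measure" and \<rho>X \<rho>Y :: "real \<Rightarrow> real" and A :: "(real \<times> real) set"
    assume *: "prob_space \<mu>" "sets \<mu> = sets borel" "\<forall>x. 0 \<le> \<rho>X x" "\<rho>X \<in> borel_measurable borel"
      "\<forall>y. 0 \<le> \<rho>Y y" "\<rho>Y \<in> borel_measurable borel"
      "distr \<mu> lborel fst = density lborel (\<lambda>x. ennreal (\<rho>X x))"
      "distr \<mu> lborel snd = density lborel (\<lambda>y. ennreal (\<rho>Y y))"
      "A \<in> sets borel" "\<forall>p\<in>A. s_fun \<mu> p = ereal s"
      "AE p in \<mu>. p \<in> A \<longrightarrow> (\<exists>c>0. ((\<lambda>\<epsilon>. measure \<mu> (ball p \<epsilon>) / \<epsilon> powr s) \<longlongrightarrow> c) (at_right 0))"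
    have "finite_measure \<mu>"
      using *(1) by (simp add: prob_space_def)
    show "\<exists>f :: real \<times> real \<Rightarrow> real.
       f \<in> borel_measurable borel \<and> (\<forall>p\<in>A. 0 \<le> f p) \<and>
       density (density (restrict_space (hausdorff_measure s) A)
                  (\<lambda>p. ennreal (\<rho>X (fst p) * \<rho>Y (snd p)))) (\<lambda>p. ennreal (f p))
         = restrict_space \<mu> A \<and>
       (\<forall>p\<in>A. lift_defined \<mu> \<rho>X \<rho>Y p \<longrightarrow> lift \<mu> \<rho>X \<rho>Y p = 1 / (pi * \<kappa>) * f p)"
      by (rule lift_radon_nikodym[OF *(1,2) _ *(4) _ *(6-9) _ *(11)[folded has_density_def] \<open>\<kappa> > 0\<close> \<kappa>[rule_format, OF \<open>finite_measure \<mu>\<close> *(2)]])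
        (use * in auto)
  qed
qed

end
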